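(* Let $n\ge2$, $p>1$, $r>0$, $p'=\frac{p}{p-1}$, $m=\frac{p-n}{p-1}$, and $B_r^c=\mathbb{R}^n\setminus\bar B_r$. For every $u\in M_1(r,\infty)$ the following hold. (i) If $m>0$, then $$\left(\int_{B_r^c}\frac{|u|^p}{|x|^{(n-1)p'}}dx\right)^{\frac1{p'}}\left(\int_{B_r^c}\left|\frac{\langle x,\nabla u\rangle}{|x|}\right|^pdx\right)^{\frac1p}\ \ge\ \frac1p\,r^{1-n}\int_{\partial B_r}|u|^p\,dS,$$ and for the functions $u_\alpha(x)=e^{-\alpha|x|^m}$, $\alpha>0$, this inequality becomes an equality. (ii) If $m<0$, then $$\left(\int_{B_r^c}\left|\frac{\langle x,\nabla u\rangle}{|x|}\right|^pdx\right)^{\frac1p}\ \ge\ \frac{|m|}{p'}\left(\int_{B_r^c}\frac{|u|^p}{|x|^p}dx\right)^{\frac1p}+\frac1p\,r^{1-p}\int_{\partial B_r}|u|^p\,dS\left(\int_{B_r^c}\frac{|u|^p}{|x|^p}dx\right)^{-\frac1{p'}},$$ and for the functions $u_k(x)=|x|^{km}$, $k>p'$, this inequality becomes an equality. (iii) If $m=0$ (i.e. $p=n$), then $$\left(\int_{B_r^c}\frac{|u|^n}{|x|^n}dx\right)^{\frac{n-1}n}\left(\int_{B_r^c}\left|\frac{\langle x,\nabla u\rangle}{|x|}\right|^ndx\right)^{\frac1n}\ \ge\ \frac1n\,r^{1-n}\int_{\partial B_r}|u|^n\,dS,$$ and for the functions $u_q(x)=|x|^q$, $q<0$, this inequality becomes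 an equality.
   Context: $B_\rho\subset\mathbb{R}^n$ is the open ball of radius $\rho$ centered at $0$; $\langle\cdot,\cdot\rangle$ is the Euclidean scalar product; $d\sigma=dS$ is surface measure. Functions $u$ are real-valued and weakly differentiable on $B_r^c$, with $$\int_{B_r^c}\left|\frac{\langle x,\nabla u\rangle}{|x|}\right|^pdx<\infty,\qquad \int_{B_r^c}\frac{|u|^p}{|x|^{(n-1)p'}}dx<\infty;$$ values on spheres (including $\partial B_r$) are taken in the sense of traces, i.e. using the representative that is absolutely continuous along almost every ray from the origin. $M_1(r,\infty)$ is the set of such $u$ satisfying, as $R\to\infty$: $R^{1-n}\int_{\partial B_R}|u|^p\,d\sigma\to0$ if $m\ge0$, and $R^{1-p}\int_{\partial B_R}|u|^p\,d\sigma\to0$ if $m<0$. In (ii), if $u=0$ a.e., the last term on the right-hand side is understood as $0$. *)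

theory Defs
  imports "HOL-Analysis.Analysis"
begin

section \<open>Weak derivatives\<close>

definition locally_integrable_on ::
    "('a::euclidean_space \<Rightarrow> 'b::{banach, second_countable_topology}) \<Rightarrow> 'a set \<Rightarrow> bool"
    (infix "locally'_integrable'_on" 50) where
  "f locally_integrable_on \<Omega> \<longleftrightarrow>
     (\<forall>K. compact K \<and> K \<subseteq> \<Omega> \<longrightarrow> set_integrable lebesgue K f)"

definition partial_deriv :: "'n::finite \<Rightarrow> (real ^ 'n \<Rightarrow> real) \<Rightarrow> real ^ 'n \<Rightarrow> real" where
  "partial_deriv i \<phi> x = frechet_derivative \<phi> (at x) (axis i 1)"

text \<open>Test functions are compactly supported and of class C1; for first-order weak derivatives
  these define the same notion as compactly supported functions of class C-infinity
  (cf. Gilbarg--Trudinger, Section 7.3).\<close>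

definition test_function :: "(real ^ 'n::finite) set \<Rightarrow> (real ^ 'n \<Rightarrow> real) \<Rightarrow> bool" where
  "test_function \<Omega> \<phi> \<longleftrightarrow>
     \<phi> differentiable_on UNIV \<and> (\<forall>i. continuous_on UNIV (partial_deriv i \<phi>)) \<and>
     compact (closure {x. \<phi> x \<noteq> 0}) \<and> closure {x. \<phi> x \<noteq> 0} \<subseteq> \<Omega>"

definition is_weak_gradient ::
    "(real ^ 'n::finite) set \<Rightarrow> (real ^ 'n \<Rightarrow> real) \<Rightarrow> (real ^ 'n \<Rightarrow> real ^ 'n) \<Rightarrow> bool" where
  "is_weak_gradient \<Omega> u G \<longleftrightarrow>
     u locally_integrable_on \<Omega> \<and> G locally_integrable_on \<Omega> \<and>
     (\<forall>\<phi> i. test_function \<Omega> \<phi> \<longrightarrow>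
        (LINT x:\<Omega>|lebesgue. u x * partial_deriv i \<phi> x) = - (LINT x:\<Omega>|lebesgue. G x $ i * \<phi> x))"

definition weakly_differentiable_on ::
    "(real ^ 'n::finite \<Rightarrow> real) \<Rightarrow> (real ^ 'n) set \<Rightarrow> bool"
    (infix "weakly'_differentiable'_on" 50) where
  "u weakly_differentiable_on \<Omega> \<longleftrightarrow> (\<exists>G. is_weak_gradient \<Omega> u G)"

text \<open>On an open set the weak gradient is unique up to a null set, so that integrals of it do not
  depend on the choice made here.\<close>

definition weak_gradient ::
    "(real ^ 'n::finite) set \<Rightarrow> (real ^ 'n \<Rightarrow> real) \<Rightarrow> real ^ 'n \<Rightarrow> real ^ 'n" where
  "weak_gradient \<Omega> u = (SOME G. is_weak_gradient \<Omega> u G)"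


section \<open>Surface measure on spheres and traces\<close>

text \<open>The surface measure of a Borel subset A of the sphere of radius R > 0 in dimension n is n/R
  times the Lebesgue measure of the truncated cone of all t x with x in A and 0 < t < 1. As a
  measure this is n/R times the image of Lebesgue measure on the punctured ball under the radial
  projection onto the sphere. It is completed, like Lebesgue measure, because traces are
  in general not Borel measurable.\<close>

definition sphere_measure :: "real \<Rightarrow> (real ^ 'n::finite) measure" where
  "sphere_measure R = completion (scale_measure (ennreal (real CARD('n) / R))
     (distr (restrict_space lborel (ball 0 R - {0})) (restrict_space borel (sphere 0 R))
        (\<lambda>x. (R / norm x) *\<^sub>R x)))"

lemma emeasure_sphere_measure:
  fixes A :: "(real ^ 'n::finite) set"
  assumes R: "R > 0" and A: "A \<in> sets borel" "A \<subseteq> sphere 0 R"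
  shows "emeasure (sphere_measure R) A =
    ennreal (real CARD('n) / R) * emeasure lborel {t *\<^sub>R x | t x. 0 < t \<and> t < 1 \<and> x \<in> A}"
proof -
  define B :: "(real ^ 'n) set" where "B = ball 0 R - {0}"
  define f :: "real ^ 'n \<Rightarrow> real ^ 'n" where "f = (\<lambda>x. (R / norm x) *\<^sub>R x)"
  define S where "S = restrict_space borel (sphere (0 :: real ^ 'n) R)"
  have B: "B \<in> sets borel" by (simp add: B_def)
  have f: "f \<in> measurable (restrict_space lborel B) S"
    unfolding S_def using R
    by (intro measurable_restrict_space2 measurable_restrict_space1)
       (auto simp: f_def B_def space_restrict_space)
  have AS: "A \<in> sets S"
    using A by (auto simp: S_def sets_restrict_space)
  have eq: "f -` A \<inter> B = {t *\<^sub>R x | t x. 0 < t \<and> t < 1 \<and> x \<in> A}" (is "_ = ?C")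
  proof (intro equalityI subsetI)
    fix y assume y: "y \<in> f -` A \<inter> B"
    then have "y = (norm y / R) *\<^sub>R f y" "0 < norm y / R" "norm y / R < 1" "f y \<in> A"
      using R by (auto simp: f_def B_def)
    then show "y \<in> ?C" by blast
  next
    fix y assume "y \<in> ?C"
    then obtain t x where y: "y = t *\<^sub>R x" "0 < t" "t < 1" "x \<in> A" by blast
    with A have nx: "norm x = R" by auto
    with y R have "f y = x" "y \<in> B" by (auto simp: f_def B_def)
    with y show "y \<in> f -` A \<inter> B" by simp
  qed
  have "emeasure (sphere_measure R) A
      = emeasure (scale_measure (ennreal (real CARD('n) / R)) (distr (restrict_space lborel B) S f)) A"
    unfolding sphere_measure_def B_def[symmetric] f_def[symmetric] S_def[symmetric]
    using AS by (intro emeasure_completion[THEN trans] arg_cong2[where f = emeasure] refl)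
                (auto simp: main_part_sets)
  also have "\<dots> = ennreal (real CARD('n) / R) * emeasure (restrict_space lborel B) (f -` A \<inter> B)"
    using AS f by (simp add: emeasure_distr space_restrict_space)
  also have "emeasure (restrict_space lborel B) (f -` A \<inter> B) = emeasure lborel (f -` A \<inter> B)"
    using B by (intro emeasure_restrict_space) auto
  finally show ?thesis unfolding eq .
qed

text \<open>In the following definition the elements (s,t) of D stand for the intervals of a finite
  non-overlapping family.\<close>

definition absolutely_continuous_on_interval :: "real \<Rightarrow> real \<Rightarrow> (real \<Rightarrow> real) \<Rightarrow> bool" where
  "absolutely_continuous_on_interval a b f \<longleftrightarrow>
     (\<forall>\<epsilon>>0. \<exists>\<delta>>0. \<forall>D. finite D \<and> D \<subseteq> {(s, t). a \<le> s \<and> s \<le> t \<and> t \<le> b} \<and>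
        disjoint_family_on (\<lambda>(s, t). {s<..<t}) D \<and> (\<Sum>(s, t)\<in>D. t - s) < \<delta> \<longrightarrow>
        (\<Sum>(s, t)\<in>D. \<bar>f t - f s\<bar>) < \<epsilon>)"

text \<open>The representative of u that is absolutely continuous along almost every ray, up to and
  including the boundary sphere of radius r. Its values on a sphere are the trace of u; they are
  determined up to a null set of that sphere. A representative exists whenever u is
  weakly differentiable on the exterior of the ball and its radial derivative is in L^p there.\<close>

definition is_ray_representative ::
    "real \<Rightarrow> (real ^ 'n::finite \<Rightarrow> real) \<Rightarrow> (real ^ 'n \<Rightarrow> real) \<Rightarrow> bool" where
  "is_ray_representative r u v \<longleftrightarrow>
     (AE x in lebesgue. x \<in> - cball 0 r \<longrightarrow> v x = u x) \<and>
     (AE \<omega> in sphere_measure 1.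
        \<forall>R>r. absolutely_continuous_on_interval r R (\<lambda>t. v (t *\<^sub>R \<omega>)))"

definition ray_trace :: "real \<Rightarrow> (real ^ 'n::finite \<Rightarrow> real) \<Rightarrow> real ^ 'n \<Rightarrow> real" where
  "ray_trace r u = (SOME v. is_ray_representative r u v)"


section \<open>The function class and the integrals of the inequalities\<close>

definition radial_derivative :: "real \<Rightarrow> (real ^ 'n::finite \<Rightarrow> real) \<Rightarrow> real ^ 'n \<Rightarrow> real" where
  "radial_derivative r u x = (x \<bullet> weak_gradient (- cball 0 r) u x) / norm x"

definition conj_exponent :: "real \<Rightarrow> real" where
  "conj_exponent p = p / (p - 1)"

definition M1 :: "real \<Rightarrow> real \<Rightarrow> (real ^ 'n::finite \<Rightarrow> real) set" where
  "M1 p r = {u.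
     let n = real CARD('n); m = (p - n) / (p - 1); p' = conj_exponent p in
     u weakly_differentiable_on (- cball 0 r) \<and>
     set_integrable lebesgue (- cball 0 r) (\<lambda>x. \<bar>radial_derivative r u x\<bar> powr p) \<and>
     set_integrable lebesgue (- cball 0 r) (\<lambda>x. \<bar>u x\<bar> powr p / norm x powr ((n - 1) * p')) \<and>
     ((\<lambda>R. ennreal (R powr (if m \<ge> 0 then 1 - n else 1 - p)) *
           (\<integral>\<^sup>+ x. ennreal (\<bar>ray_trace r u x\<bar> powr p) \<partial>sphere_measure R)) \<longlongrightarrow> 0) at_top}"

definition radial_energy :: "real \<Rightarrow> real \<Rightarrow> (real ^ 'n::finite \<Rightarrow> real) \<Rightarrow> real" where
  "radial_energy p r u = (LINT x:- cball 0 r|lebesgue. \<bar>radial_derivative r u x\<bar> powr p)"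

definition weighted_integral ::
    "real \<Rightarrow> real \<Rightarrow> real \<Rightarrow> (real ^ 'n::finite \<Rightarrow> real) \<Rightarrow> real" where
  "weighted_integral p s r u = (LINT x:- cball 0 r|lebesgue. \<bar>u x\<bar> powr p / norm x powr s)"

definition boundary_integral :: "real \<Rightarrow> real \<Rightarrow> (real ^ 'n::finite \<Rightarrow> real) \<Rightarrow> real" where
  "boundary_integral p r u = (LINT x|sphere_measure r. \<bar>ray_trace r u x\<bar> powr p)"

text \<open>Bochner integrals of non-integrable functions are 0 by convention, so finiteness
  of the integrals whose finiteness is not part of the definition of the class is stated
  separately, by means of the following predicates.\<close>

definition weighted_integrable ::
    "real \<Rightarrow> real \<Rightarrow> real \<Rightarrow> (real ^ 'n::finite \<Rightarrow> real) \<Rightarrow> bool" where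
  "weighted_integrable p s r u \<longleftrightarrow>
     set_integrable lebesgue (- cball 0 r) (\<lambda>x. \<bar>u x\<bar> powr p / norm x powr s)"

definition boundary_integrable :: "real \<Rightarrow> real \<Rightarrow> (real ^ 'n::finite \<Rightarrow> real) \<Rightarrow> bool" where
  "boundary_integrable p r u \<longleftrightarrow> integrable (sphere_measure r) (\<lambda>x. \<bar>ray_trace r u x\<bar> powr p)"

definition boundary_quotient :: "real \<Rightarrow> real \<Rightarrow> (real ^ 'n::finite \<Rightarrow> real) \<Rightarrow> real" where
  "boundary_quotient p r u =
     (if AE x in lebesgue. x \<in> - cball 0 r \<longrightarrow> u x = 0 then 0
      else 1 / p * r powr (1 - p) * boundary_integral p r u *
           weighted_integral p p r u powr (- (1 / conj_exponent p)))"

end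

theory Submission
  imports Defs
begin

text \<open>The inequalities are one-dimensional facts about the rays t \<mapsto> t w with |w| = 1, averaged over the
  directions w. Let v be the representative of u that is absolutely continuous on almost every ray, with
  derivative g along the rays, let F(t) be the integral over the directions of |v(t w)|^p and Q(t) that of
  p |v(t w)|^(p-1) |g(t w)|. On each ray |v|^p has a derivative of absolute value at most
  p |v|^(p-1) |g|, so F(s) \<le> F(t) + \<integral> Q over (s, t) for r \<le> s \<le> t.

  If m \<ge> 0, let t tend to infinity: F(t) tends to 0 by definition of the class, so
  F(r) \<le> \<integral> Q over (r, \<infinity>). In polar coordinates the right-hand side is p times the integral of
  |u|^(p-1) |x|^(1-n) |g| over the exterior domain, and Hoelder's inequality gives (i) and (iii). If m < 0, so
  that p < n, the same argument with the weight t^(n-p) produces on the left the additional term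
  (n - p) \<integral> |u|^p / |x|^p. Before the limit t = R is taken this integral is restricted to |x| \<le> R, where it is
  finite; the inequality itself then bounds it independently of R, so that it is finite
  on the whole exterior domain. Division by its power 1/p' gives (ii).

  The analytic content is that u has such a representative. Testing the weak gradient G with the fields
  y \<phi>(y/s) and integrating over 1 < s < l shows that u(l x) - u(x) is the integral of x \<cdot> G(s x) over
  1 < s < l, for almost every x. Dilations move points along rays, so in polar coordinates this says that on
  almost every ray u is, up to a constant, a primitive of its radial derivative
  g (weak_gradient_dilation, AE_ray_primitive, ray_trace_is_radial_primitive). Since the radial derivative is in L^p
  for the measure t^(n-1) dt, it is integrable down to t = r, so that the trace on the boundary sphere makes sense.

  Equality holds for the functions in the statement because, for each of them, the two factors in Hoelder's
  inequality are proportional and |u| decreases along the rays; it is verified by computing the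
  three integrals, which are elementary for radial functions.\<close>

section \<open>Polar coordinates\<close>

text \<open>The surface measure of the unit sphere, as a Borel measure on the whole space that is concentrated on
  the sphere. In this form functions of a direction need not be restricted to a subspace.\<close>

definition direction_measure :: "'a::euclidean_space measure" where
  "direction_measure =
     scale_measure (ennreal DIM('a)) (distr (restrict_space lborel (ball 0 1 - {0})) borel sgn)"

lemma borel_measurable_sgn_vec [measurable]:
  "(sgn :: 'a::euclidean_space \<Rightarrow> 'a) \<in> borel_measurable borel"
  unfolding sgn_div_norm[abs_def] by measurable

lemma sets_direction_measure [simp, measurable_cong]:
  "sets (direction_measure :: 'a::euclidean_space measure) = sets borel"
  by (simp add: direction_measure_def)

lemma space_direction_measure [simp]:
  "space (direction_measure :: 'a::euclidean_space measure) = UNIV"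
  by (simp add: direction_measure_def space_scale_measure)

lemma nn_integral_direction_measure:
  fixes f :: "'a::euclidean_space \<Rightarrow> ennreal"
  assumes [measurable]: "f \<in> borel_measurable borel"
  shows "(\<integral>\<^sup>+w. f w \<partial>direction_measure) =
    ennreal DIM('a) * (\<integral>\<^sup>+y. f (sgn y) * indicator (ball 0 1 - {0}) y \<partial>lborel)"
  unfolding direction_measure_def
  by (subst nn_integral_scale_measure, simp, subst nn_integral_distr)
     (auto simp: nn_integral_restrict_space measurable_restrict_space1)

lemma finite_direction_measure: "finite_measure (direction_measure :: 'a::euclidean_space measure)"
proof
  have "emeasure (direction_measure :: 'a measure) UNIV = (\<integral>\<^sup>+w. 1 \<partial>(direction_measure :: 'a measure))"
    by simp
  also have "\<dots> = ennreal DIM('a) * emeasure lborel (ball (0::'a) 1 - {0})"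
    by (subst nn_integral_direction_measure) auto
  also have "\<dots> < \<infinity>"
    using order.strict_trans1[OF emeasure_mono[of "ball (0::'a) 1 - {0}" "ball 0 1" lborel]]
      emeasure_lborel_ball_finite[of "0::'a" 1]
    by (auto simp: ennreal_mult_less_top)
  finally show "emeasure (direction_measure :: 'a measure) (space direction_measure) \<noteq> \<infinity>"
    by simp
qed

interpretation direction_measure: finite_measure "direction_measure :: 'a::euclidean_space measure"
  by (rule finite_direction_measure)

interpretation direction_lborel: pair_sigma_finite
  "direction_measure :: 'a::euclidean_space measure" "lborel :: 'b::euclidean_space measure" ..

lemma AE_direction_measure_norm:
  "AE w in (direction_measure :: 'a::euclidean_space measure). norm w = 1"
proof (rule AE_I[where N = "{w. norm w \<noteq> 1}"])
  have "(\<integral>\<^sup>+w. indicator {w::'a. norm w \<noteq> 1} w \<partial>direction_measure) = 0"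
    by (subst nn_integral_direction_measure)
       (auto simp: nn_integral_0_iff_AE norm_sgn indicator_def)
  then show "emeasure direction_measure {w::'a. norm w \<noteq> 1} = 0"
    by (subst (asm) nn_integral_indicator) auto
qed auto

lemma nn_integral_lborel_scaleR:
  fixes f :: "'a::euclidean_space \<Rightarrow> ennreal"
  assumes [measurable]: "f \<in> borel_measurable borel" and c: "c > 0"
  shows "(\<integral>\<^sup>+x. f x \<partial>lborel) = ennreal (c ^ DIM('a)) * (\<integral>\<^sup>+x. f (c *\<^sub>R x) \<partial>lborel)"
  by (subst lborel_affine[of c 0])
     (use c in \<open>auto simp: nn_integral_density nn_integral_distr nn_integral_cmult\<close>)

text \<open>This integral is the radial weight in the proof of the polar coordinate formula.\<close>

lemma nn_integral_tail_power:
  fixes a :: real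
  assumes a: "a > 0" and n: "n > 0"
  shows "(\<integral>\<^sup>+s. ennreal (n * s powr (-n-1)) * indicator {a..} s \<partial>lborel) = ennreal (a powr (-n))"
proof -
  have "((\<lambda>s. - (s powr (-n))) \<longlongrightarrow> - 0) at_top"
    using n by (intro tendsto_minus tendsto_neg_powr filterlim_ident) auto
  then have "(\<integral>\<^sup>+s. ennreal (n * s powr (-n-1)) * indicator {a..} s \<partial>lborel) = ennreal (0 - (- (a powr (-n))))"
    using a n
    by (intro nn_integral_FTC_atLeast) (auto intro!: derivative_eq_intros)
  then show ?thesis by simp
qed

text \<open>Writing the directions as y/|y| with y in the unit ball turns the right-hand side into an integral over
  pairs (y, t). The substitutions t = s |y| and then x = s y transform it into the integral of f(x) |x|^n times
  the integral of n s^(-n-1) over s > |x|, and the latter is |x|^(-n). Only Tonelli's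
  theorem and the behaviour of Lebesgue measure under dilations enter.\<close>

theorem nn_integral_polar:
  fixes f :: "'a::euclidean_space \<Rightarrow> ennreal"
  assumes [measurable]: "f \<in> borel_measurable borel"
  shows "(\<integral>\<^sup>+x. f x \<partial>lborel) =
    (\<integral>\<^sup>+w. (\<integral>\<^sup>+t. f (t *\<^sub>R w) * ennreal (t ^ (DIM('a) - 1)) * indicator {0<..} t \<partial>lborel) \<partial>direction_measure)"
proof -
  define n where "n = DIM('a)"
  let ?X = "\<lambda>s x. f x * ennreal (norm x ^ n) * ennreal (s powr (-real n-1)) * (if norm x < s then 1 else 0)"
  let ?T = "\<lambda>y t. f (t *\<^sub>R sgn y) * ennreal (t ^ (n - 1)) * indicator {0<..} t"
  let ?Y = "\<lambda>y s. f (s *\<^sub>R y) * ennreal (s ^ (n - 1) * norm y ^ n) * indicator {0<..} s"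
  have n: "n > 0" by (simp add: n_def)
  define B where "B = ball (0::'a) 1 - {0}"
  have [measurable]: "B \<in> sets borel"
    by (simp add: B_def)
  (* The substitution t = norm y * s on the ray through y. *)
  have eq1: "(\<integral>\<^sup>+t. ?T y t \<partial>lborel)
     = (\<integral>\<^sup>+s. ?Y y s \<partial>lborel)"
    if y: "y \<noteq> 0" for y
  proof -
    have "(\<integral>\<^sup>+t. ?T y t \<partial>lborel)
      = ennreal (norm y) * (\<integral>\<^sup>+s. f ((norm y * s) *\<^sub>R sgn y) * ennreal ((norm y * s) ^ (n - 1)) * indicator {0<..} (norm y * s) \<partial>lborel)"
      using y by (subst nn_integral_real_affine[where c = "norm y" and t = 0]) auto
    also have "\<dots> = (\<integral>\<^sup>+s. ennreal (norm y) * (f ((norm y * s) *\<^sub>R sgn y) * ennreal ((norm y * s) ^ (n - 1)) * indicator {0<..} (norm y * s)) \<partial>lborel)"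
      by (subst nn_integral_cmult) auto
    also have "\<dots> = (\<integral>\<^sup>+s. ?Y y s \<partial>lborel)"
    proof (rule nn_integral_cong)
      fix s :: real
      have "(norm y * s) *\<^sub>R sgn y = s *\<^sub>R y"
        using y by (simp add: sgn_div_norm)
      moreover have "norm y * (norm y * s) ^ (n - 1) = s ^ (n - 1) * norm y ^ n"
        using n by (cases n) (simp_all add: power_mult_distrib)
      then have "s > 0 \<Longrightarrow> ennreal (norm y) * ennreal ((norm y * s) ^ (n - 1)) = ennreal (s ^ (n - 1) * norm y ^ n)"
        by (subst ennreal_mult[symmetric]) auto
      ultimately show "ennreal (norm y) * (f ((norm y * s) *\<^sub>R sgn y) * ennreal ((norm y * s) ^ (n - 1)) * indicator {0<..} (norm y * s)) = ?Y y s"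
        using y by (auto simp: indicator_def zero_less_mult_iff) (metis mult.left_commute)
    qed
    finally show ?thesis .
  qed
  (* The substitution x = s y for fixed s. *)
  have eq2: "(\<integral>\<^sup>+y. ?Y y s * indicator B y \<partial>lborel)
     = (\<integral>\<^sup>+x. ?X s x \<partial>lborel)" 
    (is "?L = ?R") for s :: real
  proof (cases "s > 0")
    case s: True
    have "?R = ennreal (s ^ n) * (\<integral>\<^sup>+y. ?X s (s *\<^sub>R y) \<partial>lborel)"
      unfolding n_def using s by (subst nn_integral_lborel_scaleR[where c = s]) simp_all
    also have "\<dots> = (\<integral>\<^sup>+y. ennreal (s ^ n) * (?X s (s *\<^sub>R y)) \<partial>lborel)"
      by (subst nn_integral_cmult) auto
    also have "\<dots> = ?L"
    proof (intro nn_integral_cong_AE)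
      have "AE y in lborel. y \<noteq> (0::'a)"
        by (rule AE_lborel_singleton)
      then show "AE y in lborel. ennreal (s ^ n) * (?X s (s *\<^sub>R y))
         = ?Y y s * indicator B y"
      proof eventually_elim
        fix y :: 'a assume y: "y \<noteq> 0"
        have "s ^ n * norm (s *\<^sub>R y) ^ n * s powr (-real n-1) = s ^ (n - 1) * norm y ^ n"
          using s n by (cases n) (auto simp: powr_diff powr_minus powr_realpow power_mult_distrib field_simps powr_add power2_eq_square)
        then have *: "ennreal (s ^ n) * ennreal (norm (s *\<^sub>R y) ^ n) * ennreal (s powr (-real n-1)) = ennreal (s ^ (n - 1) * norm y ^ n)"
          using s by (simp only: ennreal_mult[symmetric] zero_le_power norm_ge_zero powr_ge_zero mult_nonneg_nonneg less_imp_le)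
        have **: "(if norm (s *\<^sub>R y) < s then 1 else 0) = (indicator B y :: ennreal)"
          using s y by (auto simp: indicator_def B_def)
        show "ennreal (s ^ n) * (?X s (s *\<^sub>R y))
         = ?Y y s * indicator B y"
          unfolding *[symmetric] ** using s by (simp add: mult_ac)
      qed
    qed
    finally show ?thesis by simp
  next
    case False
    then have "\<not> norm x < s" for x :: 'a
      using norm_ge_zero[of x] by linarith
    then show ?thesis using False by simp
  qed
  have "(\<integral>\<^sup>+w. (\<integral>\<^sup>+t. f (t *\<^sub>R w) * ennreal (t ^ (n - 1)) * indicator {0<..} t \<partial>lborel) \<partial>direction_measure)
    = ennreal n * (\<integral>\<^sup>+y. (\<integral>\<^sup>+t. ?T y t \<partial>lborel) * indicator B y \<partial>lborel)"
    by (subst nn_integral_direction_measure) (auto simp: n_def B_def)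
  also have "(\<integral>\<^sup>+y. (\<integral>\<^sup>+t. ?T y t \<partial>lborel) * indicator B y \<partial>lborel)
    = (\<integral>\<^sup>+y. (\<integral>\<^sup>+s. ?Y y s * indicator B y \<partial>lborel) \<partial>lborel)"
  proof (intro nn_integral_cong)
    fix y
    show "(\<integral>\<^sup>+t. ?T y t \<partial>lborel) * indicator B y
      = (\<integral>\<^sup>+s. ?Y y s * indicator B y \<partial>lborel)"
      using eq1[of y] by (cases "y \<in> B") (simp_all add: B_def)
  qed
  also have "\<dots> = (\<integral>\<^sup>+s. (\<integral>\<^sup>+y. ?Y y s * indicator B y \<partial>lborel) \<partial>lborel)"
    by (rule lborel_pair.Fubini') measurable
  also have "\<dots> = (\<integral>\<^sup>+s. (\<integral>\<^sup>+x. ?X s x \<partial>lborel) \<partial>lborel)"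
    by (simp only: eq2)
  also have "\<dots> = (\<integral>\<^sup>+x. (\<integral>\<^sup>+s. ?X s x \<partial>lborel) \<partial>lborel)"
    by (rule lborel_pair.Fubini') measurable
  also have "ennreal n * \<dots> = (\<integral>\<^sup>+x. ennreal n * (\<integral>\<^sup>+s. ?X s x \<partial>lborel) \<partial>lborel)"
    by (subst nn_integral_cmult) auto
  also have "\<dots> = (\<integral>\<^sup>+x. f x \<partial>lborel)"
  proof (intro nn_integral_cong_AE)
    have "AE x in lborel. x \<noteq> (0::'a)"
      by (rule AE_lborel_singleton)
    then show "AE x in lborel. ennreal n * (\<integral>\<^sup>+s. ?X s x \<partial>lborel) = f x"
    proof eventually_elim
      fix x :: 'a assume x: "x \<noteq> 0"
      have "(\<integral>\<^sup>+s. ?X s x \<partial>lborel)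
         = (\<integral>\<^sup>+s. f x * ennreal (norm x ^ n) * (ennreal (s powr (-real n-1)) * indicator {norm x..} s) \<partial>lborel)"
        using AE_lborel_singleton[of "norm x"]
        by (intro nn_integral_cong_AE) (auto simp: indicator_def ac_simps)
      also have "\<dots> = f x * ennreal (norm x ^ n) * (\<integral>\<^sup>+s. (ennreal (s powr (-real n-1)) * indicator {norm x..} s) \<partial>lborel)"
        by (subst nn_integral_cmult) auto
      also have "ennreal n * \<dots> = f x * ennreal (norm x ^ n) * (ennreal n * (\<integral>\<^sup>+s. (ennreal (s powr (-real n-1)) * indicator {norm x..} s) \<partial>lborel))"
        by (simp add: ac_simps)
      also have "ennreal n * (\<integral>\<^sup>+s. (ennreal (s powr (-real n-1)) * indicator {norm x..} s) \<partial>lborel)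
         = (\<integral>\<^sup>+s. ennreal (n * s powr (-real n-1)) * indicator {norm x..} s \<partial>lborel)"
        by (subst nn_integral_cmult[symmetric]) (auto simp: ennreal_mult ac_simps)
      also have "\<dots> = ennreal (norm x powr (- real n))"
        using x n by (intro nn_integral_tail_power) auto
      also have "f x * ennreal (norm x ^ n) * ennreal (norm x powr (- real n)) = f x"
        using x by (simp add: mult.assoc powr_minus powr_realpow ennreal_mult[symmetric])
      finally show "ennreal n * (\<integral>\<^sup>+s. ?X s x \<partial>lborel) = f x" .
    qed
  qed
  finally show ?thesis by (simp add: n_def)
qed

text \<open>A null set of the whole space meets almost every ray in a null set, because the weight t^(n-1) is positive.\<close>

lemma AE_polar:
  fixes P :: "'a::euclidean_space \<Rightarrow> bool"
  assumes "AE x in lborel. P x"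
  shows "AE w in direction_measure. AE t in lborel. t > 0 \<longrightarrow> P (t *\<^sub>R w)"
proof -
  from assms obtain N where N: "N \<in> null_sets lborel" "{x. \<not> P x} \<subseteq> N"
    by (auto simp: eventually_ae_filter)
  have [measurable]: "N \<in> sets borel"
    using N(1) by (auto simp: null_sets_def)
  have "(\<integral>\<^sup>+x. indicator N x \<partial>lborel) = 0"
    using N(1) by (simp add: null_sets_def)
  then have "AE w in (direction_measure :: 'a measure).
      (\<integral>\<^sup>+t. indicator N (t *\<^sub>R w) * ennreal (t ^ (DIM('a) - 1)) * indicator {0<..} t \<partial>lborel) = 0"
    by (subst (asm) nn_integral_polar) (auto simp: nn_integral_0_iff_AE)
  then show ?thesis
  proof eventually_elim
    fix w :: 'a
    assume "(\<integral>\<^sup>+t. indicator N (t *\<^sub>R w) * ennreal (t ^ (DIM('a) - 1)) * indicator {0<..} t \<partial>lborel) = 0"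
    then have "AE t in lborel. indicator N (t *\<^sub>R w) * ennreal (t ^ (DIM('a) - 1)) * indicator {0<..} t = 0"
      by (subst (asm) nn_integral_0_iff_AE) auto
    then show "AE t in lborel. t > 0 \<longrightarrow> P (t *\<^sub>R w)"
    proof eventually_elim
      fix t assume "indicator N (t *\<^sub>R w) * ennreal (t ^ (DIM('a) - 1)) * indicator {0<..} t = 0"
      then show "t > 0 \<longrightarrow> P (t *\<^sub>R w)"
        using N(2) zero_less_power[of t "DIM('a) - 1"]
        by (auto simp: indicator_def ennreal_eq_0_iff simp del: zero_less_power split: if_splits)
    qed
  qed
qed

text \<open>The converse of the preceding lemma needs measurability: a set that meets every ray in a
  null set need not be measurable.\<close>

lemma AE_polarI:
  fixes P :: "'a::euclidean_space \<Rightarrow> bool"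
  assumes [measurable]: "Measurable.pred borel P"
    and AE: "AE w in direction_measure. AE t in lborel. t > 0 \<longrightarrow> P (t *\<^sub>R w)"
  shows "AE x in lborel. P x"
proof -
  let ?N = "{x. \<not> P x}"
  let ?I = "\<lambda>w. \<integral>\<^sup>+t. indicator ?N (t *\<^sub>R w) * ennreal (t ^ (DIM('a) - 1)) * indicator {0<..} t \<partial>lborel"
  have "(\<integral>\<^sup>+w. (?I w) \<partial>(direction_measure :: 'a measure)) =
     (\<integral>\<^sup>+w. 0 \<partial>(direction_measure :: 'a measure))"
  proof (intro nn_integral_cong_AE)
    show "AE w in (direction_measure :: 'a measure). (?I w) = 0"
      using AE
    proof eventually_elim
      fix w :: 'a assume "AE t in lborel. t > 0 \<longrightarrow> P (t *\<^sub>R w)"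
      then have "(?I w) = (\<integral>\<^sup>+t. 0 \<partial>(lborel :: real measure))"
        by (intro nn_integral_cong_AE) (auto simp: indicator_def elim: eventually_mono)
      then show "(?I w) = 0"
        by simp
    qed
  qed
  then have "(\<integral>\<^sup>+x. indicator ?N x \<partial>lborel) = 0"
    by (subst nn_integral_polar) auto
  then have "AE x in lborel. indicator ?N x = (0::ennreal)"
    by (subst (asm) nn_integral_0_iff_AE) auto
  then show ?thesis
    by eventually_elim (auto simp: indicator_def split: if_splits)
qed

section \<open>Surface measure on spheres\<close>

text \<open>The uncompleted surface measure of the sphere of radius R is the image of the measure of directions under
  multiplication by R, up to the factor R^(n-1). Its definition is spelled out because only the completion
  has a name.\<close>

lemma sphere_measure_eq_completion:
  fixes R :: real
  defines "S \<equiv> scale_measure (ennreal (real CARD('n::finite) / R))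
     (distr (restrict_space lborel (ball (0 :: real ^ 'n) R - {0})) (restrict_space borel (sphere 0 R))
        (\<lambda>x. (R / norm x) *\<^sub>R x))"
  assumes R: "R > 0"
  shows "sphere_measure R = completion S" "sets S = sets (restrict_space borel (sphere 0 R))"
    "space S = sphere 0 R"
    "\<And>f. f \<in> borel_measurable borel \<Longrightarrow> (\<integral>\<^sup>+x. f x \<partial>S) =
       ennreal (R ^ (CARD('n) - 1)) * (\<integral>\<^sup>+w. f (R *\<^sub>R w) \<partial>direction_measure)"
proof -
  show "sphere_measure R = completion S" "sets S = sets (restrict_space borel (sphere 0 R))"
    "space S = sphere 0 R"
    by (simp_all add: sphere_measure_def S_def space_scale_measure space_restrict_space)
  fix f :: "real ^ 'n \<Rightarrow> ennreal" assume [measurable]: "f \<in> borel_measurable borel"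
  define n where "n = CARD('n)"
  have n: "n > 0" by (simp add: n_def)
  define B where "B = ball (0 :: real ^ 'n) R - {0}"
  have [measurable]: "B \<in> sets borel" by (simp add: B_def)
  have m: "(\<lambda>x. (R / norm x) *\<^sub>R x) \<in> measurable (restrict_space lborel B) (restrict_space borel (sphere 0 R))"
    using R by (intro measurable_restrict_space2 measurable_restrict_space1)
       (auto simp: B_def space_restrict_space)
  have "(\<integral>\<^sup>+x. f x \<partial>S) = ennreal (n / R) * (\<integral>\<^sup>+x. f ((R / norm x) *\<^sub>R x) * indicator B x \<partial>lborel)"
    unfolding S_def B_def[symmetric] n_def
    by (subst nn_integral_scale_measure, simp add: measurable_restrict_space1, subst nn_integral_distr[OF m])
       (auto simp: nn_integral_restrict_space measurable_restrict_space1)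
  also have "\<dots> = ennreal (n / R) * (ennreal (R ^ n) * (\<integral>\<^sup>+y. f (R *\<^sub>R sgn y) * indicator (ball 0 1 - {0}) y \<partial>lborel))"
  proof -
    have eq: "f ((R / norm (R *\<^sub>R y)) *\<^sub>R R *\<^sub>R y) * indicator B (R *\<^sub>R y) = f (R *\<^sub>R sgn y) * indicator (ball 0 1 - {0}) y" for y
    proof -
      have "(R / norm (R *\<^sub>R y)) *\<^sub>R R *\<^sub>R y = R *\<^sub>R sgn y"
        using R by (simp add: sgn_div_norm) (simp add: divide_inverse)
      then show ?thesis
        using R by (simp add: B_def indicator_def)
    qed
    have "(\<integral>\<^sup>+x. f ((R / norm x) *\<^sub>R x) * indicator B x \<partial>lborel) =
      ennreal (R ^ n) * (\<integral>\<^sup>+y. f ((R / norm (R *\<^sub>R y)) *\<^sub>R R *\<^sub>R y) * indicator B (R *\<^sub>R y) \<partial>lborel)"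
      by (subst nn_integral_lborel_scaleR[OF _ R]) (simp_all add: n_def)
    then show ?thesis
      by (simp only: eq)
  qed
  also have "\<dots> = ennreal (R ^ (n - 1)) * (ennreal n * (\<integral>\<^sup>+y. f (R *\<^sub>R sgn y) * indicator (ball 0 1 - {0}) y \<partial>lborel))"
  proof -
    have "n / R * R ^ n = R ^ (n - 1) * n" using n R by (cases n) auto
    then have "ennreal (n / R) * ennreal (R ^ n) = ennreal (R ^ (n - 1)) * ennreal n"
      using R by (simp flip: ennreal_mult del: ennreal_of_nat_eq_real_of_nat)
    then show ?thesis by (simp only: mult.assoc[symmetric])
  qed
  also have "\<dots> = ennreal (R ^ (CARD('n) - 1)) * (\<integral>\<^sup>+w. f (R *\<^sub>R w) \<partial>direction_measure)"
    by (subst nn_integral_direction_measure) (auto simp: n_def)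
  finally show "(\<integral>\<^sup>+x. f x \<partial>S) = \<dots>" .
qed

lemma nn_integral_sphere_measure:
  fixes f :: "real ^ 'n::finite \<Rightarrow> ennreal"
  assumes "R > 0" "f \<in> borel_measurable borel"
  shows "(\<integral>\<^sup>+x. f x \<partial>sphere_measure R) =
    ennreal (R ^ (CARD('n) - 1)) * (\<integral>\<^sup>+w. f (R *\<^sub>R w) \<partial>direction_measure)"
  using sphere_measure_eq_completion[where 'n = 'n, OF assms(1)] assms(2) by (simp add: nn_integral_completion)

text \<open>Null sets of the completed surface measure are thereby expressed by directions, for arbitrary,
  possibly non-measurable properties such as those of a trace.\<close>

lemma AE_sphere_measure_iff:
  fixes P :: "real ^ 'n::finite \<Rightarrow> bool"
  assumes R: "R > 0"
  shows "(AE x in sphere_measure R. P x) \<longleftrightarrow> (AE w in direction_measure. P (R *\<^sub>R w))"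
proof -
  note S = sphere_measure_eq_completion[where 'n = 'n, OF R]
  let ?S = "scale_measure (ennreal (real CARD('n::finite) / R))
     (distr (restrict_space lborel (ball (0 :: real ^ 'n) R - {0})) (restrict_space borel (sphere 0 R))
        (\<lambda>x. (R / norm x) *\<^sub>R x))"
  show ?thesis
    unfolding S(1) AE_completion_iff
  proof
    assume "AE x in ?S. P x"
    then obtain N where N: "N \<in> sets ?S" "emeasure ?S N = 0" "{x \<in> sphere 0 R. \<not> P x} \<subseteq> N"
      unfolding eventually_ae_filter S(3) null_sets_def by blast
    then have [measurable]: "N \<in> sets borel"
      unfolding S(2) by (auto simp: sets_restrict_space)
    have "(\<integral>\<^sup>+x. indicator N x \<partial>?S) = 0"
      using N(1,2) by (subst nn_integral_indicator)
    then have "(\<integral>\<^sup>+w. indicator N (R *\<^sub>R w) \<partial>direction_measure) = 0"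
      using R by (subst (asm) S(4)) auto
    then have "AE w in direction_measure. indicator N (R *\<^sub>R w) = (0::ennreal)"
      by (subst (asm) nn_integral_0_iff_AE) auto
    with AE_direction_measure_norm show "AE w in direction_measure. P (R *\<^sub>R w)"
    proof eventually_elim
      fix w :: "real ^ 'n" assume "norm w = 1" "indicator N (R *\<^sub>R w) = (0::ennreal)"
      then show "P (R *\<^sub>R w)"
        using subsetD[OF N(3), of "R *\<^sub>R w"] R by (auto simp: indicator_def split: if_splits)
    qed
  next
    assume "AE w in direction_measure. P (R *\<^sub>R w)"
    then obtain N where N: "N \<in> sets borel" "emeasure direction_measure N = 0" "{w. \<not> P (R *\<^sub>R w)} \<subseteq> N"
      unfolding eventually_ae_filter null_sets_def by auto
    define N' where "N' = {x. x /\<^sub>R R \<in> N}"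
    have [measurable]: "N' \<in> sets borel"
      unfolding N'_def using N(1) by measurable
    have "(\<integral>\<^sup>+w. indicator N' (R *\<^sub>R w) \<partial>direction_measure) = (\<integral>\<^sup>+w. indicator N w \<partial>direction_measure)"
      using R by (intro nn_integral_cong) (auto simp: N'_def indicator_def)
    also have "\<dots> = 0" using N by simp
    finally have "(\<integral>\<^sup>+x. indicator N' x \<partial>?S) = 0"
      by (subst S(4)) auto
    moreover have "(\<lambda>x. indicator N' x :: ennreal) \<in> borel_measurable ?S"
      by (subst measurable_cong_sets[OF S(2) refl]) (auto intro: measurable_restrict_space1)
    ultimately have "AE x in ?S. indicator N' x = (0::ennreal)"
      by (subst (asm) nn_integral_0_iff_AE) auto
    then show "AE x in ?S. P x"
    proof eventually_elim
      fix x assume "indicator N' x = (0::ennreal)"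
      then have "x /\<^sub>R R \<notin> N"
        by (auto simp: N'_def indicator_def split: if_splits)
      then have "P (R *\<^sub>R (x /\<^sub>R R))"
        using N(3) by blast
      then show "P x" using R by simp
    qed
  qed
qed

section \<open>Test functions and the fundamental lemma of the calculus of variations\<close>

text \<open>Continuously differentiable functions together with their gradient, in any Euclidean space; for compactly
  supported functions on coordinate space these are the test functions.\<close>

definition C1_gradient :: "('a::euclidean_space \<Rightarrow> real) \<Rightarrow> ('a \<Rightarrow> 'a) \<Rightarrow> bool" where
  "C1_gradient f D \<longleftrightarrow>
     (\<forall>x. (f has_derivative (\<lambda>h. D x \<bullet> h)) (at x)) \<and> continuous_on UNIV D"

lemma C1_gradient_continuous: "C1_gradient f D \<Longrightarrow> continuous_on UNIV f"
  unfolding C1_gradient_def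
  by (auto intro!: continuous_at_imp_continuous_on dest: has_derivative_continuous)

lemma C1_gradient_borel [measurable_dest]:
  assumes "C1_gradient f D"
  shows "f \<in> borel_measurable borel" "D \<in> borel_measurable borel"
  using C1_gradient_continuous[OF assms] assms
  by (auto simp: C1_gradient_def intro: borel_measurable_continuous_onI)

lemma C1_gradient_mult:
  assumes "C1_gradient f D" "C1_gradient g E"
  shows "C1_gradient (\<lambda>x. f x * g x) (\<lambda>x. f x *\<^sub>R E x + g x *\<^sub>R D x)"
  using assms C1_gradient_continuous[OF assms(1)] C1_gradient_continuous[OF assms(2)]
  unfolding C1_gradient_def
  by (auto intro!: derivative_eq_intros continuous_intros simp: fun_eq_iff inner_add_left algebra_simps)

lemma C1_gradient_compose:
  assumes "C1_gradient f D"
    and d: "\<And>x. (g has_real_derivative g' (f x)) (at (f x))" and c: "continuous_on (range f) g'"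
  shows "C1_gradient (\<lambda>x. g (f x)) (\<lambda>x. g' (f x) *\<^sub>R D x)"
proof -
  have "((\<lambda>x. g (f x)) has_derivative (\<lambda>h. (g' (f x) *\<^sub>R D x) \<bullet> h)) (at x)" for x
    using has_derivative_compose[of f "\<lambda>h. D x \<bullet> h" x UNIV g "(*) (g' (f x))"] assms(1) d[of x]
    by (auto simp: C1_gradient_def has_field_derivative_def)
  moreover have "continuous_on UNIV (\<lambda>x. g' (f x))"
    using continuous_on_compose[OF C1_gradient_continuous[OF assms(1)] c] by (simp add: o_def)
  ultimately show ?thesis
    using assms(1) by (auto simp: C1_gradient_def intro!: continuous_intros)
qed

lemma has_real_derivative_max_0_power2:
  "((\<lambda>s::real. (max 0 s)\<^sup>2) has_real_derivative 2 * max 0 s) (at s)"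
proof -
  consider "s < 0" | "s > 0" | "s = 0" by linarith
  then show ?thesis
  proof cases
    case 1
    have "((\<lambda>s::real. 0) has_real_derivative 2 * max 0 s) (at s)"
      using 1 by (auto intro!: derivative_eq_intros)
    then show ?thesis
      by (rule has_field_derivative_transform_within_open[where S = "{..<0}"]) (use 1 in auto)
  next
    case 2
    have "((\<lambda>s::real. s\<^sup>2) has_real_derivative 2 * max 0 s) (at s)"
      using 2 by (auto intro!: derivative_eq_intros)
    then show ?thesis
      by (rule has_field_derivative_transform_within_open[where S = "{0<..}"]) (use 2 in auto)
  next
    case 3
    have "((\<lambda>h::real. (max 0 h)\<^sup>2 / h) \<longlongrightarrow> 0) (at 0)"
    proof (rule tendsto_0_le[where K = 1])
      show "((\<lambda>h::real. h) \<longlongrightarrow> 0) (at 0)" by (rule tendsto_ident_at)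
      show "\<forall>\<^sub>F h in at 0. norm ((max 0 h)\<^sup>2 / h) \<le> norm (h::real) * 1"
        by (auto simp: max_def power2_eq_square intro!: always_eventually)
    qed
    then show ?thesis using 3 by (simp add: DERIV_def)
  qed
qed

text \<open>The squared positive part is continuously differentiable. Composed with affine functions it
  yields functions that are positive exactly on a half-space, and composed with r^2 - |x - c|^2 one that is positive
  exactly on a ball.\<close>

lemma C1_gradient_halfspace:
  "C1_gradient (\<lambda>x. (max 0 (a - x \<bullet> i))\<^sup>2) (\<lambda>x. (2 * max 0 (a - x \<bullet> i)) *\<^sub>R (- i))"
  by (rule C1_gradient_compose[where g = "\<lambda>s. (max 0 s)\<^sup>2" and g' = "\<lambda>s. 2 * max 0 s"])
     (auto intro!: has_real_derivative_max_0_power2 continuous_intros derivative_eq_intros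
        simp: C1_gradient_def inner_commute)

lemma C1_gradient_ball:
  "C1_gradient (\<lambda>x. (max 0 (r\<^sup>2 - (x - c) \<bullet> (x - c)))\<^sup>2)
     (\<lambda>x. (2 * max 0 (r\<^sup>2 - (x - c) \<bullet> (x - c))) *\<^sub>R (- (2 *\<^sub>R (x - c))))"
  by (rule C1_gradient_compose[where g = "\<lambda>s. (max 0 s)\<^sup>2" and g' = "\<lambda>s. 2 * max 0 s"])
     (auto intro!: has_real_derivative_max_0_power2 continuous_intros derivative_eq_intros
        simp: C1_gradient_def inner_commute)

text \<open>As k tends to infinity these functions increase to the indicator function of the set where f is positive.\<close>

lemma C1_gradient_saturate:
  assumes "C1_gradient f D" and nn: "\<And>x. f x \<ge> 0" and k: "(k::real) > 0"
  shows "C1_gradient (\<lambda>x. k * f x / (1 + k * f x)) (\<lambda>x. (k / (1 + k * f x)\<^sup>2) *\<^sub>R D x)"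
proof -
  have pos: "1 + k * s > 0" if "s \<ge> 0" for s using that k by (simp add: add_pos_nonneg)
  have "((\<lambda>s. k * s / (1 + k * s)) has_real_derivative k / (1 + k * f x)\<^sup>2) (at (f x))" for x
    using pos[OF nn[of x]] by (auto intro!: derivative_eq_intros simp: field_simps power2_eq_square)
  moreover have "continuous_on (range f) (\<lambda>s. k / (1 + k * s)\<^sup>2)"
  proof (intro continuous_intros ballI)
    fix s assume "s \<in> range f"
    then have "s \<ge> 0" using nn by auto
    then show "(1 + k * s)\<^sup>2 \<noteq> 0" using pos[of s] by auto
  qed
  ultimately show ?thesis
    by (rule C1_gradient_compose[OF assms(1), where g = "\<lambda>s. k * s / (1 + k * s)" and g' = "\<lambda>s. k / (1 + k * s)\<^sup>2"])
qed

text \<open>The sets on which some nonnegative continuously differentiable function is positive form a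
  system that is closed under intersection (multiply the functions) and generates the Borel sets (it contains the
  half-spaces). On the part of such a set inside the ball the integral of f vanishes, since its indicator is a bounded
  limit of test functions. Hence the integral of f vanishes on every Borel subset of the ball, in particular
  where f is positive and where it is negative.\<close>

lemma fundamental_lemma_ball:
  fixes f :: "'a::euclidean_space \<Rightarrow> real"
  assumes [measurable]: "f \<in> borel_measurable borel" and r: "r > 0"
    and int: "set_integrable lborel (cball c r) f"
    and zero: "\<And>\<phi> D. C1_gradient \<phi> D \<Longrightarrow> (\<And>x. x \<notin> cball c r \<Longrightarrow> \<phi> x = 0) \<Longrightarrow>
      (\<integral>x. f x * \<phi> x \<partial>lborel) = 0"
  shows "AE x in lborel. x \<in> ball c r \<longrightarrow> f x = 0"
proof -
  let ?J = "\<lambda>A. \<integral>x. f x * indicator (A \<inter> ball c r) x \<partial>lborel"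
  have [measurable]: "ball c r \<in> sets borel" by simp
  define G where "G = {{x. P x > 0} | P. (\<exists>D. C1_gradient P D) \<and> (\<forall>x::'a. P x \<ge> (0::real))}"
  define PB where "PB x = (max 0 (r\<^sup>2 - (x - c) \<bullet> (x - c)))\<^sup>2" for x
  have PB_C1: "\<exists>D. C1_gradient PB D"
    unfolding PB_def[abs_def] using C1_gradient_ball by blast
  have PB_pos: "PB x > 0 \<longleftrightarrow> x \<in> ball c r" and PB_nonneg: "PB x \<ge> 0" for x
  proof -
    have "(x - c) \<bullet> (x - c) < r\<^sup>2 \<longleftrightarrow> norm (x - c) < r"
      using r by (simp add: power2_norm_eq_inner[symmetric] power_mono_iff flip: power_less_imp_less_base)
         (meson norm_ge_zero power_less_imp_less_base power_strict_mono zero_less_numeral less_imp_le)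
    then show "PB x > 0 \<longleftrightarrow> x \<in> ball c r"
      by (auto simp: PB_def max_def dist_norm norm_minus_commute)
  qed (simp add: PB_def)
  have int_B: "integrable lborel (\<lambda>x. f x * indicator (cball c r) x)"
    using int by (simp add: set_integrable_def mult.commute)
  have basic0: "(?J A) = 0" if "A \<in> G" for A
  proof -
    from that obtain P D where P: "A = {x. P x > 0}" "C1_gradient P D" "\<And>x. P x \<ge> 0"
      by (auto simp: G_def)
    obtain E where E: "C1_gradient PB E" using PB_C1 by blast
    define Q where "Q x = P x * PB x" for x
    have Q: "C1_gradient Q (\<lambda>x. P x *\<^sub>R E x + PB x *\<^sub>R D x)"
      unfolding Q_def[abs_def] by (rule C1_gradient_mult[OF P(2) E])
    note [measurable] = C1_gradient_borel[OF Q] C1_gradient_borel[OF P(2)]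
    have Qnn: "Q x \<ge> 0" for x using P(3) PB_nonneg by (simp add: Q_def)
    have Qpos: "Q x > 0 \<longleftrightarrow> x \<in> A \<inter> ball c r" for x
      using P(1) P(3)[of x] PB_pos[of x] PB_nonneg[of x] by (auto simp: Q_def zero_less_mult_iff)
    (* Q is positive exactly on the part of A inside the ball. *)
    define \<phi> where "\<phi> k x = real (Suc k) * Q x / (1 + real (Suc k) * Q x)" for k x
    have "(\<integral>x. f x * \<phi> k x \<partial>lborel) = 0" for k
    proof (rule zero)
      show "C1_gradient (\<phi> k) (\<lambda>x. (real (Suc k) / (1 + real (Suc k) * Q x)\<^sup>2) *\<^sub>R (P x *\<^sub>R E x + PB x *\<^sub>R D x))"
        unfolding \<phi>_def by (rule C1_gradient_saturate[OF Q Qnn]) simp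
      show "\<phi> k x = 0" if "x \<notin> cball c r" for x
        using that Qpos[of x] Qnn[of x] by (auto simp: \<phi>_def)
    qed
    moreover have "(\<lambda>k. \<integral>x. f x * \<phi> k x \<partial>lborel) \<longlonglongrightarrow> (?J A)"
    proof (rule integral_dominated_convergence[where w = "\<lambda>x. \<bar>f x * indicator (cball c r) x\<bar>"])
      show "integrable lborel (\<lambda>x. \<bar>f x * indicator (cball c r) x\<bar>)"
        using int_B by (rule integrable_abs)
      show "AE x in lborel. (\<lambda>k. f x * \<phi> k x) \<longlonglongrightarrow> f x * indicator (A \<inter> ball c r) x"
      proof (intro always_eventually allI tendsto_mult_left)
        fix x
        show "(\<lambda>k. \<phi> k x) \<longlonglongrightarrow> indicator (A \<inter> ball c r) x"
        proof (cases "Q x > 0")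
          case True
          have "(\<lambda>k. 1 - 1 / (1 + real (Suc k) * Q x)) \<longlonglongrightarrow> 1 - 0"
            using True
            by (intro tendsto_diff tendsto_const tendsto_divide_0[OF tendsto_const]
                filterlim_at_top_imp_at_infinity filterlim_tendsto_add_at_top[OF tendsto_const]
                filterlim_at_top_mult_tendsto_pos[OF tendsto_const]
                filterlim_compose[OF filterlim_real_sequentially filterlim_Suc])
          moreover have "\<phi> k x = 1 - 1 / (1 + real (Suc k) * Q x)" for k
          proof -
            have "1 + real (Suc k) * Q x > 0" using True by (simp add: add_pos_pos)
            then show ?thesis by (simp add: \<phi>_def field_simps)
          qed
          ultimately show ?thesis using True Qpos[of x] by simp
        next
          case False
          then have "x \<notin> A \<inter> ball c r" "Q x = 0" using Qpos[of x] Qnn[of x] by auto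
          then show ?thesis by (simp add: \<phi>_def)
        qed
      qed
      show "AE x in lborel. norm (f x * \<phi> k x) \<le> \<bar>f x * indicator (cball c r) x\<bar>" for k
      proof (intro always_eventually allI)
        fix x
        have "0 \<le> \<phi> k x" "\<phi> k x \<le> 1" using Qnn[of x] by (auto simp: \<phi>_def divide_le_eq_1 add_pos_nonneg)
        moreover have "\<phi> k x = 0" if "x \<notin> cball c r"
          using that Qpos[of x] Qnn[of x] by (auto simp: \<phi>_def)
        ultimately show "norm (f x * \<phi> k x) \<le> \<bar>f x * indicator (cball c r) x\<bar>"
          by (cases "x \<in> cball c r") (auto simp: abs_mult mult_left_le)
      qed
      show "(\<lambda>x. f x * \<phi> k x) \<in> borel_measurable lborel" for k
        unfolding \<phi>_def by measurable
      have [measurable]: "A \<in> sets borel" unfolding P(1) by measurable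
      show "(\<lambda>x. f x * indicator (A \<inter> ball c r) x) \<in> borel_measurable lborel"
        by measurable
    qed
    ultimately have "(\<lambda>k::nat. 0) \<longlonglongrightarrow> (?J A)"
      by (simp only:)
    then show ?thesis
      by (metis LIMSEQ_const_iff)
  qed
  have int_A: "integrable lborel (\<lambda>x. f x * indicator (A \<inter> ball c r) x)" if [measurable]: "A \<in> sets borel" for A
    by (rule Bochner_Integration.integrable_bound[OF int_B]) (auto simp: indicator_def)
  have G_sub: "G \<subseteq> Pow UNIV" by simp
  have G_UNIV: "UNIV \<in> G"
    unfolding G_def
    by (intro CollectI exI[of _ "\<lambda>_. 1"] conjI exI[of _ "\<lambda>_. 0"]) (simp_all add: C1_gradient_def)
  have "Int_stable G"
  proof (rule Int_stableI)
    fix A A' assume "A \<in> G" "A' \<in> G"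
    then obtain P D P' D' where *: "A = {x. P x > 0}" "C1_gradient P D" "\<And>x. P x \<ge> 0"
      "A' = {x. P' x > 0}" "C1_gradient P' D'" "\<And>x. P' x \<ge> 0"
      unfolding G_def by blast
    have "A \<inter> A' = {x. P x * P' x > 0}"
      using * by (auto simp: zero_less_mult_iff not_less[symmetric])
    then show "A \<inter> A' \<in> G"
      unfolding G_def using C1_gradient_mult[OF *(2,5)] *(3,6)
      by (intro CollectI exI[of _ "\<lambda>x. P x * P' x"]) auto
  qed
  have borel_weak_gradient_measurable_gradient: "sigma_sets UNIV G = sets (borel :: 'a measure)"
  proof
    have "A \<in> sets borel" if "A \<in> G" for A
    proof -
      from that obtain P D where P: "A = {x. P x > 0}" "C1_gradient P D" by (auto simp: G_def)
      note [measurable] = C1_gradient_borel[OF P(2)]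
      show ?thesis unfolding P(1) by measurable
    qed
    then show "sigma_sets UNIV G \<subseteq> sets (borel :: 'a measure)"
      using sets.sigma_sets_subset[of G borel] by (auto simp: space_borel)
    have "{x::'a. x \<bullet> i < a} \<in> G" for a i
      unfolding G_def using C1_gradient_halfspace[of a i]
      by (intro CollectI exI[of _ "\<lambda>x. (max 0 (a - x \<bullet> i))\<^sup>2"]) (auto simp: max_def)
    then have "(\<lambda>(a, i). {x::'a. x \<bullet> i < a}) ` (UNIV \<times> Basis) \<subseteq> G" by auto
    from sigma_sets_mono'[OF this, of UNIV] show "sets (borel :: 'a measure) \<subseteq> sigma_sets UNIV G"
      unfolding borel_eq_halfspace_less by simp
  qed
  have all: "(?J A) = 0" if "A \<in> sets borel" for A
    using \<open>Int_stable G\<close> G_sub that[folded borel_weak_gradient_measurable_gradient]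
  proof (induction rule: sigma_sets_induct_disjoint)
    case (basic A) then show ?case by (rule basic0)
  next
    case empty then show ?case by simp
  next
    case (compl A)
    then have A: "A \<in> sets borel" by (simp add: borel_weak_gradient_measurable_gradient)
    have "(?J (UNIV - A)) =
      (\<integral>x. f x * indicator (UNIV \<inter> ball c r) x - f x * indicator (A \<inter> ball c r) x \<partial>lborel)"
      by (intro Bochner_Integration.integral_cong) (auto simp: indicator_def)
    also have "\<dots> = (?J UNIV) - (?J A)"
      using A by (intro Bochner_Integration.integral_diff int_A) auto
    also have "\<dots> = 0" using compl.IH basic0[OF G_UNIV] by simp
    finally show ?case .
  next
    case (union A)
    have A: "A i \<in> sets borel" for i using union(2) by (auto simp: borel_weak_gradient_measurable_gradient)
    have "(LINT x:(\<Union>i. A i \<inter> ball c r)|lborel. f x) = (\<Sum>i. (LINT x:(A i \<inter> ball c r)|lborel. f x))"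
      using union(1) A int_A[of "\<Union>i. A i"]
      by (intro lebesgue_integral_countable_add)
         (auto simp: disjoint_family_on_def set_integrable_def mult.commute)
    then show ?case
      using union(3) by (simp add: set_lebesgue_integral_def mult.commute)
  qed
  have "AE x in lborel. f x * indicator ({x. f x > 0} \<inter> ball c r) x = 0"
    using all[of "{x. f x > 0}"] int_A[of "{x. f x > 0}"]
    by (subst integral_nonneg_eq_0_iff_AE[symmetric]) (auto simp: indicator_def intro!: always_eventually)
  moreover have "AE x in lborel. - (f x * indicator ({x. f x < 0} \<inter> ball c r) x) = 0"
    using all[of "{x. f x < 0}"] int_A[of "{x. f x < 0}"]
    by (subst integral_nonneg_eq_0_iff_AE[symmetric]) (auto simp: indicator_def intro!: always_eventually)
  ultimately show ?thesis
    by eventually_elim (auto simp: indicator_def split: if_splits)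
qed

text \<open>An open set is a countable union of balls whose closures it contains.\<close>

lemma fundamental_lemma_calculus_of_variations:
  fixes f :: "'a::euclidean_space \<Rightarrow> real"
  assumes [measurable]: "f \<in> borel_measurable borel" and \<Omega>: "open \<Omega>"
    and int: "\<And>K. compact K \<Longrightarrow> K \<subseteq> \<Omega> \<Longrightarrow> set_integrable lborel K f"
    and zero: "\<And>\<phi> D K. C1_gradient \<phi> D \<Longrightarrow> compact K \<Longrightarrow> K \<subseteq> \<Omega> \<Longrightarrow> (\<And>x. x \<notin> K \<Longrightarrow> \<phi> x = 0) \<Longrightarrow>
      (\<integral>x. f x * \<phi> x \<partial>lborel) = 0"
  shows "AE x in lborel. x \<in> \<Omega> \<longrightarrow> f x = 0"
proof -
  have "\<forall>x\<in>\<Omega>. \<exists>r>0. cball x r \<subseteq> \<Omega>"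
    using \<Omega> by (meson open_contains_cball)
  then obtain r where r: "\<And>x. x \<in> \<Omega> \<Longrightarrow> r x > 0 \<and> cball x (r x) \<subseteq> \<Omega>" by metis
  obtain F where F: "F \<subseteq> (\<lambda>x. ball x (r x)) ` \<Omega>" "countable F" "\<Union>F = \<Union>((\<lambda>x. ball x (r x)) ` \<Omega>)"
    using Lindelof[of "(\<lambda>x. ball x (r x)) ` \<Omega>"] by auto
  have "AE x in lborel. \<forall>B\<in>F. x \<in> B \<longrightarrow> f x = 0"
  proof (subst AE_ball_countable[OF F(2)], rule ballI)
    fix B assume "B \<in> F"
    then obtain c where c: "c \<in> \<Omega>" "B = ball c (r c)" using F(1) by auto
    show "AE x in lborel. x \<in> B \<longrightarrow> f x = 0"
      unfolding c(2) using r[OF c(1)]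
      by (intro fundamental_lemma_ball int) (auto intro!: zero[of _ _ "cball c (r c)"])
  qed
  then show ?thesis
  proof eventually_elim
    fix x assume *: "\<forall>B\<in>F. x \<in> B \<longrightarrow> f x = 0"
    show "x \<in> \<Omega> \<longrightarrow> f x = 0"
    proof
      assume "x \<in> \<Omega>"
      then have "x \<in> \<Union>F" unfolding F(3) using r by (auto intro!: bexI[of _ x])
      then show "f x = 0" using * by auto
    qed
  qed
qed

section \<open>Weak gradients and dilations\<close>

lemma C1_gradient_zero_outside:
  assumes "C1_gradient f D" "closed K" "\<And>x. x \<notin> K \<Longrightarrow> f x = 0" "x \<notin> K"
  shows "D x = 0"
proof -
  have "(f has_derivative (\<lambda>h. 0)) (at x)"
    by (rule has_derivative_transform_within_open[of "\<lambda>_. 0" _ _ _ "- K"])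
       (use assms in \<open>auto simp: open_Compl\<close>)
  moreover have "(f has_derivative (\<lambda>h. D x \<bullet> h)) (at x)"
    using assms(1) by (simp add: C1_gradient_def)
  ultimately have "(\<lambda>h. D x \<bullet> h) = (\<lambda>h. 0)"
    by (rule has_derivative_unique[symmetric])
  then have "D x \<bullet> D x = 0" by meson
  then show ?thesis by simp
qed

lemma C1_gradient_scaleR:
  assumes "C1_gradient f D"
  shows "C1_gradient (\<lambda>x. f (c *\<^sub>R x)) (\<lambda>x. c *\<^sub>R D (c *\<^sub>R x))"
proof -
  have "((\<lambda>x. f (c *\<^sub>R x)) has_derivative (\<lambda>h. (c *\<^sub>R D (c *\<^sub>R x)) \<bullet> h)) (at x)" for x
  proof -
    have "((\<lambda>x. c *\<^sub>R x) has_derivative (\<lambda>h. c *\<^sub>R h)) (at x)"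
      by (auto intro!: derivative_eq_intros)
    moreover have "(f has_derivative (\<lambda>h. D (c *\<^sub>R x) \<bullet> h)) (at (c *\<^sub>R x))"
      using assms by (simp add: C1_gradient_def)
    ultimately show ?thesis
      using has_derivative_compose[of "\<lambda>x. c *\<^sub>R x" "\<lambda>h. c *\<^sub>R h" x UNIV f "\<lambda>h. D (c *\<^sub>R x) \<bullet> h"] by simp
  qed
  moreover have "continuous_on UNIV (\<lambda>x. D (c *\<^sub>R x))"
    using assms by (intro continuous_on_compose2[of UNIV D UNIV "\<lambda>x. c *\<^sub>R x"] continuous_intros)
       (simp_all add: C1_gradient_def)
  ultimately show ?thesis
    unfolding C1_gradient_def by (intro conjI allI continuous_on_scaleR continuous_on_const)
qed

lemma C1_gradient_inner: "C1_gradient (\<lambda>x. x \<bullet> i) (\<lambda>_. i)"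
  unfolding C1_gradient_def inner_commute[of i]
  by (intro conjI allI has_derivative_inner_left has_derivative_ident continuous_intros)

lemma integral_lborel_scaleR:
  fixes f :: "'a::euclidean_space \<Rightarrow> real"
  assumes [measurable]: "f \<in> borel_measurable borel" and c: "c > 0"
  shows "(\<integral>x. f x \<partial>lborel) = c ^ DIM('a) * (\<integral>x. f (c *\<^sub>R x) \<partial>lborel)"
  by (subst lborel_affine[of c 0])
     (use c in \<open>auto simp: integral_density integral_distr\<close>)

lemma integrable_lborel_scaleR:
  fixes f :: "'a::euclidean_space \<Rightarrow> real"
  assumes "integrable lborel f" and c: "c > 0"
  shows "integrable lborel (\<lambda>x. f (c *\<^sub>R x))"
proof -
  have [measurable]: "f \<in> borel_measurable borel" using assms(1) by auto
  have "integrable (density (distr lborel borel (\<lambda>x. 0 + c *\<^sub>R x)) (\<lambda>_. ennreal (\<bar>c\<bar> ^ DIM('a)))) f"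
    using assms lborel_affine[of c "0::'a"] by simp
  then show ?thesis
    using c by (subst (asm) integrable_density) (auto simp: integrable_distr_eq)
qed

lemma integrable_mult_continuous_support:
  fixes f :: "'a::euclidean_space \<Rightarrow> real"
  assumes f: "set_integrable lborel K f" and K: "compact K" and h: "continuous_on K h"
    and zero: "\<And>x. x \<notin> K \<Longrightarrow> h x = (0::real)" and [measurable]: "h \<in> borel_measurable borel"
  shows "integrable lborel (\<lambda>x. f x * h x)"
proof -
  obtain C where C: "\<And>x. x \<in> K \<Longrightarrow> \<bar>h x\<bar> \<le> C"
    using compact_imp_bounded[OF compact_continuous_image[OF h K]] by (auto simp: bounded_iff)
  have eq: "f x * h x = (indicator K x *\<^sub>R f x) * h x" for x
    using zero[of x] by (cases "x \<in> K") auto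
  have int: "integrable lborel (\<lambda>x. C * (indicator K x *\<^sub>R f x))"
    using f unfolding set_integrable_def by (rule integrable_mult_right)
  have meas: "(\<lambda>x. indicator K x *\<^sub>R f x) \<in> borel_measurable lborel"
    using f unfolding set_integrable_def by (rule borel_measurable_integrable)
  have bound: "norm ((indicator K x *\<^sub>R f x) * h x) \<le> norm (C * (indicator K x *\<^sub>R f x))" for x
  proof -
    have "\<bar>f x\<bar> * \<bar>h x\<bar> \<le> \<bar>f x\<bar> * \<bar>C\<bar>" if "x \<in> K"
      using C[OF that] by (intro mult_left_mono) auto
    then show ?thesis
      by (simp add: indicator_def abs_mult mult.commute)
  qed
  show ?thesis
    unfolding eq
  proof (rule Bochner_Integration.integrable_bound[OF int])
    show "(\<lambda>x. (indicator K x *\<^sub>R f x) * h x) \<in> borel_measurable lborel"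
      by (intro borel_measurable_times meas) simp
  qed (use bound in simp)
qed

text \<open>The weak gradient with Borel representatives, Lebesgue measure on the Borel sets and gradients instead of
  partial derivatives. Tonelli's theorem and the polar coordinate formula apply to these representatives directly.\<close>

definition borel_weak_gradient ::
    "'a::euclidean_space set \<Rightarrow> ('a \<Rightarrow> real) \<Rightarrow> ('a \<Rightarrow> 'a) \<Rightarrow> bool" where
  "borel_weak_gradient \<Omega> u G \<longleftrightarrow>
     u \<in> borel_measurable borel \<and> G \<in> borel_measurable borel \<and>
     (\<forall>K. compact K \<and> K \<subseteq> \<Omega> \<longrightarrow> set_integrable lborel K u \<and> set_integrable lborel K G) \<and>
     (\<forall>\<phi> D K. C1_gradient \<phi> D \<and> compact K \<and> K \<subseteq> \<Omega> \<and> (\<forall>x. x \<notin> K \<longrightarrow> \<phi> x = 0) \<longrightarrow>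
        (\<forall>i\<in>Basis. (\<integral>x. u x * (D x \<bullet> i) \<partial>lborel) = - (\<integral>x. (G x \<bullet> i) * \<phi> x \<partial>lborel)))"

context
  fixes \<Omega> :: "'a::euclidean_space set" and u G
  assumes wg: "borel_weak_gradient \<Omega> u G"
begin

lemma borel_weak_gradient_measurable_function: "u \<in> borel_measurable borel"
  and borel_weak_gradient_measurable_gradient: "G \<in> borel_measurable borel"
  and borel_weak_gradient_integrable_function: "compact K \<Longrightarrow> K \<subseteq> \<Omega> \<Longrightarrow> set_integrable lborel K u"
  and borel_weak_gradient_integrable_gradient: "compact K \<Longrightarrow> K \<subseteq> \<Omega> \<Longrightarrow> set_integrable lborel K G"
  using wg by (simp_all add: borel_weak_gradient_def)

lemma borel_weak_gradient_identity: "C1_gradient \<phi> D \<Longrightarrow> compact K \<Longrightarrow> K \<subseteq> \<Omega> \<Longrightarrow> (\<And>x. x \<notin> K \<Longrightarrow> \<phi> x = 0) \<Longrightarrow> i \<in> Basis \<Longrightarrow>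
    (\<integral>x. u x * (D x \<bullet> i) \<partial>lborel) = - (\<integral>x. (G x \<bullet> i) * \<phi> x \<partial>lborel)"
  using wg[unfolded borel_weak_gradient_def, THEN conjunct2, THEN conjunct2, THEN conjunct2, rule_format, of \<phi> D K i]
  by simp

text \<open>The weak form of the divergence theorem for the vector field y \<phi>(y), obtained by testing in
  the direction of each basis vector b with the function (y \<cdot> b) \<phi>(y).\<close>

lemma weak_divergence_identity:
  assumes \<phi>: "C1_gradient \<phi> D" and K: "compact K" "K \<subseteq> \<Omega>" and zero: "\<And>x. x \<notin> K \<Longrightarrow> \<phi> x = 0"
  shows "(\<integral>y. u y * (real DIM('a) * \<phi> y + y \<bullet> D y) \<partial>lborel) = - (\<integral>y. (y \<bullet> G y) * \<phi> y \<partial>lborel)"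
proof -
  note [measurable] = C1_gradient_borel[OF \<phi>] borel_weak_gradient_measurable_function borel_weak_gradient_measurable_gradient
  have D0: "D x = 0" if "x \<notin> K" for x
    using C1_gradient_zero_outside[OF \<phi> compact_imp_closed[OF K(1)] zero that] .
  have cont: "continuous_on A \<phi>" "continuous_on A D" for A
    using \<phi> C1_gradient_continuous[OF \<phi>] by (auto simp: C1_gradient_def intro: continuous_on_subset)
  have "(\<integral>y. u y * (real DIM('a) * \<phi> y + y \<bullet> D y) \<partial>lborel)
      = (\<integral>y. (\<Sum>i\<in>Basis. u y * (((y \<bullet> i) *\<^sub>R D y + \<phi> y *\<^sub>R i) \<bullet> i)) \<partial>lborel)"
    by (intro Bochner_Integration.integral_cong refl)
       (simp add: sum_distrib_left[symmetric] inner_add_left sum.distrib euclidean_inner[of _ "D _"])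
  also have "\<dots> = (\<Sum>i\<in>Basis. (\<integral>y. u y * (((y \<bullet> i) *\<^sub>R D y + \<phi> y *\<^sub>R i) \<bullet> i) \<partial>lborel))"
    using D0 zero
    by (intro Bochner_Integration.integral_sum integrable_mult_continuous_support[OF borel_weak_gradient_integrable_function[OF K] K(1)])
       (auto intro!: continuous_intros cont)
  also have "\<dots> = (\<Sum>i\<in>Basis. - (\<integral>y. (G y \<bullet> i) * ((y \<bullet> i) * \<phi> y) \<partial>lborel))"
    using zero by (intro sum.cong refl borel_weak_gradient_identity[OF C1_gradient_mult[OF C1_gradient_inner \<phi>] K]) auto
  also have "\<dots> = - (\<integral>y. (\<Sum>i\<in>Basis. (G y \<bullet> i) * ((y \<bullet> i) * \<phi> y)) \<partial>lborel)"
  proof (subst Bochner_Integration.integral_sum)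
    fix i :: 'a assume "i \<in> Basis"
    have "set_integrable lborel K (\<lambda>y. G y \<bullet> i)"
      using borel_weak_gradient_integrable_gradient[OF K] by (auto simp: set_integrable_def simp flip: inner_scaleR_left)
    then show "integrable lborel (\<lambda>y. (G y \<bullet> i) * ((y \<bullet> i) * \<phi> y))"
      using zero by (intro integrable_mult_continuous_support[OF _ K(1)]) (auto intro!: continuous_intros cont)
  qed (simp add: sum_negf)
  also have "(\<integral>y. (\<Sum>i\<in>Basis. (G y \<bullet> i) * ((y \<bullet> i) * \<phi> y)) \<partial>lborel) = (\<integral>y. (y \<bullet> G y) * \<phi> y \<partial>lborel)"
    by (intro Bochner_Integration.integral_cong refl)
       (simp add: euclidean_inner[of _ "G _"] sum_distrib_left mult_ac)
  finally show ?thesis .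
qed

end

text \<open>All points between K and its dilate by the factor l: the supports of the functions
  \<phi>(y/s) for s between 1 and l lie in this compact set.\<close>

definition dilates :: "real \<Rightarrow> 'a::euclidean_space set \<Rightarrow> 'a set" where
  "dilates l K = (\<lambda>z. fst z *\<^sub>R snd z) ` ({1..l} \<times> K)"

lemma bounded_of_compact_support:
  fixes q :: "'a::euclidean_space \<Rightarrow> real"
  assumes "continuous_on UNIV q" "compact K" "\<And>x. x \<notin> K \<Longrightarrow> q x = 0"
  obtains C where "C \<ge> 0" "\<And>x. \<bar>q x\<bar> \<le> C"
proof -
  have "bounded (q ` K)"
    using assms by (intro compact_imp_bounded compact_continuous_image) (auto intro: continuous_on_subset)
  then obtain C where C: "\<And>x. x \<in> K \<Longrightarrow> \<bar>q x\<bar> \<le> C"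
    by (auto simp: bounded_iff)
  have "\<bar>q x\<bar> \<le> max C 0" for x
    using C[of x] assms(3)[of x] by (cases "x \<in> K") auto
  then show ?thesis using that[of "max C 0"] by auto
qed

context
  fixes \<Omega> :: "'a::euclidean_space set" and u G
  assumes wg: "borel_weak_gradient \<Omega> u G"
    and star: "\<And>x s. x \<in> \<Omega> \<Longrightarrow> s \<ge> 1 \<Longrightarrow> s *\<^sub>R x \<in> \<Omega>"
begin

lemmas borel_weak_gradient_measurable = borel_weak_gradient_measurable_function[OF wg] borel_weak_gradient_measurable_gradient[OF wg]

lemma dilates:
  assumes "compact K" "K \<subseteq> \<Omega>"
  shows "compact (dilates l K)" "dilates l K \<subseteq> \<Omega>" "dilates l K \<in> sets borel"
    "\<And>s x. 1 \<le> s \<Longrightarrow> s \<le> l \<Longrightarrow> x \<in> K \<Longrightarrow> s *\<^sub>R x \<in> dilates l K"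
proof -
  show "compact (dilates l K)"
    unfolding dilates_def using assms
    by (intro compact_continuous_image compact_Times compact_Icc continuous_intros)
  then show "dilates l K \<in> sets borel" by (rule borel_compact)
  show "dilates l K \<subseteq> \<Omega>" using assms(2) star by (auto simp: dilates_def)
  show "\<And>s x. 1 \<le> s \<Longrightarrow> s \<le> l \<Longrightarrow> x \<in> K \<Longrightarrow> s *\<^sub>R x \<in> dilates l K"
    by (force simp: dilates_def)
qed

lemma integrable_inner_gradient:
  assumes "compact K" "K \<subseteq> \<Omega>"
  shows "integrable lborel (\<lambda>y. indicator K y * (y \<bullet> G y))"
proof -
  note [measurable] = borel_weak_gradient_measurable
  have [measurable]: "K \<in> sets borel" using assms(1) by (rule borel_compact)
  obtain C where C: "\<And>x. x \<in> K \<Longrightarrow> norm x \<le> C"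
    using compact_imp_bounded[OF assms(1)] by (auto simp: bounded_iff)
  have int: "integrable lborel (\<lambda>y. C * norm (indicator K y *\<^sub>R G y))"
    using borel_weak_gradient_integrable_gradient[OF wg assms] unfolding set_integrable_def by (intro integrable_mult_right integrable_norm)
  show ?thesis
  proof (rule Bochner_Integration.integrable_bound[OF int])
    have "\<bar>y \<bullet> G y\<bar> \<le> \<bar>C\<bar> * norm (G y)" if "y \<in> K" for y
      using C[OF that] by (intro order_trans[OF Cauchy_Schwarz_ineq2] mult_right_mono) auto
    then show "AE y in lborel. norm (indicator K y * (y \<bullet> G y)) \<le> norm (C * norm (indicator K y *\<^sub>R G y))"
      by (auto simp: indicator_def abs_mult)
  qed measurable
qed

lemma integrable_indicator_Icc: "integrable lborel (indicator {a..b} :: real \<Rightarrow> real)"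
  by (rule integrable_real_indicator) (auto simp: emeasure_lborel_Icc_eq)

text \<open>This is the integrability needed to exchange the integrals over s and x. For fixed s the substitution
  y = s x bounds the inner integral by the integral of |y \<cdot> G(y)| over the dilates of K, uniformly in s.\<close>

lemma integrable_pair_gradient:
  assumes K: "compact K" "K \<subseteq> \<Omega>"
  shows "integrable (lborel \<Otimes>\<^sub>M lborel) (\<lambda>(s, x). indicator {1..l} s * indicator K x * (x \<bullet> G (s *\<^sub>R x)))"
proof -
  note [measurable] = borel_weak_gradient_measurable
  let ?f = "\<lambda>(s, x). indicator {1..l} s * indicator K x * (x \<bullet> G (s *\<^sub>R x)) :: real"
  define F where "F y = \<bar>indicator (dilates l K) y * (y \<bullet> G y)\<bar>" for y
  note dil = dilates[OF K, where l = l]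
  have [measurable]: "dilates l K \<in> sets borel" "K \<in> sets borel"
    using dil K by (auto intro: borel_compact)
  have F: "integrable lborel F"
    unfolding F_def by (intro integrable_abs integrable_inner_gradient dil)
  have Fm [measurable]: "F \<in> borel_measurable borel"
    unfolding F_def by measurable
  have bound: "\<bar>?f (s, x)\<bar> \<le> indicator {1..l} s * F (s *\<^sub>R x)" for s x
  proof (cases "s \<in> {1..l} \<and> x \<in> K")
    case True
    then have "F (s *\<^sub>R x) = s * \<bar>x \<bullet> G (s *\<^sub>R x)\<bar>"
      using dil(4)[of s x] by (simp add: F_def abs_mult)
    moreover have "\<bar>x \<bullet> G (s *\<^sub>R x)\<bar> \<le> s * \<bar>x \<bullet> G (s *\<^sub>R x)\<bar>"
      using True by (intro mult_right_mono[of 1 s, simplified]) auto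
    ultimately show ?thesis using True by simp
  next
    case False
    then have "?f (s, x) = 0" by (auto simp: indicator_def)
    moreover have "0 \<le> indicator {1..l} s * F (s *\<^sub>R x)"
      by (simp add: F_def)
    ultimately show ?thesis by (simp only: abs_zero)
  qed
  have intF: "integrable lborel (\<lambda>x. indicator {1..l} s * F (s *\<^sub>R x))" for s
    by (cases "s \<in> {1..l}") (auto intro!: integrable_lborel_scaleR F)
  have int_s: "integrable lborel (\<lambda>x. ?f (s, x))" for s
  proof (rule Bochner_Integration.integrable_bound[OF intF[of s]])
    show "AE x in lborel. norm (?f (s, x)) \<le> norm (indicator {1..l} s * F (s *\<^sub>R x))"
      unfolding real_norm_def by (intro always_eventually allI order_trans[OF bound abs_ge_self])
    show "(\<lambda>x. ?f (s, x)) \<in> borel_measurable lborel"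
      unfolding prod.case by measurable
  qed
  show ?thesis
  proof (rule lborel_pair.Fubini_integrable)
    show "?f \<in> borel_measurable (lborel \<Otimes>\<^sub>M lborel)" by measurable
    show "AE s in lborel. integrable lborel (\<lambda>x. ?f (s, x))" using int_s by simp
    have int1: "integrable lborel (\<lambda>s::real. indicator {1..l} s * integral\<^sup>L lborel F)"
      by (intro integrable_mult_left integrable_indicator_Icc)
    show "integrable lborel (\<lambda>s. \<integral>x. norm (?f (s, x)) \<partial>lborel)"
    proof (rule Bochner_Integration.integrable_bound[OF int1])
      show "(\<lambda>s. \<integral>x. norm (?f (s, x)) \<partial>lborel) \<in> borel_measurable lborel"
        by measurable
      have "(\<integral>x. norm (?f (s, x)) \<partial>lborel) \<le> indicator {1..l} s * integral\<^sup>L lborel F" for s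
      proof -
        have "(\<integral>x. norm (?f (s, x)) \<partial>lborel) \<le> (\<integral>x. indicator {1..l} s * F (s *\<^sub>R x) \<partial>lborel)"
          using bound[of s] by (intro integral_mono intF integrable_norm int_s) auto
        also have "\<dots> \<le> indicator {1..l} s * integral\<^sup>L lborel F"
        proof (cases "s \<in> {1..l}")
          case True
          have "0 \<le> (\<integral>x. F (s *\<^sub>R x) \<partial>lborel)"
            by (intro integral_nonneg_AE) (simp add: F_def)
          then have "1 * (\<integral>x. F (s *\<^sub>R x) \<partial>lborel) \<le> s ^ DIM('a) * (\<integral>x. F (s *\<^sub>R x) \<partial>lborel)"
            using True by (intro mult_right_mono one_le_power) auto
          also have "\<dots> = integral\<^sup>L lborel F"
            using True by (intro integral_lborel_scaleR[symmetric] Fm) auto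
          finally show ?thesis using True by simp
        qed simp
        finally show ?thesis .
      qed
      then show "AE s in lborel. norm (\<integral>x. norm (?f (s, x)) \<partial>lborel) \<le> norm (indicator {1..l} s * integral\<^sup>L lborel F)"
        by (intro always_eventually allI) (auto intro: order_trans[OF _ abs_ge_self])
    qed
  qed
qed

lemma integrable_pair_function:
  assumes K: "compact K" "K \<subseteq> \<Omega>"
  shows "integrable (lborel \<Otimes>\<^sub>M lborel) (\<lambda>(s::real, y). indicator {1..l} s * (indicator K y * u y))"
proof -
  note [measurable] = borel_weak_gradient_measurable
  have [measurable]: "K \<in> sets borel" using K by (auto intro: borel_compact)
  have u: "integrable lborel (\<lambda>y. indicator K y * u y)"
    using borel_weak_gradient_integrable_function[OF wg K] by (simp add: set_integrable_def)
  show ?thesis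
    by (rule lborel_pair.Fubini_integrable) (auto simp: abs_mult u intro!: integrable_mult_left integrable_indicator_Icc)
qed

text \<open>Apply the weak divergence identity to \<phi>(y/s), multiply by s^(-n-1) and integrate over s from 1 to l. The factor
  that multiplies u(y) on the left is the derivative of - s^(-n) \<phi>(y/s) with respect to s, so its integral
  is \<phi>(y) - l^(-n) \<phi>(y/l), and the substitution y = l x transfers the dilation from \<phi> to u. On the right
  the substitution y = s x removes all powers of s.\<close>

lemma weak_dilation_identity:
  assumes \<phi>: "C1_gradient \<phi> D" and K: "compact K" "K \<subseteq> \<Omega>" and zero: "\<And>x. x \<notin> K \<Longrightarrow> \<phi> x = 0"
    and l: "l \<ge> 1"
  shows "(\<integral>x. (u (l *\<^sub>R x) - u x - (\<integral>s. indicator {1..l} s * (x \<bullet> G (s *\<^sub>R x)) \<partial>lborel)) * \<phi> x \<partial>lborel) = 0"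
proof -
  note [measurable] = borel_weak_gradient_measurable
  define n where "n = DIM('a)"
  define q where "q x = real n * \<phi> x + x \<bullet> D x" for x
  (* The derivative of - inverse s ^ n * \<phi> (inverse s *\<^sub>R y) with respect to s. *)
  define h where "h s y = inverse s ^ (n + 1) * q (inverse s *\<^sub>R y)" for s y
  let ?\<chi> = "indicator {1..l} :: real \<Rightarrow> real"
  let ?g = "\<lambda>s x. ?\<chi> s * (x \<bullet> G (s *\<^sub>R x)) * \<phi> x"
  note [measurable] = C1_gradient_borel[OF \<phi>]
  have D0: "D x = 0" if "x \<notin> K" for x
    using C1_gradient_zero_outside[OF \<phi> compact_imp_closed[OF K(1)] zero that] .
  have cont_\<phi>: "continuous_on A \<phi>" and cont_D: "continuous_on A D" for A
    using \<phi> C1_gradient_continuous[OF \<phi>] by (auto simp: C1_gradient_def intro: continuous_on_subset)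
  have cont_q: "continuous_on A q" for A
    unfolding q_def by (intro continuous_intros cont_\<phi> cont_D)
  have q0: "q x = 0" if "x \<notin> K" for x using zero[OF that] D0[OF that] by (simp add: q_def)
  obtain Cq where Cq: "Cq \<ge> 0" "\<And>x. \<bar>q x\<bar> \<le> Cq"
    using bounded_of_compact_support[OF cont_q K(1) q0] by blast
  obtain C\<phi> where C\<phi>: "C\<phi> \<ge> 0" "\<And>x. \<bar>\<phi> x\<bar> \<le> C\<phi>"
    using bounded_of_compact_support[OF cont_\<phi> K(1) zero] by blast
  note dil = dilates[OF K, where l = l]
  have [measurable]: "dilates l K \<in> sets borel" "K \<in> sets borel"
    using dil K by (auto intro: borel_compact)
  have [measurable]: "q \<in> borel_measurable borel" unfolding q_def by measurable
  have hm [measurable]: "case_prod h \<in> borel_measurable (borel \<Otimes>\<^sub>M borel)"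
    unfolding h_def by measurable
  have h_support: "h s y = 0" if "s \<in> {1..l}" "y \<notin> dilates l K" for s y
    using dil(4)[of s "inverse s *\<^sub>R y"] that q0[of "inverse s *\<^sub>R y"] by (auto simp: h_def)
  have h_bound: "\<bar>h s y\<bar> \<le> Cq" if "s \<in> {1..l}" for s y
  proof -
    have "inverse s ^ (n + 1) \<le> 1" using that by (intro power_le_one) (auto simp: inverse_le_1_iff)
    then have "\<bar>inverse s ^ (n + 1)\<bar> * \<bar>q (inverse s *\<^sub>R y)\<bar> \<le> 1 * Cq"
      using that Cq by (intro mult_mono) auto
    then show ?thesis by (simp add: h_def abs_mult)
  qed
  have int_u: "integrable (lborel \<Otimes>\<^sub>M lborel) (\<lambda>(s, y). ?\<chi> s * (u y * h s y))"
  proof (rule Bochner_Integration.integrable_bound)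
    show "integrable (lborel \<Otimes>\<^sub>M lborel) (\<lambda>z. Cq * (case z of (s, y) \<Rightarrow> ?\<chi> s * (indicator (dilates l K) y * u y)))"
      by (intro integrable_mult_right integrable_pair_function dil)
    show "AE z in lborel \<Otimes>\<^sub>M lborel. norm (case z of (s, y) \<Rightarrow> ?\<chi> s * (u y * h s y))
       \<le> norm (Cq * (case z of (s, y) \<Rightarrow> ?\<chi> s * (indicator (dilates l K) y * u y)))"
    proof (intro always_eventually allI, clarify)
      fix s y
      show "norm (?\<chi> s * (u y * h s y)) \<le> norm (Cq * (?\<chi> s * (indicator (dilates l K) y * u y)))"
        using h_bound[of s y] h_support[of s y] Cq(1) mult_left_mono[of "\<bar>h s y\<bar>" Cq "\<bar>u y\<bar>"]
        by (auto simp: indicator_def abs_mult mult.commute)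
    qed
  qed measurable
  have int_G: "integrable (lborel \<Otimes>\<^sub>M lborel) (\<lambda>(s, x). ?g s x)"
  proof (rule Bochner_Integration.integrable_bound)
    show "integrable (lborel \<Otimes>\<^sub>M lborel) (\<lambda>z. C\<phi> * (case z of (s, x) \<Rightarrow> ?\<chi> s * indicator K x * (x \<bullet> G (s *\<^sub>R x))))"
      by (intro integrable_mult_right integrable_pair_gradient K)
    show "AE z in lborel \<Otimes>\<^sub>M lborel. norm (case z of (s, x) \<Rightarrow> ?g s x)
       \<le> norm (C\<phi> * (case z of (s, x) \<Rightarrow> ?\<chi> s * indicator K x * (x \<bullet> G (s *\<^sub>R x))))"
    proof (intro always_eventually allI, clarify)
      fix s x
      show "norm (?g s x) \<le> norm (C\<phi> * (?\<chi> s * indicator K x * (x \<bullet> G (s *\<^sub>R x))))"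
        using C\<phi>(2)[of x] zero[of x] C\<phi>(1) mult_left_mono[of "\<bar>\<phi> x\<bar>" C\<phi> "\<bar>x \<bullet> G (s *\<^sub>R x)\<bar>"]
        by (auto simp: indicator_def abs_mult mult.commute)
    qed
  qed measurable
  have FTC: "(\<integral>s. ?\<chi> s * h s y \<partial>lborel) = \<phi> y - inverse l ^ n * \<phi> (inverse l *\<^sub>R y)" for y
  proof -
    define F where "F s = - (inverse s ^ n * \<phi> (inverse s *\<^sub>R y))" for s
    have "(\<integral>s. ?\<chi> s *\<^sub>R h s y \<partial>lborel) = F l - F 1"
    proof (rule integral_FTC_atLeastAtMost[OF l])
      fix s assume s: "1 \<le> s" "s \<le> l"
      let ?c = "inverse s *\<^sub>R y"
      have "((\<lambda>s. inverse s *\<^sub>R y) has_derivative (\<lambda>t. (- (inverse s * t * inverse s)) *\<^sub>R y)) (at s)"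
        using s by (intro has_derivative_scaleR_left Deriv.has_derivative_inverse[OF _ has_derivative_ident]) auto
      moreover have "(\<phi> has_derivative (\<lambda>v. D ?c \<bullet> v)) (at ?c)"
        using \<phi> by (simp add: C1_gradient_def)
      ultimately have "((\<lambda>s. \<phi> (inverse s *\<^sub>R y)) has_derivative (\<lambda>t. D ?c \<bullet> ((- (inverse s * t * inverse s)) *\<^sub>R y))) (at s)"
        by (rule has_derivative_compose)
      then have d: "((\<lambda>s. \<phi> (inverse s *\<^sub>R y)) has_real_derivative - (inverse s)\<^sup>2 * (y \<bullet> D ?c)) (at s)"
        unfolding has_field_derivative_def
        by (rule has_derivative_eq_rhs) (simp add: fun_eq_iff power2_eq_square inner_commute mult_ac)
      have "(F has_real_derivative h s y) (at s)"
      proof -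
        obtain k where k: "n = Suc k"
          using DIM_positive[where 'a = 'a] by (cases n) (auto simp: n_def)
        have di: "(inverse has_real_derivative - (inverse s)\<^sup>2) (at s)"
          using s by (auto intro!: derivative_eq_intros simp: power2_eq_square)
        have "(F has_real_derivative - (inverse s ^ n * (- (inverse s)\<^sup>2 * (y \<bullet> D ?c))
            + real n * (- (inverse s)\<^sup>2 * inverse s ^ (n - 1)) * \<phi> ?c)) (at s)"
          unfolding F_def by (rule derivative_eq_intros refl di d | simp)+
        also have "- (inverse s ^ n * (- (inverse s)\<^sup>2 * (y \<bullet> D ?c))
            + real n * (- (inverse s)\<^sup>2 * inverse s ^ (n - 1)) * \<phi> ?c) = h s y"
          unfolding h_def q_def k by (simp add: power2_eq_square algebra_simps)
        finally show ?thesis .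
      qed
      then show "(F has_vector_derivative h s y) (at s within {1..l})"
        by (simp add: has_real_derivative_iff_has_vector_derivative has_vector_derivative_at_within)
    next
      show "continuous_on {1..l} (\<lambda>s. h s y)"
        unfolding h_def by (intro continuous_intros continuous_on_compose2[OF cont_q[of UNIV]]) auto
    qed
    then show ?thesis by (simp add: F_def)
  qed
  have slice: "(\<integral>y. ?\<chi> s * (u y * h s y) \<partial>lborel) = - (\<integral>x. ?g s x \<partial>lborel)" for s
  proof (cases "s \<in> {1..l}")
    case True
    then have s: "s \<ge> 1" by simp
    define \<psi> where "\<psi> y = \<phi> (inverse s *\<^sub>R y)" for y
    define E where "E y = inverse s *\<^sub>R D (inverse s *\<^sub>R y)" for y
    have C1: "C1_gradient \<psi> E"
      unfolding \<psi>_def E_def by (rule C1_gradient_scaleR[OF \<phi>])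
    have supp: "\<psi> y = 0" if "y \<notin> dilates l K" for y
      using dil(4)[of s "inverse s *\<^sub>R y"] that True zero[of "inverse s *\<^sub>R y"] by (auto simp: \<psi>_def)
    have "(\<integral>y. u y * h s y \<partial>lborel) = inverse s ^ (n + 1) * (\<integral>y. u y * (real DIM('a) * \<psi> y + y \<bullet> E y) \<partial>lborel)"
      by (subst integral_mult_right_zero[symmetric], intro Bochner_Integration.integral_cong refl)
         (simp add: h_def q_def \<psi>_def E_def n_def)
    also have "(\<integral>y. u y * (real DIM('a) * \<psi> y + y \<bullet> E y) \<partial>lborel) = - (\<integral>y. (y \<bullet> G y) * \<psi> y \<partial>lborel)"
      by (rule weak_divergence_identity[OF wg C1 dil(1,2) supp])
    also have "(\<integral>y. (y \<bullet> G y) * \<psi> y \<partial>lborel) = s ^ n * (\<integral>x. ((s *\<^sub>R x) \<bullet> G (s *\<^sub>R x)) * \<psi> (s *\<^sub>R x) \<partial>lborel)"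
      unfolding n_def using s by (intro integral_lborel_scaleR) (auto simp: \<psi>_def)
    also have "(\<integral>x. ((s *\<^sub>R x) \<bullet> G (s *\<^sub>R x)) * \<psi> (s *\<^sub>R x) \<partial>lborel) = s * (\<integral>x. (x \<bullet> G (s *\<^sub>R x)) * \<phi> x \<partial>lborel)"
      using s by (subst integral_mult_right_zero[symmetric], intro Bochner_Integration.integral_cong refl)
         (simp add: \<psi>_def)
    also have "inverse s ^ (n + 1) * - (s ^ n * (s * (\<integral>x. (x \<bullet> G (s *\<^sub>R x)) * \<phi> x \<partial>lborel)))
      = - (\<integral>x. (x \<bullet> G (s *\<^sub>R x)) * \<phi> x \<partial>lborel)"
      using s by (simp add: power_inverse field_simps)
    finally show ?thesis using True by simp
  qed simp
  have Iu: "integrable lborel (\<lambda>x. u x * \<phi> x)"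
    by (intro integrable_mult_continuous_support[OF borel_weak_gradient_integrable_function[OF wg K] K(1)] cont_\<phi> zero) auto
  have Iul: "integrable lborel (\<lambda>y. u y * \<phi> (inverse l *\<^sub>R y))"
  proof (rule integrable_mult_continuous_support[OF borel_weak_gradient_integrable_function[OF wg dil(1,2)] dil(1)])
    show "continuous_on (dilates l K) (\<lambda>y. \<phi> (inverse l *\<^sub>R y))"
      by (intro continuous_on_compose2[OF cont_\<phi>[of UNIV]] continuous_intros) auto
    show "\<phi> (inverse l *\<^sub>R y) = 0" if "y \<notin> dilates l K" for y
      using dil(4)[of l "inverse l *\<^sub>R y"] that l zero[of "inverse l *\<^sub>R y"] by auto
  qed measurable
  have Iul': "integrable lborel (\<lambda>x. u (l *\<^sub>R x) * \<phi> x)"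
    using integrable_lborel_scaleR[OF Iul, of l] l by simp
  have IG: "integrable lborel (\<lambda>x. (\<integral>s. ?\<chi> s * (x \<bullet> G (s *\<^sub>R x)) \<partial>lborel) * \<phi> x)"
    using lborel_pair.integrable_snd[OF int_G] by simp
  have "(\<integral>x. u x * \<phi> x \<partial>lborel) - (\<integral>x. u (l *\<^sub>R x) * \<phi> x \<partial>lborel)
     = (\<integral>x. u x * \<phi> x \<partial>lborel) - inverse l ^ n * (\<integral>y. u y * \<phi> (inverse l *\<^sub>R y) \<partial>lborel)"
    using l by (subst (3) integral_lborel_scaleR[where c = l]) (auto simp: n_def power_inverse)
  also have "\<dots> = (\<integral>y. u y * \<phi> y - inverse l ^ n * (u y * \<phi> (inverse l *\<^sub>R y)) \<partial>lborel)"
    using Iu Iul by simp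
  also have "\<dots> = (\<integral>y. (\<integral>s. ?\<chi> s * (u y * h s y) \<partial>lborel) \<partial>lborel)"
  proof (intro Bochner_Integration.integral_cong refl)
    fix y
    have "(\<integral>s. ?\<chi> s * (u y * h s y) \<partial>lborel) = u y * (\<integral>s. ?\<chi> s * h s y \<partial>lborel)"
      by (subst integral_mult_right_zero[symmetric]) (simp add: mult_ac)
    then show "u y * \<phi> y - inverse l ^ n * (u y * \<phi> (inverse l *\<^sub>R y)) = (\<integral>s. ?\<chi> s * (u y * h s y) \<partial>lborel)"
      by (simp only: FTC right_diff_distrib mult.left_commute)
  qed
  also have "\<dots> = (\<integral>s. (\<integral>y. ?\<chi> s * (u y * h s y) \<partial>lborel) \<partial>lborel)"
    by (rule lborel_pair.Fubini_integral[OF int_u])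
  also have "\<dots> = - (\<integral>s. (\<integral>x. ?g s x \<partial>lborel) \<partial>lborel)"
    by (simp only: slice Bochner_Integration.integral_minus)
  also have "(\<integral>s. (\<integral>x. ?g s x \<partial>lborel) \<partial>lborel) = (\<integral>x. (\<integral>s. ?g s x \<partial>lborel) \<partial>lborel)"
    by (rule lborel_pair.Fubini_integral[OF int_G, symmetric])
  also have "\<dots> = (\<integral>x. (\<integral>s. ?\<chi> s * (x \<bullet> G (s *\<^sub>R x)) \<partial>lborel) * \<phi> x \<partial>lborel)"
    by simp
  finally show ?thesis
    using Iu Iul' IG by (simp add: left_diff_distrib)
qed

text \<open>The fundamental theorem of calculus for u along rays, stated without reference to polar coordinates:
  one null set of points x for each factor l.\<close>

theorem weak_gradient_dilation:
  assumes \<Omega>: "open \<Omega>" and l: "l \<ge> 1"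
  shows "AE x in lborel. x \<in> \<Omega> \<longrightarrow> u (l *\<^sub>R x) - u x = (\<integral>s. indicator {1..l} s * (x \<bullet> G (s *\<^sub>R x)) \<partial>lborel)"
proof -
  let ?G = "\<lambda>x. \<integral>s. indicator {1..l} s * (x \<bullet> G (s *\<^sub>R x)) \<partial>lborel"
  note [measurable] = borel_weak_gradient_measurable
  have "AE x in lborel. x \<in> \<Omega> \<longrightarrow> u (l *\<^sub>R x) - u x - (?G x) = 0"
  proof (rule fundamental_lemma_calculus_of_variations[OF _ \<Omega>])
    fix K assume K: "compact K" "K \<subseteq> \<Omega>"
    have [measurable]: "K \<in> sets borel" using K by (auto intro: borel_compact)
    note dil = dilates[OF K, where l = l]
    have "integrable lborel (\<lambda>y. indicator (dilates l K) y * u y)"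
      using borel_weak_gradient_integrable_function[OF wg dil(1,2)] by (simp add: set_integrable_def)
    then have "integrable lborel (\<lambda>x. indicator (dilates l K) (l *\<^sub>R x) * u (l *\<^sub>R x))"
      using l by (intro integrable_lborel_scaleR[where f = "\<lambda>y. indicator (dilates l K) y * u y"]) auto
    then have 1: "integrable lborel (\<lambda>x. indicator K x * u (l *\<^sub>R x))"
    proof (rule Bochner_Integration.integrable_bound)
      show "AE x in lborel. norm (indicator K x * u (l *\<^sub>R x)) \<le> norm (indicator (dilates l K) (l *\<^sub>R x) * u (l *\<^sub>R x))"
        using dil(4)[of l] l by (auto simp: indicator_def)
    qed measurable
    have 2: "integrable lborel (\<lambda>x. indicator K x * u x)"
      using borel_weak_gradient_integrable_function[OF wg K] by (simp add: set_integrable_def)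
    have 3: "integrable lborel (\<lambda>x. indicator K x * (?G x))"
      using lborel_pair.integrable_snd[OF integrable_pair_gradient[OF K, of l]]
      by (simp add: mult.assoc mult.left_commute[of "indicator {1..l} _" "indicator K _"])
    show "set_integrable lborel K (\<lambda>x. u (l *\<^sub>R x) - u x - (?G x))"
      using 1 2 3 by (simp add: set_integrable_def right_diff_distrib)
  qed (use weak_dilation_identity l in \<open>auto\<close>)
  then show ?thesis by eventually_elim auto
qed

end

section \<open>Primitives along rays\<close>

definition ray_integral :: "real \<Rightarrow> ('a::euclidean_space \<Rightarrow> real) \<Rightarrow> 'a \<Rightarrow> real \<Rightarrow> real" where
  "ray_integral r g w t = (\<integral>s. (if r \<le> s \<and> s \<le> t then g (s *\<^sub>R w) else 0) \<partial>lborel)"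

lemma borel_measurable_ray_integral [measurable]:
  assumes [measurable]: "g \<in> borel_measurable borel" "f \<in> borel_measurable M" "h \<in> borel_measurable M"
  shows "(\<lambda>x. ray_integral r g (f x) (h x)) \<in> borel_measurable M"
  unfolding ray_integral_def by measurable

lemma ray_integral_diff:
  assumes "set_integrable lborel {r..t'} (\<lambda>s. g (s *\<^sub>R w))" "r \<le> t" "t \<le> t'"
  shows "ray_integral r g w t' - ray_integral r g w t = (\<integral>s. indicator {t..t'} s * g (s *\<^sub>R w) \<partial>lborel)"
proof -
  have int: "set_integrable lborel {a..b} (\<lambda>s. g (s *\<^sub>R w))" if "r \<le> a" "b \<le> t'" for a b
    by (rule set_integrable_subset[OF assms(1)]) (use that in auto)
  have eq: "ray_integral r g w b = (\<integral>s. indicator {r..b} s * g (s *\<^sub>R w) \<partial>lborel)" for b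
    unfolding ray_integral_def by (intro Bochner_Integration.integral_cong) (auto simp: indicator_def)
  have i: "integrable lborel (\<lambda>s. indicator {a..b} s * g (s *\<^sub>R w))" if "r \<le> a" "b \<le> t'" for a b
    using int[OF that] by (simp add: set_integrable_def)
  have "ray_integral r g w t' - ray_integral r g w t =
      (\<integral>s. indicator {r..t'} s * g (s *\<^sub>R w) - indicator {r..t} s * g (s *\<^sub>R w) \<partial>lborel)"
    unfolding eq using assms by (intro Bochner_Integration.integral_diff[symmetric] i) auto
  also have "\<dots> = (\<integral>s. indicator {t..t'} s * g (s *\<^sub>R w) \<partial>lborel)"
  proof (rule integral_cong_AE)
    show "AE s in lborel. indicator {r..t'} s * g (s *\<^sub>R w) - indicator {r..t} s * g (s *\<^sub>R w) = indicator {t..t'} s * g (s *\<^sub>R w)"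
      using AE_lborel_singleton[of t] by eventually_elim (use assms in \<open>auto simp: indicator_def\<close>)
  qed (use i[of r t'] i[of r t] i[of t t'] assms in \<open>auto intro!: borel_measurable_diff\<close>)
  finally show ?thesis .
qed

lemma AE_lborel_ex_greater:
  fixes r :: real
  assumes "AE t in lborel. P t" "r < r'"
  shows "\<exists>t. r < t \<and> t < r' \<and> P t"
proof (rule ccontr)
  assume "\<not> ?thesis"
  then have "AE t in lborel. t \<notin> {r<..<r'}"
    using assms(1) by (auto elim: eventually_mono)
  then have "{r<..<r'} \<in> null_sets lborel"
    by (subst AE_iff_null_sets) auto
  then show False using assms(2) by (auto simp: null_sets_def)
qed

lemma AE_lborel_swap:
  fixes P :: "'a::euclidean_space \<Rightarrow> 'b::euclidean_space \<Rightarrow> bool"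
  assumes "AE x in lborel. AE y in lborel. P x y"
    and "Measurable.pred (lborel \<Otimes>\<^sub>M lborel) (\<lambda>z. P (fst z) (snd z))"
  shows "AE y in lborel. AE x in lborel. P x y"
  using lborel_pair.AE_commute[of P] assms by (simp add: pred_def)

text \<open>On a ray the L^p condition carries the weight t^(n-1), which is bounded below for t > r; therefore g is
  integrable up to the boundary sphere on almost every ray.\<close>

lemma AE_ray_integrable:
  fixes g :: "'a::euclidean_space \<Rightarrow> real"
  assumes r: "r > 0" and p: "p \<ge> 1" and [measurable]: "g \<in> borel_measurable borel"
    and fin: "(\<integral>\<^sup>+x. ennreal (\<bar>g x\<bar> powr p) * indicator (- cball 0 r) x \<partial>lborel) < \<infinity>"
  shows "AE w in direction_measure. \<forall>R. set_integrable lborel {r..R} (\<lambda>s. g (s *\<^sub>R w))"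
proof -
  let ?K = "\<lambda>w t. ennreal (\<bar>g (t *\<^sub>R w)\<bar> powr p) * indicator (- cball 0 r) (t *\<^sub>R w) * ennreal (t ^ (DIM('a) - 1)) * indicator {0<..} t"
  let ?I = "\<lambda>w. \<integral>\<^sup>+t. ?K w t \<partial>lborel"
  have "(\<integral>\<^sup>+w. ?I w \<partial>(direction_measure :: 'a measure)) < \<infinity>"
    using fin by (subst (asm) nn_integral_polar) auto
  then have "AE w in (direction_measure :: 'a measure). ?I w \<noteq> \<infinity>"
    by (intro nn_integral_PInf_AE) (auto simp: less_top)
  with AE_direction_measure_norm show ?thesis
  proof eventually_elim
    fix w :: 'a assume w: "norm w = 1" and I: "?I w \<noteq> \<infinity>"
    define c where "c = r ^ (DIM('a) - 1)"
    have c: "c > 0" using r by (simp add: c_def)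
    show "\<forall>R. set_integrable lborel {r..R} (\<lambda>s. g (s *\<^sub>R w))"
      unfolding set_integrable_def
    proof (intro allI integrableI_bounded)
      fix R
      show "(\<lambda>s. indicator {r..R} s *\<^sub>R g (s *\<^sub>R w)) \<in> borel_measurable lborel" by measurable
      have "(\<integral>\<^sup>+s. ennreal (norm (indicator {r..R} s *\<^sub>R g (s *\<^sub>R w))) \<partial>lborel)
         \<le> (\<integral>\<^sup>+s. indicator {r..R} s + ennreal (1 / c) * (?K w s) \<partial>lborel)"
      proof (rule nn_integral_mono_AE)
        show "AE s in lborel. ennreal (norm (indicator {r..R} s *\<^sub>R g (s *\<^sub>R w))) \<le>
           indicator {r..R} s + ennreal (1 / c) * (?K w s)"
          using AE_lborel_singleton[of r]
        proof eventually_elim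
          fix s :: real assume "s \<noteq> r"
          show "ennreal (norm (indicator {r..R} s *\<^sub>R g (s *\<^sub>R w))) \<le>
           indicator {r..R} s + ennreal (1 / c) * (?K w s)"
          proof (cases "s \<in> {r..R}")
            case True
            with \<open>s \<noteq> r\<close> have s: "r < s" "s > 0" using r by auto
            let ?a = "\<bar>g (s *\<^sub>R w)\<bar>"
            have "?a \<le> 1 + ?a powr p"
            proof (cases "?a \<le> 1")
              case False
              then have "?a powr 1 \<le> ?a powr p" using p by (intro powr_mono) auto
              then show ?thesis using False by simp
            qed (simp add: add_increasing2)
            also have "?a powr p \<le> 1 / c * (?a powr p * s ^ (DIM('a) - 1))"
            proof -
              have "c \<le> s ^ (DIM('a) - 1)" unfolding c_def using r s by (intro power_mono) auto
              then have "?a powr p * c \<le> ?a powr p * s ^ (DIM('a) - 1)" by (intro mult_left_mono) auto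
              then show ?thesis using c by (simp add: field_simps)
            qed
            finally have "ennreal ?a \<le> ennreal (1 + 1 / c * (?a powr p * s ^ (DIM('a) - 1)))"
              by (intro ennreal_leI) simp
            also have "\<dots> = 1 + ennreal (1 / c) * (ennreal (?a powr p) * ennreal (s ^ (DIM('a) - 1)))"
              using c s by (subst ennreal_plus) (auto simp flip: ennreal_mult)
            finally show ?thesis using True s w by (simp add: indicator_def)
          qed simp
        qed
      qed
      also have "\<dots> = emeasure lborel {r..R} + ennreal (1 / c) * ?I w"
        by (subst nn_integral_add) (auto simp: nn_integral_cmult)
      also have "\<dots> < \<infinity>"
        using I by (auto simp: ennreal_mult_less_top less_top emeasure_lborel_Icc_eq)
      finally show "(\<integral>\<^sup>+s. ennreal (norm (indicator {r..R} s *\<^sub>R g (s *\<^sub>R w))) \<partial>lborel) < \<infinity>" .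
    qed
  qed
qed

text \<open>The dilation theorem holds for almost every x for each l. Exchanging the quantifiers over x and l and
  passing to polar coordinates yields, on almost every ray and for almost every pair of parameters t and
  t' = l t, that u minus the primitive of g takes the same value at t and at t'. Hence this difference is constant.\<close>

theorem AE_ray_primitive:
  fixes u :: "'a::euclidean_space \<Rightarrow> real"
  defines "\<Omega> r \<equiv> - cball (0::'a) r"
  assumes wg: "borel_weak_gradient (\<Omega> r) u G" and r: "r > 0" and p: "p \<ge> 1"
    and g: "\<And>x. g x = (x \<bullet> G x) / norm x"
    and fin: "(\<integral>\<^sup>+x. ennreal (\<bar>g x\<bar> powr p) * indicator (- cball 0 r) x \<partial>lborel) < \<infinity>"
  shows "AE w in direction_measure. \<exists>c. AE t in lborel. t > r \<longrightarrow> u (t *\<^sub>R w) = c + ray_integral r g w t"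
proof -
  note [measurable] = borel_weak_gradient_measurable_function[OF wg] borel_weak_gradient_measurable_gradient[OF wg]
  have gm [measurable]: "g \<in> borel_measurable borel" unfolding g[abs_def] by measurable
  have [measurable]: "\<Omega> r \<in> sets borel" unfolding \<Omega>_def by simp
  have star: "s *\<^sub>R x \<in> \<Omega> r" if "x \<in> \<Omega> r" "s \<ge> 1" for x s
    using that mult_mono[of 1 s "norm x" "norm x"] r by (auto simp: \<Omega>_def)
  define T where "T l x \<longleftrightarrow> (l \<ge> 1 \<longrightarrow> x \<in> \<Omega> r \<longrightarrow> u (l *\<^sub>R x) - u x =
      (\<integral>s. (if 1 \<le> s \<and> s \<le> l then x \<bullet> G (s *\<^sub>R x) else 0) \<partial>lborel))" for l x
  have "AE l in lborel. AE x in lborel. T l x"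
  proof (rule always_eventually, rule allI)
    fix l :: real
    have eq: "(\<integral>s. (if 1 \<le> s \<and> s \<le> l then x \<bullet> G (s *\<^sub>R x) else 0) \<partial>lborel) = (\<integral>s. indicator {1..l} s * (x \<bullet> G (s *\<^sub>R x)) \<partial>lborel)" for x
      by (intro Bochner_Integration.integral_cong) (auto simp: indicator_def)
    show "AE x in lborel. T l x"
      unfolding T_def eq using weak_gradient_dilation[OF wg star, of l]
      by (cases "l \<ge> 1") (auto simp: \<Omega>_def open_Compl)
  qed
  then have "AE x in lborel. AE l in lborel. T l x"
    by (rule AE_lborel_swap) (unfold T_def, measurable)
  then have "AE w in direction_measure. AE t in lborel. t > 0 \<longrightarrow> (AE l in lborel. T l (t *\<^sub>R w))"
    by (rule AE_polar)
  with AE_direction_measure_norm AE_ray_integrable[OF r p gm fin] show ?thesis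
  proof eventually_elim
    fix w :: 'a
    assume w: "norm w = 1" and int: "\<forall>R. set_integrable lborel {r..R} (\<lambda>s. g (s *\<^sub>R w))"
      and AE: "AE t in lborel. t > 0 \<longrightarrow> (AE l in lborel. T l (t *\<^sub>R w))"
    define q where "q t = u (t *\<^sub>R w) - ray_integral r g w t" for t
    have [measurable]: "q \<in> borel_measurable borel" unfolding q_def by measurable
    (* q is u minus the candidate primitive; the dilation theorem compares its values at t and l * t. *)
    have "AE t in lborel. AE t' in lborel. t > r \<longrightarrow> t' \<ge> t \<longrightarrow> q t' = q t"
      using AE
    proof eventually_elim
      fix t assume *: "t > 0 \<longrightarrow> (AE l in lborel. T l (t *\<^sub>R w))"
      show "AE t' in lborel. t > r \<longrightarrow> t' \<ge> t \<longrightarrow> q t' = q t"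
      proof (cases "t > r")
        case True
        with r have t: "t > 0" by simp
        from True w r have tw: "t *\<^sub>R w \<in> \<Omega> r" by (simp add: \<Omega>_def)
        have "AE l in lborel. T l (t *\<^sub>R w)" using * t by simp
        then have "AE l in lborel. l \<ge> 1 \<longrightarrow> q (l * t) = q t"
        proof eventually_elim
          fix l assume **: "T l (t *\<^sub>R w)"
          show "l \<ge> 1 \<longrightarrow> q (l * t) = q t"
          proof
            assume l: "l \<ge> 1"
            have tl: "t \<le> l * t" using l t by simp
            have "ray_integral r g w (l * t) - ray_integral r g w t = (\<integral>s. indicator {t..l * t} s * g (s *\<^sub>R w) \<partial>lborel)"
              using int True tl by (intro ray_integral_diff) auto
            also have "\<dots> = t * (\<integral>s. indicator {t..l * t} (t * s) * g ((t * s) *\<^sub>R w) \<partial>lborel)"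
              using t lborel_integral_real_affine[of t "\<lambda>s. indicator {t..l * t} s * g (s *\<^sub>R w)" 0] by simp
            also have "\<dots> = (\<integral>s. (if 1 \<le> s \<and> s \<le> l then (t *\<^sub>R w) \<bullet> G (s *\<^sub>R t *\<^sub>R w) else 0) \<partial>lborel)"
              using t w by (subst integral_mult_right_zero[symmetric], intro Bochner_Integration.integral_cong refl)
                (auto simp: indicator_def g mult_ac)
            also have "\<dots> = u (l *\<^sub>R t *\<^sub>R w) - u (t *\<^sub>R w)"
              using ** l tw by (simp add: T_def)
            finally show "q (l * t) = q t" by (simp add: q_def)
          qed
        qed
        then have "AE t' in lborel. 0 + (1 / t) * t' \<ge> 1 \<longrightarrow> q ((0 + (1 / t) * t') * t) = q t"
          using t by (intro AE_borel_affine) auto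
        then show ?thesis
          by eventually_elim (use t in \<open>auto simp: field_simps\<close>)
      qed simp
    qed
    (* Exchanging t and t' removes the restriction to t' \<ge> t. *)
    moreover from this have "AE t' in lborel. AE t in lborel. t > r \<longrightarrow> t' \<ge> t \<longrightarrow> q t' = q t"
      by (rule AE_lborel_swap) measurable
    ultimately have "AE t in lborel. AE t' in lborel. t > r \<longrightarrow> t' > r \<longrightarrow> q t' = q t"
    proof eventually_elim
      fix t assume "AE t' in lborel. t > r \<longrightarrow> t' \<ge> t \<longrightarrow> q t' = q t"
        "AE t' in lborel. t' > r \<longrightarrow> t \<ge> t' \<longrightarrow> q t = q t'"
      then show "AE t' in lborel. t > r \<longrightarrow> t' > r \<longrightarrow> q t' = q t"
        by eventually_elim (metis linear)
    qed
    from AE_lborel_ex_greater[OF this, of r "r + 1"]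
    obtain t0 where t0: "t0 > r" "AE t' in lborel. t0 > r \<longrightarrow> t' > r \<longrightarrow> q t' = q t0"
      by auto
    from t0(2) have "AE t in lborel. t > r \<longrightarrow> u (t *\<^sub>R w) = q t0 + ray_integral r g w t"
      by eventually_elim (use t0(1) in \<open>auto simp: q_def\<close>)
    then show "\<exists>c. AE t in lborel. t > r \<longrightarrow> u (t *\<^sub>R w) = c + ray_integral r g w t" by blast
  qed
qed

text \<open>The average over r < t < r + 1 picks the constant of integration measurably.\<close>

definition ray_constant :: "real \<Rightarrow> ('a::euclidean_space \<Rightarrow> real) \<Rightarrow> ('a \<Rightarrow> real) \<Rightarrow> 'a \<Rightarrow> real" where
  "ray_constant r u g w = (\<integral>t. indicator {r<..<r+1} t * (u (t *\<^sub>R w) - ray_integral r g w t) \<partial>lborel)"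

definition ray_primitive :: "real \<Rightarrow> ('a::euclidean_space \<Rightarrow> real) \<Rightarrow> ('a \<Rightarrow> real) \<Rightarrow> 'a \<Rightarrow> real" where
  "ray_primitive r u g x = ray_constant r u g (sgn x) + ray_integral r g (sgn x) (norm x)"

lemma borel_measurable_ray_primitive [measurable]:
  assumes [measurable]: "u \<in> borel_measurable borel" "g \<in> borel_measurable borel"
  shows "ray_primitive r u g \<in> borel_measurable borel"
  unfolding ray_primitive_def[abs_def] ray_constant_def by measurable

lemma ray_primitive_scaleR:
  assumes "norm w = 1" "t > 0"
  shows "ray_primitive r u g (t *\<^sub>R w) = ray_constant r u g w + ray_integral r g w t"
  using assms by (simp add: ray_primitive_def sgn_div_norm)

lemma ray_constant_eq:
  fixes u :: "'a::euclidean_space \<Rightarrow> real"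
  assumes [measurable]: "u \<in> borel_measurable borel" "g \<in> borel_measurable borel"
    and AE: "AE t in lborel. t > r \<longrightarrow> u (t *\<^sub>R w) = c + ray_integral r g w t"
  shows "ray_constant r u g w = c"
proof -
  have "ray_constant r u g w = (\<integral>t. indicator {r<..<r+1} t * c \<partial>lborel)"
    unfolding ray_constant_def
  proof (rule integral_cong_AE)
    show "AE t in lborel. indicator {r<..<r+1} t * (u (t *\<^sub>R w) - ray_integral r g w t) = indicator {r<..<r+1} t * c"
      using AE by eventually_elim (auto simp: indicator_def)
  qed measurable
  also have "\<dots> = c" by simp
  finally show ?thesis .
qed

section \<open>Absolute continuity on an interval\<close>

lemma integral_large_values_tendsto_0:
  fixes h :: "real \<Rightarrow> real"
  assumes h: "integrable lborel h"
  shows "(\<lambda>N::nat. \<integral>x. (if \<bar>h x\<bar> > N then \<bar>h x\<bar> else 0) \<partial>lborel) \<longlonglongrightarrow> 0"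
proof -
  have [measurable]: "h \<in> borel_measurable borel" using h by auto
  have "(\<lambda>N::nat. \<integral>x. (if \<bar>h x\<bar> > N then \<bar>h x\<bar> else 0) \<partial>lborel) \<longlonglongrightarrow> integral\<^sup>L lborel (\<lambda>x::real. 0)"
  proof (rule integral_dominated_convergence[where w = "\<lambda>x. \<bar>h x\<bar>"])
    show "AE x in lborel. (\<lambda>N::nat. if \<bar>h x\<bar> > N then \<bar>h x\<bar> else 0) \<longlonglongrightarrow> 0"
    proof (rule always_eventually, rule allI)
      fix x
      obtain N0 :: nat where "\<bar>h x\<bar> < N0" using reals_Archimedean2 by blast
      then have "\<forall>\<^sub>F N :: nat in sequentially. (if \<bar>h x\<bar> > N then \<bar>h x\<bar> else 0) = 0"
        by (intro eventually_sequentiallyI[of N0]) auto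
      then show "(\<lambda>N::nat. if \<bar>h x\<bar> > N then \<bar>h x\<bar> else 0) \<longlonglongrightarrow> 0"
        by (rule tendsto_eventually)
    qed
  qed (use h in auto)
  then show ?thesis by simp
qed

lemma sum_indicator_disjoint_le:
  assumes "finite D" "disjoint_family_on A D"
  shows "(\<Sum>i\<in>D. indicator (A i) x) \<le> (1 :: real)"
proof (cases "\<exists>i\<in>D. x \<in> A i")
  case True
  then obtain i where i: "i \<in> D" "x \<in> A i" by blast
  then have "(\<Sum>j\<in>D. indicator (A j) x) = (\<Sum>j\<in>D. if j = i then 1 else (0 :: real))"
    using assms(2) by (intro sum.cong) (auto simp: disjoint_family_on_def indicator_def)
  then show ?thesis using assms(1) by simp
next
  case False
  then have "(\<Sum>j\<in>D. indicator (A j) x) = (0 :: real)" by (intro sum.neutral) auto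
  then show ?thesis by simp
qed

text \<open>Split h into the part where |h| > N, whose total integral is less than \<epsilon>/2 for
  large N, and the rest, which contributes at most N times the total length of the intervals.\<close>

lemma absolutely_continuous_on_interval_primitive:
  fixes h :: "real \<Rightarrow> real"
  assumes h: "integrable lborel h"
    and f: "\<And>s t. a \<le> s \<Longrightarrow> s \<le> t \<Longrightarrow> t \<le> b \<Longrightarrow> f t - f s = (\<integral>x. indicator {s..t} x * h x \<partial>lborel)"
  shows "absolutely_continuous_on_interval a b f"
  unfolding absolutely_continuous_on_interval_def
proof (intro allI impI)
  fix \<epsilon> :: real assume e: "\<epsilon> > 0"
  define L where "L N x = (if \<bar>h x\<bar> > real N then \<bar>h x\<bar> else 0)" for N x
  have [measurable]: "h \<in> borel_measurable borel" using h by auto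
  have "\<forall>\<^sub>F N in sequentially. (\<integral>x. L N x \<partial>lborel) < \<epsilon> / 2"
    unfolding L_def using integral_large_values_tendsto_0[OF h] e by (intro order_tendstoD(2)) auto
  then obtain N where N: "(\<integral>x. L N x \<partial>lborel) < \<epsilon> / 2"
    by (auto simp: eventually_sequentially)
  have [measurable]: "L N \<in> borel_measurable borel"
    unfolding L_def by measurable
  have L: "integrable lborel (L N)"
    by (rule Bochner_Integration.integrable_bound[OF integrable_abs[OF h]]) (auto simp: L_def)
  define \<delta> where "\<delta> = \<epsilon> / (2 * (real N + 1))"
  have d: "\<delta> > 0" using e by (simp add: \<delta>_def)
  show "\<exists>\<delta>>0. \<forall>D. finite D \<and> D \<subseteq> {(s, t). a \<le> s \<and> s \<le> t \<and> t \<le> b} \<and>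
        disjoint_family_on (\<lambda>(s, t). {s<..<t}) D \<and> (\<Sum>(s, t)\<in>D. t - s) < \<delta> \<longrightarrow>
        (\<Sum>(s, t)\<in>D. \<bar>f t - f s\<bar>) < \<epsilon>"
  proof (intro exI[of _ \<delta>] conjI allI impI d)
    fix D :: "(real \<times> real) set" assume D: "finite D \<and> D \<subseteq> {(s, t). a \<le> s \<and> s \<le> t \<and> t \<le> b} \<and>
        disjoint_family_on (\<lambda>(s, t). {s<..<t}) D \<and> (\<Sum>(s, t)\<in>D. t - s) < \<delta>"
    define A :: "real \<times> real \<Rightarrow> real set" where "A = (\<lambda>(s, t). {s<..<t})"
    have [measurable]: "A z \<in> sets borel" for z by (simp add: A_def split: prod.split)
    have LA: "integrable lborel (\<lambda>x. indicator (A z) x * L N x)" for z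
      by (rule Bochner_Integration.integrable_bound[OF L]) (auto simp: indicator_def L_def)
    have *: "(case z of (s, t) \<Rightarrow> \<bar>f t - f s\<bar>) \<le> (\<integral>x. indicator (A z) x * L N x \<partial>lborel) + real N * (case z of (s, t) \<Rightarrow> t - s)"
      if "z \<in> D" for z
    proof -
      obtain s t where z: "z = (s, t)" by (cases z)
      with D that have st: "a \<le> s" "s \<le> t" "t \<le> b" by auto
      have NA: "integrable lborel (\<lambda>x. indicator (A z) x * real N)"
        using st by (intro integrable_mult_left integrable_real_indicator) (auto simp: A_def z)
      have "\<bar>f t - f s\<bar> \<le> (\<integral>x. \<bar>indicator {s..t} x * h x\<bar> \<partial>lborel)"
        unfolding f[OF st] by (rule integral_abs_bound)
      also have "\<dots> = (\<integral>x. indicator (A z) x * \<bar>h x\<bar> \<partial>lborel)"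
      proof (rule integral_cong_AE)
        show "AE x in lborel. \<bar>indicator {s..t} x * h x\<bar> = indicator (A z) x * \<bar>h x\<bar>"
          using AE_lborel_singleton[of s] AE_lborel_singleton[of t]
          by eventually_elim (auto simp: A_def z indicator_def)
      qed measurable
      also have "\<dots> \<le> (\<integral>x. indicator (A z) x * L N x + indicator (A z) x * real N \<partial>lborel)"
      proof (rule integral_mono)
        show "integrable lborel (\<lambda>x. indicator (A z) x * \<bar>h x\<bar>)"
          by (rule Bochner_Integration.integrable_bound[OF integrable_abs[OF h]]) (auto simp: indicator_def)
        show "integrable lborel (\<lambda>x. indicator (A z) x * L N x + indicator (A z) x * real N)"
          by (intro Bochner_Integration.integrable_add LA NA)
      qed (auto simp: indicator_def L_def)
      also have "\<dots> = (\<integral>x. indicator (A z) x * L N x \<partial>lborel) + (\<integral>x. indicator (A z) x * real N \<partial>lborel)"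
        by (intro Bochner_Integration.integral_add LA NA)
      also have "(\<integral>x. indicator (A z) x * real N \<partial>lborel) = real N * (t - s)"
        using st by (simp add: A_def z)
      finally show ?thesis by (simp add: z)
    qed
    have "(\<Sum>(s, t)\<in>D. \<bar>f t - f s\<bar>) \<le> (\<Sum>z\<in>D. (\<integral>x. indicator (A z) x * L N x \<partial>lborel) + real N * (case z of (s, t) \<Rightarrow> t - s))"
      by (rule sum_mono) (rule *)
    also have "\<dots> = (\<Sum>z\<in>D. (\<integral>x. indicator (A z) x * L N x \<partial>lborel)) + real N * (\<Sum>(s, t)\<in>D. t - s)"
      by (simp add: sum.distrib sum_distrib_left)
    also have "(\<Sum>z\<in>D. (\<integral>x. indicator (A z) x * L N x \<partial>lborel)) = (\<integral>x. (\<Sum>z\<in>D. indicator (A z) x * L N x) \<partial>lborel)"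
      by (intro Bochner_Integration.integral_sum[symmetric] LA)
    also have "\<dots> \<le> (\<integral>x. L N x \<partial>lborel)"
    proof (rule integral_mono)
      fix x
      have "(\<Sum>z\<in>D. indicator (A z) x) * L N x \<le> 1 * L N x"
        using D by (intro mult_right_mono sum_indicator_disjoint_le) (auto simp: A_def L_def)
      then show "(\<Sum>z\<in>D. indicator (A z) x * L N x) \<le> L N x"
        by (simp add: sum_distrib_right)
    qed (intro Bochner_Integration.integrable_sum LA L)+
    also have "\<dots> < \<epsilon> / 2" by (rule N)
    also have "real N * (\<Sum>(s, t)\<in>D. t - s) \<le> real N * \<delta>"
      using D by (intro mult_left_mono) auto
    also have "real N * \<delta> \<le> \<epsilon> / 2"
      using e by (simp add: \<delta>_def field_simps)
    finally show "(\<Sum>(s, t)\<in>D. \<bar>f t - f s\<bar>) < \<epsilon>" by simp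
  qed
qed

lemma absolutely_continuous_on_interval_right_limit:
  assumes "absolutely_continuous_on_interval a b f" "a \<le> t" "t < b" "\<epsilon> > 0"
  obtains \<delta> where "\<delta> > 0" "\<And>t'. t \<le> t' \<Longrightarrow> t' < t + \<delta> \<Longrightarrow> t' \<le> b \<Longrightarrow> \<bar>f t' - f t\<bar> < \<epsilon>"
proof -
  from assms(1,4) obtain \<delta> where \<delta>: "\<delta> > 0" and
    D: "\<forall>D. finite D \<and> D \<subseteq> {(s, t). a \<le> s \<and> s \<le> t \<and> t \<le> b} \<and>
        disjoint_family_on (\<lambda>(s, t). {s<..<t}) D \<and> (\<Sum>(s, t)\<in>D. t - s) < \<delta> \<longrightarrow>
        (\<Sum>(s, t)\<in>D. \<bar>f t - f s\<bar>) < \<epsilon>"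
    unfolding absolutely_continuous_on_interval_def by blast
  show ?thesis
  proof (rule that[OF \<delta>])
    fix t' assume "t \<le> t'" "t' < t + \<delta>" "t' \<le> b"
    then show "\<bar>f t' - f t\<bar> < \<epsilon>"
      using D[rule_format, of "{(t, t')}"] assms(2) by (auto simp: disjoint_family_on_def)
  qed
qed

text \<open>The values at r itself, and hence the trace on the boundary sphere, are
  determined by the values almost everywhere beyond r.\<close>

lemma absolutely_continuous_AE_eq_imp_eq:
  assumes f: "\<And>R. R > r \<Longrightarrow> absolutely_continuous_on_interval r R f"
    and g: "\<And>R. R > r \<Longrightarrow> absolutely_continuous_on_interval r R g"
    and AE: "AE t in lborel. t > r \<longrightarrow> f t = g t" and t: "t \<ge> r"
  shows "f t = g t"
proof (rule ccontr)
  assume "f t \<noteq> g t"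
  define e where "e = \<bar>f t - g t\<bar> / 2"
  have e: "e > 0" using \<open>f t \<noteq> g t\<close> by (simp add: e_def)
  obtain d1 where d1: "d1 > 0" "\<And>t'. t \<le> t' \<Longrightarrow> t' < t + d1 \<Longrightarrow> t' \<le> t + 1 \<Longrightarrow> \<bar>f t' - f t\<bar> < e"
    using absolutely_continuous_on_interval_right_limit[OF f[of "t + 1"] t _ e] t by auto
  obtain d2 where d2: "d2 > 0" "\<And>t'. t \<le> t' \<Longrightarrow> t' < t + d2 \<Longrightarrow> t' \<le> t + 1 \<Longrightarrow> \<bar>g t' - g t\<bar> < e"
    using absolutely_continuous_on_interval_right_limit[OF g[of "t + 1"] t _ e] t by auto
  obtain t' where t': "t < t'" "t' < t + min 1 (min d1 d2)" "t' > r \<longrightarrow> f t' = g t'"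
    using AE_lborel_ex_greater[OF AE, of t "t + min 1 (min d1 d2)"] d1(1) d2(1) by auto
  have "\<bar>f t' - f t\<bar> < e" "\<bar>g t' - g t\<bar> < e" "f t' = g t'"
    using t' t d1(2)[of t'] d2(2)[of t'] by auto
  then show False
    unfolding e_def by (auto simp: abs_if split: if_splits)
qed

text \<open>A locally integrable function is measurable on the open set because the set is exhausted by
  compact sets.\<close>

lemma lebesgue_AE_eq_borel:
  fixes f :: "'a::euclidean_space \<Rightarrow> real"
  assumes \<Omega>: "open \<Omega>" and f: "\<And>K. compact K \<Longrightarrow> K \<subseteq> \<Omega> \<Longrightarrow> set_integrable lebesgue K f"
  shows "(\<lambda>x. indicator \<Omega> x * f x) \<in> borel_measurable lebesgue"
    and "\<exists>f'\<in>borel_measurable borel. AE x in lborel. x \<in> \<Omega> \<longrightarrow> f x = f' x"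
proof -
  obtain C where C: "\<And>n. compact (C n)" "\<And>n. C n \<subseteq> \<Omega>" "\<And>n. C n \<subseteq> interior (C (Suc n))" "\<Union>(range C) = \<Omega>"
    "\<And>K. \<lbrakk>compact K; K \<subseteq> \<Omega>\<rbrakk> \<Longrightarrow> \<exists>N. \<forall>n\<ge>N. K \<subseteq> (C n)"
    by (rule open_Union_compact_subsets[OF \<Omega>]) (rule that; assumption)
  have "(\<lambda>x. indicator (C n) x * f x) \<in> borel_measurable lebesgue" for n
    using f[OF C(1,2)[of n]] by (auto simp: set_integrable_def)
  then show meas: "(\<lambda>x. indicator \<Omega> x * f x) \<in> borel_measurable lebesgue"
  proof (rule borel_measurable_LIMSEQ_real[rotated])
    fix x
    show "(\<lambda>n. indicator (C n) x * f x) \<longlonglongrightarrow> indicator \<Omega> x * f x"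
    proof (cases "x \<in> \<Omega>")
      case True
      then obtain N where "\<forall>n\<ge>N. {x} \<subseteq> C n" using C(5)[of "{x}"] by auto
      then show ?thesis using True
        by (intro tendsto_eventually eventually_sequentiallyI[of N]) auto
    next
      case False
      then have "x \<notin> C n" for n using C(2) by blast
      then show ?thesis using False by simp
    qed
  qed
  from meas obtain f' where f': "f' \<in> borel_measurable lborel" "AE x in lborel. indicator \<Omega> x * f x = f' x"
    using completion_ex_borel_measurable_real by blast
  have "AE x in lborel. x \<in> \<Omega> \<longrightarrow> f x = f' x"
    using f'(2) by eventually_elim auto
  with f'(1) show "\<exists>f'\<in>borel_measurable borel. AE x in lborel. x \<in> \<Omega> \<longrightarrow> f x = f' x" by auto
qed

lemma test_function_of_C1_gradient:
  fixes \<phi> :: "real ^ 'n::finite \<Rightarrow> real"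
  assumes \<phi>: "C1_gradient \<phi> D" and K: "compact K" "K \<subseteq> \<Omega>" and zero: "\<And>x. x \<notin> K \<Longrightarrow> \<phi> x = 0"
  shows "test_function \<Omega> \<phi>" "partial_deriv i \<phi> x = D x \<bullet> axis i 1"
proof -
  have d: "(\<phi> has_derivative (\<lambda>h. D x \<bullet> h)) (at x)" for x
    using \<phi> by (simp add: C1_gradient_def)
  have pd: "partial_deriv i \<phi> = (\<lambda>x. D x \<bullet> axis i 1)" for i
    unfolding partial_deriv_def frechet_derivative_at[OF d, symmetric] ..
  then show "partial_deriv i \<phi> x = D x \<bullet> axis i 1" by simp
  have "closure {x. \<phi> x \<noteq> 0} \<subseteq> K"
    using zero K(1) by (intro closure_minimal compact_imp_closed) auto
  moreover have "bounded {x. \<phi> x \<noteq> 0}"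
    by (rule bounded_subset[OF compact_imp_bounded[OF K(1)]]) (use zero in auto)
  then have "compact (closure {x. \<phi> x \<noteq> 0})"
    by (simp add: compact_closure)
  moreover have "continuous_on UNIV (\<lambda>x. D x \<bullet> axis i 1)" for i
    using \<phi> by (auto simp: C1_gradient_def intro!: continuous_intros)
  ultimately show "test_function \<Omega> \<phi>"
    using d K(2) unfolding test_function_def pd
    by (auto simp: differentiable_on_def differentiable_def intro: has_derivative_at_withinI)
qed

lemma C1_gradient_of_test_function:
  fixes \<phi> :: "real ^ 'n::finite \<Rightarrow> real"
  assumes "test_function \<Omega> \<phi>"
  shows "C1_gradient \<phi> (\<lambda>x. \<chi> i. partial_deriv i \<phi> x)"
proof -
  have "(\<phi> has_derivative (\<lambda>h. (\<chi> i. partial_deriv i \<phi> x) \<bullet> h)) (at x)" for x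
  proof -
    have d: "(\<phi> has_derivative frechet_derivative \<phi> (at x)) (at x)"
      using assms by (auto simp: test_function_def differentiable_on_def simp flip: frechet_derivative_works)
    have lin: "linear (frechet_derivative \<phi> (at x))"
      using d by (rule has_derivative_linear)
    have "frechet_derivative \<phi> (at x) h = (\<chi> i. partial_deriv i \<phi> x) \<bullet> h" for h
    proof -
      have "frechet_derivative \<phi> (at x) h = frechet_derivative \<phi> (at x) (\<Sum>i\<in>UNIV. (h $ i) *\<^sub>R axis i 1)"
        by (simp add: basis_expansion[of h, unfolded scalar_mult_eq_scaleR])
      also have "\<dots> = (\<Sum>i\<in>UNIV. h $ i * partial_deriv i \<phi> x)"
        using lin by (simp add: linear_sum linear_scale partial_deriv_def)
      also have "\<dots> = (\<chi> i. partial_deriv i \<phi> x) \<bullet> h"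
        by (simp add: inner_vec_def mult.commute)
      finally show ?thesis .
    qed
    then have "frechet_derivative \<phi> (at x) = (\<lambda>h. (\<chi> i. partial_deriv i \<phi> x) \<bullet> h)" by auto
    with d show ?thesis by simp
  qed
  moreover have "continuous_on UNIV (\<lambda>x. \<chi> i. partial_deriv i \<phi> x)"
    using assms by (auto simp: test_function_def intro!: continuous_on_vec_lambda)
  ultimately show ?thesis by (simp add: C1_gradient_def)
qed

section \<open>The trace of a weakly differentiable function\<close>

text \<open>This gives measurability of traces, which agree with a Borel function only almost everywhere.\<close>

lemma borel_measurable_completion_AE_eq:
  assumes AE: "AE x in M. f x = g x" and [measurable]: "g \<in> borel_measurable M"
  shows "f \<in> borel_measurable (completion M)"
proof (rule measurableI)
  fix A :: "'b set" assume [measurable]: "A \<in> sets borel"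
  have ne: "Measurable.pred (completion M) (\<lambda>x. f x \<noteq> g x)"
    using AE by (intro sets_completion_AE) auto
  have neA: "Measurable.pred (completion M) (\<lambda>x. f x \<noteq> g x \<and> f x \<in> A)"
    using AE by (intro sets_completion_AE) (auto elim: eventually_mono)
  have gA: "Measurable.pred (completion M) (\<lambda>x. g x \<in> A)"
    by (rule measurable_completion) measurable
  have "Measurable.pred (completion M) (\<lambda>x. (g x \<in> A \<and> \<not> f x \<noteq> g x) \<or> (f x \<noteq> g x \<and> f x \<in> A))"
    by (intro pred_intros_logic ne neA gA)
  also have "(\<lambda>x. (g x \<in> A \<and> \<not> f x \<noteq> g x) \<or> (f x \<noteq> g x \<and> f x \<in> A)) = (\<lambda>x. f x \<in> A)"
    by auto
  finally show "f -` A \<inter> space (completion M) \<in> sets (completion M)"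
    by (simp add: pred_def vimage_def Int_def conj_commute)
qed simp

lemma set_integrable_lebesgue_AE_eq:
  fixes f g :: "'a::euclidean_space \<Rightarrow> 'b::{banach, second_countable_topology}"
  assumes [measurable]: "A \<in> sets borel" "g \<in> borel_measurable borel"
    and AE: "AE x in lborel. x \<in> A \<longrightarrow> f x = g x"
  shows "set_integrable lebesgue A f \<longleftrightarrow> set_integrable lborel A g"
    and "(LINT x:A|lebesgue. f x) = (LINT x:A|lborel. g x)"
proof -
  have ae: "AE x in lborel. indicator A x *\<^sub>R f x = indicator A x *\<^sub>R g x"
    using AE by eventually_elim (auto simp: indicator_def)
  have m: "(\<lambda>x. indicator A x *\<^sub>R f x) \<in> borel_measurable lebesgue"
    by (rule borel_measurable_completion_AE_eq[OF ae]) measurable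
  have m': "(\<lambda>x. indicator A x *\<^sub>R g x) \<in> borel_measurable lebesgue"
    by (rule measurable_completion) measurable
  show "set_integrable lebesgue A f \<longleftrightarrow> set_integrable lborel A g"
    unfolding set_integrable_def using integrable_cong_AE[OF m m' AE_completion[OF ae]]
    by (simp add: integrable_completion)
  show "(LINT x:A|lebesgue. f x) = (LINT x:A|lborel. g x)"
    unfolding set_lebesgue_integral_def using integral_cong_AE[OF m m' AE_completion[OF ae]]
    by (simp add: integral_completion)
qed

text \<open>A bridge from the Lebesgue measurable functions of the definition to Borel functions.\<close>

lemma is_weak_gradient_borel:
  fixes u :: "real ^ 'n::finite \<Rightarrow> real"
  assumes \<Omega>: "open \<Omega>" and wg: "is_weak_gradient \<Omega> u G"
  shows "\<exists>u0 G0. borel_weak_gradient \<Omega> u0 G0 \<and> (AE x in lborel. x \<in> \<Omega> \<longrightarrow> u x = u0 x \<and> G x = G0 x)"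
proof -
  have u: "\<And>K. compact K \<Longrightarrow> K \<subseteq> \<Omega> \<Longrightarrow> set_integrable lebesgue K u"
    and G: "\<And>K. compact K \<Longrightarrow> K \<subseteq> \<Omega> \<Longrightarrow> set_integrable lebesgue K G"
    and weak: "\<And>\<phi> i. test_function \<Omega> \<phi> \<Longrightarrow>
      (LINT x:\<Omega>|lebesgue. u x * partial_deriv i \<phi> x) = - (LINT x:\<Omega>|lebesgue. G x $ i * \<phi> x)"
    using wg by (auto simp: is_weak_gradient_def locally_integrable_on_def)
  have Gi: "set_integrable lebesgue K (\<lambda>x. G x $ i)" if "compact K" "K \<subseteq> \<Omega>" for K i
  proof -
    have "integrable lebesgue (\<lambda>x. (indicator K x *\<^sub>R G x) \<bullet> axis i 1)"
      using G[OF that] unfolding set_integrable_def by (rule integrable_inner_left)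
    then show ?thesis by (simp add: set_integrable_def inner_axis)
  qed
  obtain u0 where u0: "u0 \<in> borel_measurable borel" "AE x in lborel. x \<in> \<Omega> \<longrightarrow> u x = u0 x"
    using lebesgue_AE_eq_borel(2)[OF \<Omega> u] by blast
  have "\<forall>i. \<exists>h. h \<in> borel_measurable borel \<and> (AE x in lborel. x \<in> \<Omega> \<longrightarrow> G x $ i = h x)"
    using lebesgue_AE_eq_borel(2)[OF \<Omega> Gi] by blast
  from choice[OF this] obtain h where "\<forall>i. h i \<in> borel_measurable borel \<and> (AE x in lborel. x \<in> \<Omega> \<longrightarrow> G x $ i = h i x)" ..
  then have h: "\<And>i. h i \<in> borel_measurable borel" "\<And>i. AE x in lborel. x \<in> \<Omega> \<longrightarrow> G x $ i = h i x"
    by simp_all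
  define G0 where "G0 x = (\<chi> i. h i x)" for x
  note [measurable] = u0(1) h(1)
  have [measurable]: "\<Omega> \<in> sets borel" using \<Omega> by simp
  have G0 [measurable]: "G0 \<in> borel_measurable borel"
    by (subst borel_measurable_euclidean_space) (auto simp: Basis_vec_def inner_axis G0_def)
  have "AE x in lborel. \<forall>i\<in>UNIV. x \<in> \<Omega> \<longrightarrow> G x $ i = h i x"
    using h(2) by (subst AE_ball_countable) auto
  then have G0_AE: "AE x in lborel. x \<in> \<Omega> \<longrightarrow> G x = G0 x"
    by eventually_elim (auto simp: G0_def vec_eq_iff)
  have "borel_weak_gradient \<Omega> u0 G0"
    unfolding borel_weak_gradient_def
  proof (intro conjI allI impI ballI; (elim conjE)?)
    show "u0 \<in> borel_measurable borel" "G0 \<in> borel_measurable borel" by measurable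
  next
    fix K assume K: "compact K" "K \<subseteq> \<Omega>"
    have [measurable]: "K \<in> sets borel" using K by (auto intro: borel_compact)
    have ae: "AE x in lborel. x \<in> K \<longrightarrow> u x = u0 x" "AE x in lborel. x \<in> K \<longrightarrow> G x = G0 x"
      using u0(2) G0_AE K(2) by (auto elim: eventually_mono)
    show "set_integrable lborel K u0"
      by (rule set_integrable_lebesgue_AE_eq(1)[THEN iffD1, OF _ _ ae(1) u[OF K]]) measurable
    show "set_integrable lborel K G0"
      by (rule set_integrable_lebesgue_AE_eq(1)[THEN iffD1, OF _ _ ae(2) G[OF K]]) measurable
  next
    fix \<phi> D K and b :: "real ^ 'n"
    assume \<phi>: "C1_gradient \<phi> D" and K: "compact K" "K \<subseteq> \<Omega>" and zero: "\<forall>x. x \<notin> K \<longrightarrow> \<phi> x = 0"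
      and "b \<in> Basis"
    then obtain i where b: "b = axis i 1" by (auto simp: Basis_vec_def)
    note [measurable] = C1_gradient_borel[OF \<phi>]
    have D0: "D x = 0" if "x \<notin> K" for x
      using C1_gradient_zero_outside[OF \<phi> compact_imp_closed[OF K(1)]] zero that by blast
    have test: "test_function \<Omega> \<phi>" and pd: "\<And>x. partial_deriv i \<phi> x = D x \<bullet> axis i 1"
      using test_function_of_C1_gradient[OF \<phi> K] zero by auto
    have [measurable]: "(\<lambda>x. G0 x $ i) \<in> borel_measurable borel"
      unfolding G0_def by simp
    have "(LINT x:\<Omega>|lebesgue. u x * partial_deriv i \<phi> x) = (LINT x:\<Omega>|lborel. u0 x * (D x \<bullet> axis i 1))"
      using u0(2) by (intro set_integrable_lebesgue_AE_eq(2)) (auto simp: pd elim: eventually_mono)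
    moreover have "(LINT x:\<Omega>|lebesgue. G x $ i * \<phi> x) = (LINT x:\<Omega>|lborel. G0 x $ i * \<phi> x)"
      using G0_AE by (intro set_integrable_lebesgue_AE_eq(2)) (auto elim: eventually_mono)
    ultimately have "(LINT x:\<Omega>|lborel. u0 x * (D x \<bullet> axis i 1)) = - (LINT x:\<Omega>|lborel. G0 x $ i * \<phi> x)"
      using weak[OF test, of i] by simp
    moreover have "(LINT x:\<Omega>|lborel. u0 x * (D x \<bullet> axis i 1)) = (\<integral>x. u0 x * (D x \<bullet> b) \<partial>lborel)"
      unfolding set_lebesgue_integral_def
      using D0[OF contra_subsetD[OF K(2)]] by (intro Bochner_Integration.integral_cong) (auto simp: indicator_def b)
    moreover have "(LINT x:\<Omega>|lborel. G0 x $ i * \<phi> x) = (\<integral>x. (G0 x \<bullet> b) * \<phi> x \<partial>lborel)"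
      unfolding set_lebesgue_integral_def
      using zero K(2) by (intro Bochner_Integration.integral_cong) (auto simp: indicator_def b inner_axis)
    ultimately show "(\<integral>x. u0 x * (D x \<bullet> b) \<partial>lborel) = - (\<integral>x. (G0 x \<bullet> b) * \<phi> x \<partial>lborel)"
      by simp
  qed
  moreover have "AE x in lborel. x \<in> \<Omega> \<longrightarrow> u x = u0 x \<and> G x = G0 x"
    using u0(2) G0_AE by eventually_elim auto
  ultimately show ?thesis by blast
qed

text \<open>The one-dimensional structure behind the trace, with absolute continuity along rays in integral form. The
  inequalities depend on u only through such a pair.\<close>

definition radial_primitive :: "real \<Rightarrow> ('a::euclidean_space \<Rightarrow> real) \<Rightarrow> ('a \<Rightarrow> real) \<Rightarrow> bool" where
  "radial_primitive r v g \<longleftrightarrow> v \<in> borel_measurable borel \<and> g \<in> borel_measurable borel \<and>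
    (AE w in direction_measure.
       (\<forall>R. set_integrable lborel {r..R} (\<lambda>s. g (s *\<^sub>R w))) \<and>
       (\<forall>s t. r \<le> s \<and> s \<le> t \<longrightarrow>
          v (t *\<^sub>R w) - v (s *\<^sub>R w) = (\<integral>x. indicator {s..t} x * g (x *\<^sub>R w) \<partial>lborel)))"

lemma radial_primitive_absolutely_continuous:
  assumes "radial_primitive r v g"
  shows "AE w in direction_measure. \<forall>R>r. absolutely_continuous_on_interval r R (\<lambda>t. v (t *\<^sub>R w))"
  using assms[unfolded radial_primitive_def, THEN conjunct2, THEN conjunct2]
proof eventually_elim
  case (elim w)
  show ?case
  proof (intro allI impI)
    fix R
    show "absolutely_continuous_on_interval r R (\<lambda>t. v (t *\<^sub>R w))"
    proof (rule absolutely_continuous_on_interval_primitive)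
      show "integrable lborel (\<lambda>s. indicator {r..R} s * g (s *\<^sub>R w))"
        using elim by (simp add: set_integrable_def)
      fix s t assume st: "r \<le> s" "s \<le> t" "t \<le> R"
      have "(\<integral>x. indicator {s..t} x * (indicator {r..R} x * g (x *\<^sub>R w)) \<partial>lborel) = (\<integral>x. indicator {s..t} x * g (x *\<^sub>R w) \<partial>lborel)"
        using st by (intro Bochner_Integration.integral_cong) (auto simp: indicator_def)
      then show "v (t *\<^sub>R w) - v (s *\<^sub>R w) = (\<integral>x. indicator {s..t} x * (indicator {r..R} x * g (x *\<^sub>R w)) \<partial>lborel)"
        using elim st by simp
    qed
  qed
qed

text \<open>Two representatives agree almost everywhere, hence almost everywhere on almost every ray, and by continuity
  at every point of such a ray.\<close>

lemma ray_representative_unique: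
  fixes u :: "real ^ 'n::finite \<Rightarrow> real"
  assumes r: "r > 0" and v: "is_ray_representative r u v" and v': "is_ray_representative r u v'"
  shows "AE w in direction_measure. \<forall>t\<ge>r. v (t *\<^sub>R w) = v' (t *\<^sub>R w)"
proof -
  have "AE x in lborel. x \<in> - cball 0 r \<longrightarrow> v x = v' x"
    using v v' unfolding is_ray_representative_def AE_completion_iff
    by (auto elim: AE_mp)
  from AE_polar[OF this]
  have polar: "AE w in direction_measure. AE t in lborel. t > 0 \<longrightarrow> (t *\<^sub>R w \<in> - cball 0 r \<longrightarrow> v (t *\<^sub>R w) = v' (t *\<^sub>R w))" .
  have AC: "AE w in direction_measure. \<forall>R>r. absolutely_continuous_on_interval r R (\<lambda>t. v (t *\<^sub>R w))"
    "AE w in direction_measure. \<forall>R>r. absolutely_continuous_on_interval r R (\<lambda>t. v' (t *\<^sub>R w))"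
    using v v' unfolding is_ray_representative_def AE_sphere_measure_iff[OF zero_less_one] scaleR_one by blast+
  show ?thesis
    using AE_direction_measure_norm polar AC
  proof eventually_elim
    fix w :: "real ^ 'n"
    assume w: "norm w = 1"
      and eq: "AE t in lborel. t > 0 \<longrightarrow> (t *\<^sub>R w \<in> - cball 0 r \<longrightarrow> v (t *\<^sub>R w) = v' (t *\<^sub>R w))"
      and ac: "\<forall>R>r. absolutely_continuous_on_interval r R (\<lambda>t. v (t *\<^sub>R w))"
        "\<forall>R>r. absolutely_continuous_on_interval r R (\<lambda>t. v' (t *\<^sub>R w))"
    have "AE t in lborel. t > r \<longrightarrow> v (t *\<^sub>R w) = v' (t *\<^sub>R w)"
      using eq by eventually_elim (use w r in auto)
    then show "\<forall>t\<ge>r. v (t *\<^sub>R w) = v' (t *\<^sub>R w)"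
      using ac absolutely_continuous_AE_eq_imp_eq[where r = r and f = "\<lambda>t. v (t *\<^sub>R w)" and g = "\<lambda>t. v' (t *\<^sub>R w)"]
      by blast
  qed
qed

text \<open>Since the integration constant is chosen measurably, v is a Borel function, so that its agreement with u on
  almost every ray implies agreement almost everywhere.\<close>

lemma radial_primitive_of_weak_gradient:
  fixes u :: "'a::euclidean_space \<Rightarrow> real"
  assumes wg: "borel_weak_gradient (- cball 0 r) u G" and r: "r > 0" and p: "p \<ge> 1"
    and g: "\<And>x. g x = (x \<bullet> G x) / norm x"
    and fin: "(\<integral>\<^sup>+x. ennreal (\<bar>g x\<bar> powr p) * indicator (- cball 0 r) x \<partial>lborel) < \<infinity>"
  defines "v \<equiv> ray_primitive r u g"
  shows "radial_primitive r v g" and "AE x in lborel. x \<in> - cball 0 r \<longrightarrow> u x = v x"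
proof -
  note [measurable] = borel_weak_gradient_measurable_function[OF wg] borel_weak_gradient_measurable_gradient[OF wg]
  have gm [measurable]: "g \<in> borel_measurable borel" unfolding g[abs_def] by measurable
  have vm [measurable]: "v \<in> borel_measurable borel" unfolding v_def by measurable
  have main: "AE w in direction_measure. norm w = 1 \<and>
       (AE t in lborel. t > r \<longrightarrow> u (t *\<^sub>R w) = v (t *\<^sub>R w)) \<and>
       (\<forall>R. set_integrable lborel {r..R} (\<lambda>s. g (s *\<^sub>R w))) \<and>
       (\<forall>s t. r \<le> s \<and> s \<le> t \<longrightarrow>
          v (t *\<^sub>R w) - v (s *\<^sub>R w) = (\<integral>x. indicator {s..t} x * g (x *\<^sub>R w) \<partial>lborel))"
    using AE_direction_measure_norm AE_ray_primitive[OF wg r p g fin] AE_ray_integrable[OF r p gm fin]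
  proof eventually_elim
    case (elim w)
    then obtain c where c: "AE t in lborel. t > r \<longrightarrow> u (t *\<^sub>R w) = c + ray_integral r g w t" by blast
    have v: "v (t *\<^sub>R w) = c + ray_integral r g w t" if "t \<ge> r" for t
      unfolding v_def using ray_primitive_scaleR[of w t r u g] elim(1) that r ray_constant_eq[OF _ _ c] by simp
    from c have "AE t in lborel. t > r \<longrightarrow> u (t *\<^sub>R w) = v (t *\<^sub>R w)"
      by eventually_elim (auto simp: v)
    moreover have "v (t *\<^sub>R w) - v (s *\<^sub>R w) = (\<integral>x. indicator {s..t} x * g (x *\<^sub>R w) \<partial>lborel)" if "r \<le> s" "s \<le> t" for s t
      using ray_integral_diff[of r t g w s] elim(3) that by (simp add: v)
    ultimately show ?case using elim by blast
  qed
  show "radial_primitive r v g"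
    unfolding radial_primitive_def using vm gm main by (auto elim: eventually_mono)
  show "AE x in lborel. x \<in> - cball 0 r \<longrightarrow> u x = v x"
  proof (rule AE_polarI)
    show "AE w in direction_measure. AE t in lborel. t > 0 \<longrightarrow> (t *\<^sub>R w \<in> - cball 0 r \<longrightarrow> u (t *\<^sub>R w) = v (t *\<^sub>R w))"
      using main
    proof eventually_elim
      case (elim w)
      then have "AE t in lborel. t > r \<longrightarrow> u (t *\<^sub>R w) = v (t *\<^sub>R w)" by blast
      then show ?case by eventually_elim (use elim in auto)
    qed
  qed measurable
qed

text \<open>The primitive constructed from the radial derivative is a ray representative. So one exists, and the
  chosen representative agrees with this one on almost every ray, at every point from r onwards.\<close>

theorem ray_trace_is_radial_primitive:
  fixes u :: "real ^ 'n::finite \<Rightarrow> real"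
  defines "\<Omega> r \<equiv> - cball (0 :: real ^ 'n) r"
  assumes r: "r > 0" and p: "p \<ge> 1" and wd: "u weakly_differentiable_on \<Omega> r"
    and int: "set_integrable lebesgue (\<Omega> r) (\<lambda>x. \<bar>radial_derivative r u x\<bar> powr p)"
  shows "\<exists>v g. radial_primitive r v g \<and>
    (AE x in lborel. x \<in> \<Omega> r \<longrightarrow> u x = v x \<and> radial_derivative r u x = g x) \<and>
    (AE w in direction_measure. \<forall>t\<ge>r. ray_trace r u (t *\<^sub>R w) = v (t *\<^sub>R w))"
proof -
  have \<Omega>: "open (\<Omega> r)" by (simp add: \<Omega>_def open_Compl)
  then have [measurable]: "\<Omega> r \<in> sets borel" by simp
  define G where "G = weak_gradient (\<Omega> r) u"
  have "is_weak_gradient (\<Omega> r) u G"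
    using wd unfolding weakly_differentiable_on_def G_def weak_gradient_def by (rule someI_ex)
  from is_weak_gradient_borel[OF \<Omega> this] obtain u0 G0 where wg: "borel_weak_gradient (\<Omega> r) u0 G0"
    and AE: "AE x in lborel. x \<in> \<Omega> r \<longrightarrow> u x = u0 x \<and> G x = G0 x" by blast
  note [measurable] = borel_weak_gradient_measurable_function[OF wg] borel_weak_gradient_measurable_gradient[OF wg]
  define g where "g x = (x \<bullet> G0 x) / norm x" for x
  have gm [measurable]: "g \<in> borel_measurable borel" unfolding g_def by measurable
  have g_AE: "AE x in lborel. x \<in> \<Omega> r \<longrightarrow> radial_derivative r u x = g x"
    using AE by eventually_elim (auto simp: radial_derivative_def g_def G_def \<Omega>_def)
  have "set_integrable lborel (\<Omega> r) (\<lambda>x. \<bar>g x\<bar> powr p)"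
    using int g_AE by (subst (asm) set_integrable_lebesgue_AE_eq(1)[where g = "\<lambda>x. \<bar>g x\<bar> powr p"])
      (auto elim: eventually_mono)
  then have "(\<integral>\<^sup>+x. ennreal (norm (indicator (\<Omega> r) x *\<^sub>R \<bar>g x\<bar> powr p)) \<partial>lborel) < \<infinity>"
    unfolding set_integrable_def integrable_iff_bounded by blast
  also have "(\<integral>\<^sup>+x. ennreal (norm (indicator (\<Omega> r) x *\<^sub>R \<bar>g x\<bar> powr p)) \<partial>lborel) =
      (\<integral>\<^sup>+x. ennreal (\<bar>g x\<bar> powr p) * indicator (- cball 0 r) x \<partial>lborel)"
    by (intro nn_integral_cong) (auto simp: indicator_def \<Omega>_def)
  finally have fin: "(\<integral>\<^sup>+x. ennreal (\<bar>g x\<bar> powr p) * indicator (- cball 0 r) x \<partial>lborel) < \<infinity>" .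
  define v where "v = ray_primitive r u0 g"
  note prim = radial_primitive_of_weak_gradient[OF wg[unfolded \<Omega>_def] r p g_def fin, folded v_def]
  from AE prim(2) have uv: "AE x in lborel. x \<in> \<Omega> r \<longrightarrow> u x = v x"
    by eventually_elim (auto simp: \<Omega>_def)
  have rep: "is_ray_representative r u v"
    unfolding is_ray_representative_def AE_completion_iff AE_sphere_measure_iff[OF zero_less_one] scaleR_one
    using uv radial_primitive_absolutely_continuous[OF prim(1)] by (auto simp: \<Omega>_def elim: eventually_mono)
  then have "is_ray_representative r u (ray_trace r u)"
    unfolding ray_trace_def by (rule someI[of "is_ray_representative r u"])
  from ray_representative_unique[OF r this rep]
  have "AE w in direction_measure. \<forall>t\<ge>r. ray_trace r u (t *\<^sub>R w) = v (t *\<^sub>R w)" .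
  moreover have "AE x in lborel. x \<in> \<Omega> r \<longrightarrow> u x = v x \<and> radial_derivative r u x = g x"
    using uv g_AE by eventually_elim auto
  ultimately show ?thesis using prim(1) by blast
qed

section \<open>The inequality on a ray and Hoelder inequality\<close>

lemma powr_diff_le:
  fixes x y p :: real
  assumes "0 \<le> y" "y \<le> x" "p \<ge> 1"
  shows "x powr p - y powr p \<le> p * x powr (p - 1) * (x - y)"
proof (cases "y = 0 \<or> y = x")
  case True
  have "x powr p \<le> p * (x powr (p - 1) * x)" if "x > 0"
  proof -
    have "x powr (p - 1) * x = x powr p" using that by (simp add: powr_diff)
    then show ?thesis using assms mult_right_mono[of 1 p "x powr p"] by simp
  qed
  then show ?thesis using True assms by (cases "x = 0") auto
next
  case False
  then have y: "0 < y" "y < x" using assms by auto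
  have "\<exists>z. y < z \<and> z < x \<and> x powr p - y powr p = (x - y) * (p * z powr (p - 1))"
    using y by (intro MVT2) (auto intro!: derivative_eq_intros)
  then obtain z where z: "y < z" "z < x" "x powr p - y powr p = (x - y) * (p * z powr (p - 1))" by blast
  have "z powr (p - 1) \<le> x powr (p - 1)" using z y assms by (intro powr_mono2) auto
  then have "(x - y) * (p * z powr (p - 1)) \<le> (x - y) * (p * x powr (p - 1))"
    using assms by (intro mult_left_mono) auto
  then show ?thesis using z by (simp add: mult_ac)
qed

text \<open>An inequality form of the chain rule for |f|^p, where f is only absolutely continuous. With an
  additional \<epsilon> in the integrand it holds on sufficiently short intervals around each point, by the mean value
  theorem and the continuity of f, and it is additive in the interval; Bolzano's bisection argument makes it
  global.\<close>

lemma power_of_primitive_le: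
  fixes f h :: "real \<Rightarrow> real"
  assumes p: "p > 1" and st: "s \<le> t" and h: "set_integrable lborel {s..t} h"
    and [measurable]: "f \<in> borel_measurable borel" "h \<in> borel_measurable borel"
    and f: "\<And>a b. s \<le> a \<Longrightarrow> a \<le> b \<Longrightarrow> b \<le> t \<Longrightarrow> f b - f a = (\<integral>x. indicator {a..b} x * h x \<partial>lborel)"
  shows "ennreal (\<bar>f s\<bar> powr p) \<le> ennreal (\<bar>f t\<bar> powr p) +
    (\<integral>\<^sup>+x. ennreal (p * \<bar>f x\<bar> powr (p - 1) * \<bar>h x\<bar>) * indicator {s..t} x \<partial>lborel)"
proof -
  let ?Z = "\<lambda>a b. \<integral>y. indicator {a..b} y * \<bar>h y\<bar> \<partial>lborel"
  have hab: "integrable lborel (\<lambda>x. indicator {a..b} x * h x)" if "s \<le> a" "b \<le> t" for a b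
    using set_integrable_subset[OF h, of "{a..b}"] that by (auto simp: set_integrable_def)
  have cont_f: "continuous_on {s..t} f"
  proof -
    have "h integrable_on {s..t}"
      using set_borel_integral_eq_integral(1)[OF h] .
    then have c: "continuous_on {s..t} (\<lambda>x. f s + integral {s..x} h)"
      by (intro continuous_intros indefinite_integral_continuous_1)
    have eq: "f x = f s + integral {s..x} h" if "x \<in> {s..t}" for x
    proof -
      have "set_integrable lborel {s..x} h"
        by (rule set_integrable_subset[OF h]) (use that in auto)
      from set_borel_integral_eq_integral(2)[OF this] f[of s x] that
      show ?thesis by (simp add: set_lebesgue_integral_def)
    qed
    show ?thesis by (rule continuous_on_eq[OF c]) (rule eq[symmetric])
  qed
  define k where "k x = p * \<bar>f x\<bar> powr (p - 1)" for x
  have [measurable]: "k \<in> borel_measurable borel" unfolding k_def by measurable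
  have k0: "k x \<ge> 0" for x using p by (simp add: k_def)
  have cont_k: "continuous_on {s..t} k"
    unfolding k_def using p by (intro continuous_intros continuous_on_powr' cont_f) auto
  have step: "ennreal (\<bar>f s\<bar> powr p) \<le> ennreal (\<bar>f t\<bar> powr p) +
    (\<integral>\<^sup>+x. ennreal ((k x + e) * \<bar>h x\<bar>) * indicator {s..t} x \<partial>lborel)" if e: "e > 0" for e
  proof -
    define P where "P a b \<longleftrightarrow> (s \<le> a \<and> a \<le> b \<and> b \<le> t \<longrightarrow> ennreal (\<bar>f a\<bar> powr p) \<le> ennreal (\<bar>f b\<bar> powr p) +
      (\<integral>\<^sup>+x. ennreal ((k x + e) * \<bar>h x\<bar>) * indicator {a..b} x \<partial>lborel))" for a b
    have "P s t"
    proof (rule Bolzano[OF st])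
      fix a b c assume P: "P a b" "P b c" and abc: "a \<le> b" "b \<le> c"
      show "P a c" unfolding P_def
      proof
        assume *: "s \<le> a \<and> a \<le> c \<and> c \<le> t"
        let ?J = "\<lambda>x. ennreal ((k x + e) * \<bar>h x\<bar>)"
        have 1: "ennreal (\<bar>f a\<bar> powr p) \<le> ennreal (\<bar>f b\<bar> powr p) + (\<integral>\<^sup>+x. ?J x * indicator {a..b} x \<partial>lborel)"
          using P(1) * abc by (simp add: P_def)
        have 2: "ennreal (\<bar>f b\<bar> powr p) \<le> ennreal (\<bar>f c\<bar> powr p) + (\<integral>\<^sup>+x. ?J x * indicator {b..c} x \<partial>lborel)"
          using P(2) * abc by (simp add: P_def)
        have "(\<integral>\<^sup>+x. ?J x * indicator {b..c} x \<partial>lborel) + (\<integral>\<^sup>+x. ?J x * indicator {a..b} x \<partial>lborel)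
          = (\<integral>\<^sup>+x. ?J x * indicator {b..c} x + ?J x * indicator {a..b} x \<partial>lborel)"
          by (subst nn_integral_add) auto
        also have "\<dots> = (\<integral>\<^sup>+x. ?J x * indicator {a..c} x \<partial>lborel)"
        proof (rule nn_integral_cong_AE)
          show "AE x in lborel. ?J x * indicator {b..c} x + ?J x * indicator {a..b} x = ?J x * indicator {a..c} x"
            using AE_lborel_singleton[of b] by eventually_elim (use abc in \<open>auto simp: indicator_def\<close>)
        qed
        finally have 3: "(\<integral>\<^sup>+x. ?J x * indicator {b..c} x \<partial>lborel) + (\<integral>\<^sup>+x. ?J x * indicator {a..b} x \<partial>lborel)
          = (\<integral>\<^sup>+x. ?J x * indicator {a..c} x \<partial>lborel)" .
        from order_trans[OF 1 add_right_mono[OF 2]]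
        show "ennreal (\<bar>f a\<bar> powr p) \<le> ennreal (\<bar>f c\<bar> powr p) + (\<integral>\<^sup>+x. ?J x * indicator {a..c} x \<partial>lborel)"
          by (simp only: add.assoc 3)
      qed
    next
      fix x assume x: "s \<le> x" "x \<le> t"
      have "\<exists>d>0. \<forall>y\<in>{s..t}. dist y x < d \<longrightarrow> dist (k y) (k x) < e / 2"
        using cont_k x e unfolding continuous_on_iff by (meson atLeastAtMost_iff half_gt_zero)
      then obtain d where d: "d > 0" "\<And>y. s \<le> y \<Longrightarrow> y \<le> t \<Longrightarrow> \<bar>y - x\<bar> < d \<Longrightarrow> \<bar>k y - k x\<bar> < e / 2"
        by (auto simp: dist_real_def)
      show "\<exists>d>0. \<forall>a b. a \<le> x \<and> x \<le> b \<and> b - a < d \<longrightarrow> P a b"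
      proof (intro exI[of _ d] conjI allI impI d(1))
        fix a b assume ab: "a \<le> x \<and> x \<le> b \<and> b - a < d"
        show "P a b" unfolding P_def
        proof
          assume *: "s \<le> a \<and> a \<le> b \<and> b \<le> t"
          have kle: "k a \<le> k y + e" if "y \<in> {a..b}" for y
            using d(2)[of a] d(2)[of y] ab that * unfolding abs_less_iff by auto
          have "\<bar>f a\<bar> powr p \<le> \<bar>f b\<bar> powr p + k a * (?Z a b)"
          proof (cases "\<bar>f a\<bar> \<le> \<bar>f b\<bar>")
            case True
            then have "\<bar>f a\<bar> powr p \<le> \<bar>f b\<bar> powr p" using p by (intro powr_mono2) auto
            moreover have "0 \<le> k a * (?Z a b)"
              by (intro mult_nonneg_nonneg k0 integral_nonneg_AE) auto
            ultimately show ?thesis by linarith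
          next
            case False
            have "\<bar>f a\<bar> powr p - \<bar>f b\<bar> powr p \<le> k a * (\<bar>f a\<bar> - \<bar>f b\<bar>)"
              unfolding k_def using False p by (intro powr_diff_le) auto
            also have "\<dots> \<le> k a * (?Z a b)"
            proof (intro mult_left_mono k0)
              have "\<bar>f a\<bar> - \<bar>f b\<bar> \<le> \<bar>f b - f a\<bar>" by linarith
              also have "\<dots> \<le> (\<integral>y. \<bar>indicator {a..b} y * h y\<bar> \<partial>lborel)"
                using f[of a b] * by (simp only: integral_abs_bound)
              finally show "\<bar>f a\<bar> - \<bar>f b\<bar> \<le> (?Z a b)"
                by (simp add: abs_mult)
            qed
            finally show ?thesis by simp
          qed
          then have "ennreal (\<bar>f a\<bar> powr p) \<le> ennreal (\<bar>f b\<bar> powr p) + ennreal (k a * (?Z a b))"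
            by (subst ennreal_plus[symmetric]) (auto intro!: ennreal_leI mult_nonneg_nonneg k0 integral_nonneg_AE)
          also have "ennreal (k a * (?Z a b)) = (\<integral>\<^sup>+y. ennreal (k a * (indicator {a..b} y * \<bar>h y\<bar>)) \<partial>lborel)"
          proof (subst nn_integral_eq_integral)
            have "integrable lborel (\<lambda>y. indicator {a..b} y * \<bar>h y\<bar>)"
              using integrable_abs[OF hab[of a b]] * by (simp add: abs_mult)
            then show "integrable lborel (\<lambda>y. k a * (indicator {a..b} y * \<bar>h y\<bar>))" by simp
          qed (auto intro!: mult_nonneg_nonneg k0)
          also have "\<dots> \<le> (\<integral>\<^sup>+y. ennreal ((k y + e) * \<bar>h y\<bar>) * indicator {a..b} y \<partial>lborel)"
            by (intro nn_integral_mono) (auto simp: indicator_def intro!: ennreal_leI mult_right_mono kle)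
          finally show "ennreal (\<bar>f a\<bar> powr p) \<le> ennreal (\<bar>f b\<bar> powr p) +
             (\<integral>\<^sup>+x. ennreal ((k x + e) * \<bar>h x\<bar>) * indicator {a..b} x \<partial>lborel)"
            by (simp add: add_left_mono)
        qed
      qed
    qed
    then show ?thesis using st by (simp add: P_def)
  qed
  (* The additional \<epsilon> contributes at most \<epsilon> times this finite constant. *)
  define C where "C = (\<integral>x. indicator {s..t} x * \<bar>h x\<bar> \<partial>lborel)"
  have C0: "C \<ge> 0" unfolding C_def by (intro integral_nonneg_AE) auto
  have C: "(\<integral>\<^sup>+x. ennreal \<bar>h x\<bar> * indicator {s..t} x \<partial>lborel) = ennreal C"
  proof -
    have "(\<integral>\<^sup>+x. ennreal \<bar>h x\<bar> * indicator {s..t} x \<partial>lborel) = (\<integral>\<^sup>+x. ennreal (indicator {s..t} x * \<bar>h x\<bar>) \<partial>lborel)"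
      by (intro nn_integral_cong) (auto simp: indicator_def)
    also have "\<dots> = ennreal C"
      unfolding C_def using integrable_abs[OF hab[of s t]] by (intro nn_integral_eq_integral) (auto simp: abs_mult)
    finally show ?thesis .
  qed
  show ?thesis
  proof (rule ennreal_le_epsilon)
    fix e :: real assume e: "0 < e"
    define e' where "e' = e / (C + 1)"
    have e': "e' > 0" using e C0 by (simp add: e'_def)
    have "(\<integral>\<^sup>+x. ennreal ((k x + e') * \<bar>h x\<bar>) * indicator {s..t} x \<partial>lborel) =
       (\<integral>\<^sup>+x. ennreal (k x * \<bar>h x\<bar>) * indicator {s..t} x + ennreal e' * (ennreal \<bar>h x\<bar> * indicator {s..t} x) \<partial>lborel)"
      using e' k0 by (intro nn_integral_cong)
         (auto simp: indicator_def ennreal_plus[symmetric] ennreal_mult[symmetric] distrib_right simp del: ennreal_plus)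
    also have "\<dots> = (\<integral>\<^sup>+x. ennreal (k x * \<bar>h x\<bar>) * indicator {s..t} x \<partial>lborel) + ennreal e' * ennreal C"
      by (subst nn_integral_add) (auto simp: nn_integral_cmult C)
    also have "ennreal e' * ennreal C \<le> ennreal e"
      using e e' C0 by (subst ennreal_mult[symmetric]) (auto intro!: ennreal_leI simp: e'_def field_simps)
    finally have "(\<integral>\<^sup>+x. ennreal ((k x + e') * \<bar>h x\<bar>) * indicator {s..t} x \<partial>lborel) \<le>
      (\<integral>\<^sup>+x. ennreal (k x * \<bar>h x\<bar>) * indicator {s..t} x \<partial>lborel) + ennreal e"
      by (simp add: add_left_mono)
    from order_trans[OF step[OF e'] add_left_mono[OF this]]
    show "ennreal (\<bar>f s\<bar> powr p) \<le> ennreal (\<bar>f t\<bar> powr p) +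
      (\<integral>\<^sup>+x. ennreal (p * \<bar>f x\<bar> powr (p - 1) * \<bar>h x\<bar>) * indicator {s..t} x \<partial>lborel) + ennreal e"
      by (simp add: k_def add.assoc)
  qed
qed

text \<open>Young's inequality, applied after both functions have been normalised in their norms.\<close>

lemma nn_integral_Holder:
  fixes f g :: "'b \<Rightarrow> real"
  assumes pq: "p > 1" "q > 1" "1 / p + 1 / q = 1"
    and [measurable]: "f \<in> borel_measurable M" "g \<in> borel_measurable M"
    and f0: "\<And>x. f x \<ge> 0" and g0: "\<And>x. g x \<ge> 0"
    and A: "(\<integral>\<^sup>+x. ennreal (f x powr q) \<partial>M) = ennreal A" "A \<ge> 0"
    and B: "(\<integral>\<^sup>+x. ennreal (g x powr p) \<partial>M) = ennreal B" "B \<ge> 0"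
  shows "(\<integral>\<^sup>+x. ennreal (f x * g x) \<partial>M) \<le> ennreal (A powr (1 / q) * B powr (1 / p))"
proof (cases "A = 0 \<or> B = 0")
  case True
  have "AE x in M. f x * g x = 0"
  proof (cases "A = 0")
    case True
    then have "(\<integral>\<^sup>+x. ennreal (f x powr q) \<partial>M) = 0"
      using A by simp
    then have "AE x in M. ennreal (f x powr q) = 0"
      by (subst (asm) nn_integral_0_iff_AE) auto
    then show ?thesis by eventually_elim (auto simp: ennreal_eq_0_iff)
  next
    case False
    then have "(\<integral>\<^sup>+x. ennreal (g x powr p) \<partial>M) = 0"
      using True B by simp
    then have "AE x in M. ennreal (g x powr p) = 0"
      by (subst (asm) nn_integral_0_iff_AE) auto
    then show ?thesis by eventually_elim (auto simp: ennreal_eq_0_iff)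
  qed
  then have "(\<integral>\<^sup>+x. ennreal (f x * g x) \<partial>M) = (\<integral>\<^sup>+x. 0 \<partial>M)"
    by (intro nn_integral_cong_AE) (auto elim: eventually_mono)
  then show ?thesis by simp
next
  case False
  then have pos: "A > 0" "B > 0" using A B by auto
  define a where "a = A powr (1 / q)"
  define b where "b = B powr (1 / p)"
  have ab: "a > 0" "b > 0" using pos by (simp_all add: a_def b_def)
  have aq: "a powr q = A" and bp: "b powr p = B"
    using pos pq by (simp_all add: a_def b_def powr_powr)
  have "(\<integral>\<^sup>+x. ennreal (f x * g x) \<partial>M) \<le>
     (\<integral>\<^sup>+x. ennreal (a * b / (q * A)) * ennreal (f x powr q) + ennreal (a * b / (p * B)) * ennreal (g x powr p) \<partial>M)"
  proof (rule nn_integral_mono)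
    fix x
    have eqs: "(g x / b) powr p = g x powr p / B" "(f x / a) powr q = f x powr q / A"
      using f0[of x] g0[of x] ab by (simp_all add: powr_divide aq bp)
    have "g x / b * (f x / a) \<le> (g x / b) powr p / p + (f x / a) powr q / q"
      using pq f0[of x] g0[of x] ab by (intro Youngs_inequality) auto
    then have "g x / b * (f x / a) * (a * b) \<le> (g x powr p / B / p + f x powr q / A / q) * (a * b)"
      unfolding eqs using ab by (intro mult_right_mono) auto
    also have "g x / b * (f x / a) * (a * b) = f x * g x"
      using ab by simp
    also have "(g x powr p / B / p + f x powr q / A / q) * (a * b) =
        a * b / (q * A) * f x powr q + a * b / (p * B) * g x powr p"
      using pos pq by (simp add: field_simps)
    finally have "f x * g x \<le> a * b / (q * A) * f x powr q + a * b / (p * B) * g x powr p" .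
    then show "ennreal (f x * g x) \<le> ennreal (a * b / (q * A)) * ennreal (f x powr q) + ennreal (a * b / (p * B)) * ennreal (g x powr p)"
      using ab pos pq by (simp add: ennreal_mult[symmetric] ennreal_plus[symmetric] ennreal_leI del: ennreal_plus)
  qed
  also have "\<dots> = ennreal (a * b / (q * A)) * ennreal A + ennreal (a * b / (p * B)) * ennreal B"
    by (subst nn_integral_add) (auto simp: nn_integral_cmult A B)
  also have "\<dots> = ennreal (a * b / (q * A) * A + a * b / (p * B) * B)"
    using ab pos pq by (simp add: ennreal_mult[symmetric] ennreal_plus[symmetric] del: ennreal_plus)
  also have "a * b / (q * A) * A + a * b / (p * B) * B = a * b * (1 / p + 1 / q)"
    using pos pq by (simp add: field_simps)
  also have "\<dots> = a * b" using pq by simp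
  finally show ?thesis by (simp add: a_def b_def)
qed

text \<open>Polar coordinates with the order of integration reversed, for integrals over spherical shells.\<close>

lemma nn_integral_polar_radial:
  fixes f :: "'a::euclidean_space \<Rightarrow> ennreal"
  assumes [measurable]: "f \<in> borel_measurable borel" "I \<in> sets borel" and I: "I \<subseteq> {0<..}"
  shows "(\<integral>\<^sup>+x. f x * indicator I (norm x) \<partial>lborel) =
    (\<integral>\<^sup>+t. (\<integral>\<^sup>+w. f (t *\<^sub>R w) \<partial>direction_measure) * ennreal (t powr (DIM('a) - 1)) * indicator I t \<partial>lborel)"
proof -
  let ?A = "\<lambda>w t. f (t *\<^sub>R w) * indicator I (norm (t *\<^sub>R w)) * ennreal (t ^ (DIM('a) - 1)) * indicator {0<..} t"
  let ?B = "\<lambda>w t. f (t *\<^sub>R w) * ennreal (t powr (DIM('a) - 1)) * indicator I t"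
  have "(\<integral>\<^sup>+x. f x * indicator I (norm x) \<partial>lborel) =
    (\<integral>\<^sup>+w. (\<integral>\<^sup>+t. ?A w t \<partial>lborel) \<partial>direction_measure)"
    by (rule nn_integral_polar) measurable
  also have "\<dots> = (\<integral>\<^sup>+w. (\<integral>\<^sup>+t. ?B w t \<partial>lborel) \<partial>direction_measure)"
  proof (rule nn_integral_cong_AE)
    show "AE w in direction_measure.
      (\<integral>\<^sup>+t. ?A w t \<partial>lborel) =
      (\<integral>\<^sup>+t. ?B w t \<partial>lborel)"
      using AE_direction_measure_norm
    proof eventually_elim
      fix w :: 'a assume w: "norm w = 1"
      show "(\<integral>\<^sup>+t. ?A w t \<partial>lborel) =
      (\<integral>\<^sup>+t. ?B w t \<partial>lborel)"
      proof (rule nn_integral_cong)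
        fix t :: real
        have "t powr real (DIM('a) - 1) = t ^ (DIM('a) - 1)" if "t > 0" using that by (rule powr_realpow)
        then show "?A w t =
          ?B w t"
          using I w by (cases "t > 0") (auto simp: indicator_def of_nat_diff Suc_le_eq)
      qed
    qed
  qed
  also have "\<dots> = (\<integral>\<^sup>+t. (\<integral>\<^sup>+w. ?B w t \<partial>direction_measure) \<partial>lborel)"
    by (rule direction_lborel.Fubini'[symmetric]) measurable
  also have "\<dots> = (\<integral>\<^sup>+t. (\<integral>\<^sup>+w. f (t *\<^sub>R w) \<partial>direction_measure) * ennreal (t powr (DIM('a) - 1)) * indicator I t \<partial>lborel)"
    by (intro nn_integral_cong) (simp add: nn_integral_multc)
  finally show ?thesis .
qed

section \<open>Averages over the directions\<close>

text \<open>Up to the factor t^(n-1) the integral of |v|^p over the sphere of radius t. It takes values in the extended reals,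
  which makes finiteness of the boundary term a conclusion.\<close>

definition sphere_power :: "real \<Rightarrow> ('a::euclidean_space \<Rightarrow> real) \<Rightarrow> real \<Rightarrow> ennreal" where
  "sphere_power p v t = (\<integral>\<^sup>+w. ennreal (\<bar>v (t *\<^sub>R w)\<bar> powr p) \<partial>direction_measure)"

text \<open>The rate at which the quantity defined above can change with t.\<close>

definition sphere_flux ::
    "real \<Rightarrow> ('a::euclidean_space \<Rightarrow> real) \<Rightarrow> ('a \<Rightarrow> real) \<Rightarrow> real \<Rightarrow> ennreal" where
  "sphere_flux p v g t =
     (\<integral>\<^sup>+w. ennreal (p * \<bar>v (t *\<^sub>R w)\<bar> powr (p - 1) * \<bar>g (t *\<^sub>R w)\<bar>) \<partial>direction_measure)"

lemma borel_measurable_sphere_power [measurable]: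
  assumes [measurable]: "v \<in> borel_measurable borel"
  shows "sphere_power p v \<in> borel_measurable borel"
  unfolding sphere_power_def[abs_def] by measurable

lemma borel_measurable_sphere_flux [measurable]:
  assumes [measurable]: "v \<in> borel_measurable borel" "g \<in> borel_measurable borel"
  shows "sphere_flux p v g \<in> borel_measurable borel"
  unfolding sphere_flux_def[abs_def] by measurable

lemma sphere_power_le:
  fixes v :: "'a::euclidean_space \<Rightarrow> real"
  assumes v: "radial_primitive r v g" and p: "p > 1" and st: "r \<le> s" "s \<le> t"
  shows "sphere_power p v s \<le> sphere_power p v t + (\<integral>\<^sup>+x. sphere_flux p v g x * indicator {s..t} x \<partial>lborel)"
proof -
  have [measurable]: "v \<in> borel_measurable borel" "g \<in> borel_measurable borel"
    using v by (simp_all add: radial_primitive_def)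
  let ?K = "\<lambda>w x. ennreal (p * \<bar>v (x *\<^sub>R w)\<bar> powr (p - 1) * \<bar>g (x *\<^sub>R w)\<bar>) * indicator {s..t} x"
  have "sphere_power p v s \<le> (\<integral>\<^sup>+w. ennreal (\<bar>v (t *\<^sub>R w)\<bar> powr p) +
     (\<integral>\<^sup>+x. ?K w x \<partial>lborel) \<partial>direction_measure)"
    unfolding sphere_power_def
  proof (rule nn_integral_mono_AE)
    show "AE w in direction_measure. ennreal (\<bar>v (s *\<^sub>R w)\<bar> powr p) \<le> ennreal (\<bar>v (t *\<^sub>R w)\<bar> powr p) +
     (\<integral>\<^sup>+x. ?K w x \<partial>lborel)"
      using v[unfolded radial_primitive_def, THEN conjunct2, THEN conjunct2]
    proof eventually_elim
      fix w :: 'a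
      assume *: "(\<forall>R. set_integrable lborel {r..R} (\<lambda>s. g (s *\<^sub>R w))) \<and>
       (\<forall>s t. r \<le> s \<and> s \<le> t \<longrightarrow>
          v (t *\<^sub>R w) - v (s *\<^sub>R w) = (\<integral>x. indicator {s..t} x * g (x *\<^sub>R w) \<partial>lborel))"
      have "set_integrable lborel {s..t} (\<lambda>x. g (x *\<^sub>R w))"
        by (rule set_integrable_subset[of _ "{r..t}"]) (use * st in auto)
      then show "ennreal (\<bar>v (s *\<^sub>R w)\<bar> powr p) \<le> ennreal (\<bar>v (t *\<^sub>R w)\<bar> powr p) +
     (\<integral>\<^sup>+x. ?K w x \<partial>lborel)"
        using * st by (intro power_of_primitive_le[where f = "\<lambda>t. v (t *\<^sub>R w)", OF p st(2)]) auto
    qed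
  qed
  also have "\<dots> = sphere_power p v t +
     (\<integral>\<^sup>+w. (\<integral>\<^sup>+x. ?K w x \<partial>lborel) \<partial>direction_measure)"
    unfolding sphere_power_def by (rule nn_integral_add) measurable
  also have "(\<integral>\<^sup>+w. (\<integral>\<^sup>+x. ?K w x \<partial>lborel) \<partial>direction_measure)
     = (\<integral>\<^sup>+x. (\<integral>\<^sup>+w. ?K w x \<partial>direction_measure) \<partial>lborel)"
    by (rule direction_lborel.Fubini'[symmetric]) measurable
  also have "\<dots> = (\<integral>\<^sup>+x. sphere_flux p v g x * indicator {s..t} x \<partial>lborel)"
    unfolding sphere_flux_def by (intro nn_integral_cong) (simp add: nn_integral_multc)
  finally show ?thesis .
qed

lemma nn_integral_powr_Icc:
  assumes "a > 0" "r > 0" "r \<le> s"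
  shows "(\<integral>\<^sup>+t. ennreal (a * t powr (a - 1)) * indicator {r..s} t \<partial>lborel) = ennreal (s powr a - r powr a)"
  using assms by (intro nn_integral_FTC_Icc) (auto intro!: derivative_eq_intros)

text \<open>Formally this is the integral from r to R of the derivative of t^a F(t), but F is not known to be
  differentiable. Instead the unweighted estimate of F(t) by F(R) and the integral of Q over (t, R) is multiplied by
  the derivative of t^a and integrated over t, with Tonelli's theorem for the double integral of Q.\<close>

lemma weighted_sphere_power_le:
  fixes v :: "'a::euclidean_space \<Rightarrow> real"
  assumes v: "radial_primitive r v g" and p: "p > 1" and r: "0 < r" "r \<le> R" and a: "a > 0"
  shows "ennreal (r powr a) * sphere_power p v r +
      ennreal a * (\<integral>\<^sup>+t. sphere_power p v t * ennreal (t powr (a - 1)) * indicator {r..R} t \<partial>lborel)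
    \<le> ennreal (R powr a) * sphere_power p v R +
      (\<integral>\<^sup>+s. sphere_flux p v g s * ennreal (s powr a) * indicator {r..R} s \<partial>lborel)"
proof -
  have [measurable]: "v \<in> borel_measurable borel" "g \<in> borel_measurable borel"
    using v by (simp_all add: radial_primitive_def)
  define F where "F = sphere_power p v"
  define Q where "Q = sphere_flux p v g"
  let ?K = "\<lambda>t s. Q s * (if t \<le> s \<and> s \<le> R then 1 else 0) * (ennreal (a * t powr (a - 1)) * indicator {r..R} t)"
  let ?D = "\<lambda>s. ennreal (s powr a - r powr a) * (Q s * indicator {r..R} s)"
  let ?C = "\<lambda>s. ennreal (r powr a) * (Q s * indicator {r..R} s)"
  let ?L = "\<lambda>t. F t * ennreal (t powr (a - 1)) * indicator {r..R} t"
  let ?W = "\<lambda>t. ennreal (a * t powr (a - 1)) * indicator {r..R} t"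
  have [measurable]: "F \<in> borel_measurable borel" "Q \<in> borel_measurable borel"
    unfolding F_def Q_def by measurable
  have le: "F s \<le> F R + (\<integral>\<^sup>+x. Q x * (if s \<le> x \<and> x \<le> R then 1 else 0) \<partial>lborel)" if "r \<le> s" "s \<le> R" for s
    using sphere_power_le[OF v p that] by (simp add: F_def Q_def indicator_def of_bool_def)
  have 1: "ennreal (r powr a) * F r \<le> ennreal (r powr a) * F R +
      (\<integral>\<^sup>+s. ?C s \<partial>lborel)"
  proof -
    have "ennreal (r powr a) * F r \<le> ennreal (r powr a) * (F R + (\<integral>\<^sup>+s. Q s * indicator {r..R} s \<partial>lborel))"
      using sphere_power_le[OF v p order_refl r(2)] by (intro mult_left_mono) (simp_all add: F_def Q_def)
    then show ?thesis by (simp add: distrib_left nn_integral_cmult)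
  qed
  have "ennreal a * (\<integral>\<^sup>+t. ?L t \<partial>lborel) =
      (\<integral>\<^sup>+t. F t * (?W t) \<partial>lborel)"
    using a by (subst nn_integral_cmult[symmetric]) (auto simp: ennreal_mult mult_ac)
  also have "\<dots> \<le> (\<integral>\<^sup>+t. (F R + (\<integral>\<^sup>+s. Q s * (if t \<le> s \<and> s \<le> R then 1 else 0) \<partial>lborel)) *
      (?W t) \<partial>lborel)"
  proof (rule nn_integral_mono)
    fix t
    show "F t * (?W t) \<le>
      (F R + (\<integral>\<^sup>+s. Q s * (if t \<le> s \<and> s \<le> R then 1 else 0) \<partial>lborel)) * (?W t)"
      using le[of t] by (cases "t \<in> {r..R}") (auto intro!: mult_right_mono)
  qed
  also have "\<dots> = (\<integral>\<^sup>+t. F R * (?W t) +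
      (\<integral>\<^sup>+s. ?K t s \<partial>lborel) \<partial>lborel)"
    by (intro nn_integral_cong) (simp only: distrib_right, subst nn_integral_multc, auto)
  also have "\<dots> = F R * ennreal (R powr a - r powr a) +
      (\<integral>\<^sup>+t. (\<integral>\<^sup>+s. ?K t s \<partial>lborel) \<partial>lborel)"
    using nn_integral_powr_Icc[OF a r] by (subst nn_integral_add) (auto simp: nn_integral_cmult)
  also have "(\<integral>\<^sup>+t. (\<integral>\<^sup>+s. ?K t s \<partial>lborel) \<partial>lborel)
    = (\<integral>\<^sup>+s. (\<integral>\<^sup>+t. ?K t s \<partial>lborel) \<partial>lborel)"
    by (rule lborel_pair.Fubini') measurable
  also have "\<dots> = (\<integral>\<^sup>+s. ?D s \<partial>lborel)"
  proof (rule nn_integral_cong)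
    fix s
    have "(\<integral>\<^sup>+t. ?K t s \<partial>lborel)
      = (\<integral>\<^sup>+t. Q s * indicator {r..R} s * (ennreal (a * t powr (a - 1)) * indicator {r..s} t) \<partial>lborel)"
      by (intro nn_integral_cong) (auto simp: indicator_def)
    also have "\<dots> = Q s * indicator {r..R} s * (\<integral>\<^sup>+t. ennreal (a * t powr (a - 1)) * indicator {r..s} t \<partial>lborel)"
      by (subst nn_integral_cmult) auto
    also have "\<dots> = ?D s"
      using nn_integral_powr_Icc[OF a r(1), of s] by (cases "s \<in> {r..R}") (auto simp: mult_ac)
    finally show "(\<integral>\<^sup>+t. ?K t s \<partial>lborel)
      = ?D s" .
  qed
  finally have 2: "ennreal a * (\<integral>\<^sup>+t. ?L t \<partial>lborel) \<le>
     F R * ennreal (R powr a - r powr a) + (\<integral>\<^sup>+s. ?D s \<partial>lborel)" .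
  have "ennreal (r powr a) * F r + ennreal a * (\<integral>\<^sup>+t. ?L t \<partial>lborel) \<le>
     (ennreal (r powr a) * F R + F R * ennreal (R powr a - r powr a)) +
     ((\<integral>\<^sup>+s. ?C s \<partial>lborel) +
      (\<integral>\<^sup>+s. ?D s \<partial>lborel))"
    using add_mono[OF 1 2] by (simp add: ac_simps)
  also have "ennreal (r powr a) * F R + F R * ennreal (R powr a - r powr a) = ennreal (R powr a) * F R"
  proof -
    have "ennreal (r powr a) + ennreal (R powr a - r powr a) = ennreal (R powr a)"
      using r a by (subst ennreal_plus[symmetric]) (auto intro!: powr_mono2)
    then show ?thesis by (metis distrib_right mult.commute)
  qed
  also have "(\<integral>\<^sup>+s. ?C s \<partial>lborel) +
      (\<integral>\<^sup>+s. ?D s \<partial>lborel) =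
     (\<integral>\<^sup>+s. ?C s + ?D s \<partial>lborel)"
    by (subst nn_integral_add) auto
  also have "\<dots> = (\<integral>\<^sup>+s. Q s * ennreal (s powr a) * indicator {r..R} s \<partial>lborel)"
  proof (rule nn_integral_cong)
    fix s
    show "?C s + ?D s =
      Q s * ennreal (s powr a) * indicator {r..R} s"
    proof (cases "s \<in> {r..R}")
      case True
      then have "ennreal (r powr a) + ennreal (s powr a - r powr a) = ennreal (s powr a)"
        using r a by (subst ennreal_plus[symmetric]) (auto intro!: powr_mono2)
      then show ?thesis using True by (simp flip: distrib_right) (simp add: mult.commute)
    qed simp
  qed
  finally show ?thesis by (simp add: F_def Q_def)
qed

text \<open>In polar coordinates the left-hand side is the integral of p |v|^(p-1) |x|^(a+1-n) |g|. The exponent of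
  |x| in the weighted integral is the one that results from raising the first factor to the conjugate exponent.\<close>

lemma sphere_flux_integral_le:
  fixes v :: "'a::euclidean_space \<Rightarrow> real"
  defines "n \<equiv> real DIM('a)"
  assumes [measurable]: "v \<in> borel_measurable borel" "g \<in> borel_measurable borel" "I \<in> sets borel"
    and I: "I \<subseteq> {0<..}" and p: "p > 1"
    and A: "(\<integral>\<^sup>+x. ennreal (\<bar>v x\<bar> powr p / norm x powr ((n - 1 - a) * conj_exponent p)) * indicator I (norm x) \<partial>lborel) = ennreal A" "A \<ge> 0"
    and E: "(\<integral>\<^sup>+x. ennreal (\<bar>g x\<bar> powr p) * indicator I (norm x) \<partial>lborel) \<le> ennreal E" "E \<ge> 0"
  shows "(\<integral>\<^sup>+t. sphere_flux p v g t * ennreal (t powr a) * indicator I t \<partial>lborel)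
    \<le> ennreal (p * (A powr (1 / conj_exponent p) * E powr (1 / p)))"
proof -
  define q where "q = conj_exponent p"
  have q: "q > 1" "1 / p + 1 / q = 1" "(p - 1) * q = p"
    using p by (auto simp: q_def conj_exponent_def field_simps)
  have n1: "n \<ge> 1" by (simp add: n_def Suc_le_eq)
  let ?H = "\<lambda>t w. ennreal (p * \<bar>v (t *\<^sub>R w)\<bar> powr (p - 1) * \<bar>g (t *\<^sub>R w)\<bar> * norm (t *\<^sub>R w) powr (a + 1 - n))"
  define f where "f x = \<bar>v x\<bar> powr (p - 1) * norm x powr (a + 1 - n) * indicator I (norm x)" for x
  define h where "h x = \<bar>g x\<bar> * indicator I (norm x)" for x
  have [measurable]: "f \<in> borel_measurable borel" "h \<in> borel_measurable borel"
    unfolding f_def h_def by measurable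
  have "(\<integral>\<^sup>+x. ennreal (h x powr p) \<partial>lborel) = (\<integral>\<^sup>+x. ennreal (\<bar>g x\<bar> powr p) * indicator I (norm x) \<partial>lborel)"
    using p by (intro nn_integral_cong) (auto simp: h_def indicator_def)
  with E obtain B where B: "(\<integral>\<^sup>+x. ennreal (h x powr p) \<partial>lborel) = ennreal B" "B \<ge> 0" "B \<le> E"
    unfolding le_ennreal_iff[OF E(2)] by metis
  have "(\<integral>\<^sup>+t. sphere_flux p v g t * ennreal (t powr a) * indicator I t \<partial>lborel) =
      (\<integral>\<^sup>+t. (\<integral>\<^sup>+w. ?H t w \<partial>direction_measure)
         * ennreal (t powr (DIM('a) - 1)) * indicator I t \<partial>lborel)"
  proof (rule nn_integral_cong)
    fix t
    show "sphere_flux p v g t * ennreal (t powr a) * indicator I t =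
      (\<integral>\<^sup>+w. ?H t w \<partial>direction_measure)
         * ennreal (t powr (DIM('a) - 1)) * indicator I t"
    proof (cases "t \<in> I")
      case True
      with I have t: "t > 0" by auto
      have "(\<integral>\<^sup>+w. ?H t w \<partial>direction_measure)
        = (\<integral>\<^sup>+w. ennreal (p * \<bar>v (t *\<^sub>R w)\<bar> powr (p - 1) * \<bar>g (t *\<^sub>R w)\<bar>) * ennreal (t powr (a + 1 - n)) \<partial>direction_measure)"
      proof (rule nn_integral_cong_AE)
        show "AE w in direction_measure. ?H t w
          = ennreal (p * \<bar>v (t *\<^sub>R w)\<bar> powr (p - 1) * \<bar>g (t *\<^sub>R w)\<bar>) * ennreal (t powr (a + 1 - n))"
          using AE_direction_measure_norm by eventually_elim (use t p in \<open>simp add: ennreal_mult\<close>)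
      qed
      also have "\<dots> = sphere_flux p v g t * ennreal (t powr (a + 1 - n))"
        unfolding sphere_flux_def by (rule nn_integral_multc) measurable
      also have "\<dots> * ennreal (t powr (DIM('a) - 1)) = sphere_flux p v g t * ennreal (t powr a)"
      proof -
        have "t powr (a + 1 - n) * t powr (DIM('a) - 1) = t powr a"
          unfolding powr_add[symmetric] using n1 by (simp add: n_def of_nat_diff)
        then show ?thesis by (simp add: mult.assoc ennreal_mult[symmetric])
      qed
      finally show ?thesis by simp
    qed simp
  qed
  also have "\<dots> = (\<integral>\<^sup>+x. ennreal (p * \<bar>v x\<bar> powr (p - 1) * \<bar>g x\<bar> * norm x powr (a + 1 - n)) * indicator I (norm x) \<partial>lborel)"
    by (rule nn_integral_polar_radial[symmetric, OF _ _ I]) measurable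
  also have "\<dots> = (\<integral>\<^sup>+x. ennreal p * ennreal (f x * h x) \<partial>lborel)"
    using p by (intro nn_integral_cong) (auto simp: f_def h_def indicator_def ennreal_mult[symmetric] mult_ac)
  also have "\<dots> = ennreal p * (\<integral>\<^sup>+x. ennreal (f x * h x) \<partial>lborel)"
    by (rule nn_integral_cmult) measurable
  also have "\<dots> \<le> ennreal p * ennreal (A powr (1 / q) * B powr (1 / p))"
  proof (intro mult_left_mono nn_integral_Holder[OF p q(1,2)])
    show "(\<integral>\<^sup>+x. ennreal (f x powr q) \<partial>lborel) = ennreal A"
      unfolding A(1)[symmetric] q_def[symmetric]
    proof (rule nn_integral_cong)
      fix x
      have "(\<bar>v x\<bar> powr (p - 1) * norm x powr (a + 1 - n)) powr q = \<bar>v x\<bar> powr p / norm x powr ((n - 1 - a) * q)"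
      proof -
        have "(a + 1 - n) * q = - ((n - 1 - a) * q)" by (simp add: algebra_simps)
        then show ?thesis using q by (simp add: powr_mult powr_powr powr_minus divide_inverse)
      qed
      then show "ennreal (f x powr q) = ennreal (\<bar>v x\<bar> powr p / norm x powr ((n - 1 - a) * q)) * indicator I (norm x)"
        by (simp add: f_def indicator_def)
    qed
  qed (use A B in \<open>auto simp: f_def h_def\<close>)
  also have "\<dots> = ennreal (p * (A powr (1 / q) * B powr (1 / p)))"
    using p by (simp add: ennreal_mult)
  also have "\<dots> \<le> ennreal (p * (A powr (1 / q) * E powr (1 / p)))"
    using p B by (intro ennreal_leI mult_left_mono powr_mono2) auto
  finally show ?thesis by (simp add: q_def)
qed

text \<open>Without a weight the term F(R) disappears in the limit R to infinity. This is the situation for m \<ge> 0.\<close>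

lemma sphere_power_bound:
  fixes v :: "'a::euclidean_space \<Rightarrow> real"
  defines "n \<equiv> real DIM('a)"
  assumes v: "radial_primitive r v g" and p: "p > 1" and r: "r > 0"
    and A: "(\<integral>\<^sup>+x. ennreal (\<bar>v x\<bar> powr p / norm x powr ((n - 1) * conj_exponent p)) * indicator {r<..} (norm x) \<partial>lborel) = ennreal A" "A \<ge> 0"
    and E: "(\<integral>\<^sup>+x. ennreal (\<bar>g x\<bar> powr p) * indicator {r<..} (norm x) \<partial>lborel) \<le> ennreal E" "E \<ge> 0"
    and lim: "(sphere_power p v \<longlongrightarrow> 0) at_top"
  shows "sphere_power p v r \<le> ennreal (p * (A powr (1 / conj_exponent p) * E powr (1 / p)))" (is "_ \<le> ?C")
proof (rule tendsto_lowerbound)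
  have [measurable]: "v \<in> borel_measurable borel" "g \<in> borel_measurable borel"
    using v by (simp_all add: radial_primitive_def)
  show "((\<lambda>R. sphere_power p v R + ?C) \<longlongrightarrow> ?C) at_top"
    using tendsto_add[OF lim tendsto_const[of ?C]] by simp
  have flux: "(\<integral>\<^sup>+t. sphere_flux p v g t * ennreal (t powr 0) * indicator {r<..} t \<partial>lborel) \<le> ?C"
    using A E r p by (intro sphere_flux_integral_le) (auto simp: n_def)
  show "\<forall>\<^sub>F R in at_top. sphere_power p v r \<le> sphere_power p v R + ?C"
    using eventually_ge_at_top[of r]
  proof eventually_elim
    fix R assume R: "r \<le> R"
    have "sphere_power p v r \<le> sphere_power p v R + (\<integral>\<^sup>+t. sphere_flux p v g t * indicator {r..R} t \<partial>lborel)"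
      by (rule sphere_power_le[OF v p order_refl R])
    also have "(\<integral>\<^sup>+t. sphere_flux p v g t * indicator {r..R} t \<partial>lborel) \<le>
        (\<integral>\<^sup>+t. sphere_flux p v g t * ennreal (t powr 0) * indicator {r<..} t \<partial>lborel)"
    proof (rule nn_integral_mono_AE)
      show "AE t in lborel. sphere_flux p v g t * indicator {r..R} t \<le> sphere_flux p v g t * ennreal (t powr 0) * indicator {r<..} t"
        using AE_lborel_singleton[of r] by eventually_elim (use r in \<open>auto simp: indicator_def\<close>)
    qed
    also note flux
    finally show "sphere_power p v r \<le> sphere_power p v R + ?C" by (simp add: add_left_mono)
  qed
qed simp

text \<open>For x > 1 the right-hand side of the hypothesis is at most (1 + b) x powr (1 - 1/p), and this power can be
  cancelled. The resulting bound depends only on a, b and p; applied to integrals over bounded shells it gives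
  an estimate that is uniform in the radius of the shell.\<close>

lemma powr_self_bound:
  fixes a b c x p :: real
  assumes p: "p > 1" and a: "a > 0" and b: "b \<ge> 0" and x: "x \<ge> 0"
    and le: "a * x \<le> 1 + b * x powr (1 - 1 / p)"
  shows "x \<le> max 1 (((1 + b) / a) powr p)"
proof (cases "x \<le> 1")
  case False
  then have x1: "x > 1" by simp
  have "1 \<le> x powr (1 - 1 / p)" using x1 p by (intro ge_one_powr_ge_zero) auto
  then have "a * x \<le> (1 + b) * x powr (1 - 1 / p)" using le by (simp add: distrib_right)
  then have "a * x powr (1 / p) * x powr (1 - 1 / p) \<le> (1 + b) * x powr (1 - 1 / p)"
    using x1 by (simp add: mult.assoc powr_add[symmetric])
  then have "a * x powr (1 / p) \<le> 1 + b"
    using x1 by (subst (asm) mult_le_cancel_right) auto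
  then have "x powr (1 / p) \<le> (1 + b) / a" using a by (simp add: field_simps)
  then have "(x powr (1 / p)) powr p \<le> ((1 + b) / a) powr p" using p by (intro powr_mono2) auto
  then show ?thesis using p x1 by (simp add: powr_powr)
qed simp

text \<open>The case p < n, with the weight t^(n-p). By the hypothesis with exponent s the integral of
  |v|^p / |x|^p over each bounded shell is finite, and then the inequality bounds it by a
  constant that does not depend on the shell, since the integral enters the right-hand side with an exponent less
  than 1.\<close>

lemma weighted_sphere_power_bound:
  fixes v :: "'a::euclidean_space \<Rightarrow> real"
  defines "n \<equiv> real DIM('a)"
  assumes v: "radial_primitive r v g" and p: "p > 1" and r: "r > 0" and pn: "p < n"
    and fin: "(\<integral>\<^sup>+x. ennreal (\<bar>v x\<bar> powr p / norm x powr s) * indicator {r<..} (norm x) \<partial>lborel) < \<infinity>" and s: "s \<ge> 0"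
    and E: "(\<integral>\<^sup>+x. ennreal (\<bar>g x\<bar> powr p) * indicator {r<..} (norm x) \<partial>lborel) \<le> ennreal E" "E \<ge> 0"
    and lim: "((\<lambda>R. ennreal (R powr (n - p)) * sphere_power p v R) \<longlongrightarrow> 0) at_top"
  shows "\<exists>A\<ge>0. (\<integral>\<^sup>+x. ennreal (\<bar>v x\<bar> powr p / norm x powr p) * indicator {r<..} (norm x) \<partial>lborel) = ennreal A \<and>
    ennreal (r powr (n - p)) * sphere_power p v r + ennreal ((n - p) * A) \<le>
      ennreal (p * (A powr (1 / conj_exponent p) * E powr (1 / p)))"
proof -
  have [measurable]: "v \<in> borel_measurable borel" "g \<in> borel_measurable borel"
    using v by (simp_all add: radial_primitive_def)
  define a where "a = n - p"
  have a: "a > 0" using pn by (simp add: a_def)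
  define q where "q = conj_exponent p"
  have q: "1 / q = 1 - 1 / p" and pq: "(n - 1 - a) * q = p"
    using p by (auto simp: q_def conj_exponent_def a_def field_simps)
  define f where "f x = ennreal (\<bar>v x\<bar> powr p / norm x powr p)" for x
  have [measurable]: "f \<in> borel_measurable borel" unfolding f_def by measurable
  define T where "T R = (\<integral>\<^sup>+x. f x * indicator {r<..R} (norm x) \<partial>lborel)" for R
  define e where "e = E powr (1 / p)"
  have e: "e \<ge> 0" by (simp add: e_def)
  (* On a bounded shell the weights with the exponents p and s are comparable. *)
  have T_fin: "T R < \<infinity>" for R
  proof -
    define C where "C = \<bar>R\<bar> powr s / r powr p"
    have "T R \<le> (\<integral>\<^sup>+x. ennreal C * (ennreal (\<bar>v x\<bar> powr p / norm x powr s) * indicator {r<..} (norm x)) \<partial>lborel)"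
      unfolding T_def
    proof (rule nn_integral_mono)
      fix x
      show "f x * indicator {r<..R} (norm x) \<le> ennreal C * (ennreal (\<bar>v x\<bar> powr p / norm x powr s) * indicator {r<..} (norm x))"
      proof (cases "r < norm x \<and> norm x \<le> R")
        case True
        have "1 / norm x powr p \<le> 1 / r powr p"
          using True r p by (intro divide_left_mono powr_mono2 mult_pos_pos) auto
        moreover have "1 \<le> \<bar>R\<bar> powr s / norm x powr s"
          using True r s by (subst le_divide_eq_1_pos) (auto intro!: powr_mono2)
        ultimately have "1 / norm x powr p * 1 \<le> 1 / r powr p * (\<bar>R\<bar> powr s / norm x powr s)"
          by (intro mult_mono) auto
        then have "\<bar>v x\<bar> powr p * (1 / norm x powr p * 1) \<le> \<bar>v x\<bar> powr p * (1 / r powr p * (\<bar>R\<bar> powr s / norm x powr s))"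
          by (intro mult_left_mono) auto
        then have "\<bar>v x\<bar> powr p / norm x powr p \<le> C * (\<bar>v x\<bar> powr p / norm x powr s)"
          by (simp add: C_def mult_ac)
        then show ?thesis using True r
          by (simp add: f_def C_def ennreal_mult[symmetric] ennreal_leI)
      qed (auto simp: indicator_def)
    qed
    also have "\<dots> = ennreal C * (\<integral>\<^sup>+x. ennreal (\<bar>v x\<bar> powr p / norm x powr s) * indicator {r<..} (norm x) \<partial>lborel)"
      by (rule nn_integral_cmult) measurable
    also have "\<dots> < \<infinity>" using fin by (simp add: ennreal_mult_less_top)
    finally show ?thesis .
  qed
  define AR where "AR R = enn2real (T R)" for R
  have AR: "T R = ennreal (AR R)" "AR R \<ge> 0" for R
    using T_fin[of R] by (simp_all add: AR_def less_top)
  have step: "ennreal (r powr a) * sphere_power p v r + ennreal (a * AR R) \<le>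
      ennreal (R powr a) * sphere_power p v R + ennreal (p * (AR R powr (1 / q) * e))" if R: "R \<ge> r" for R
  proof -
    have T_eq: "T R = (\<integral>\<^sup>+t. sphere_power p v t * ennreal (t powr (a - 1)) * indicator {r..R} t \<partial>lborel)"
    proof -
      have "T R = (\<integral>\<^sup>+t. (\<integral>\<^sup>+w. f (t *\<^sub>R w) \<partial>direction_measure) * ennreal (t powr (DIM('a) - 1)) * indicator {r<..R} t \<partial>lborel)"
        unfolding T_def using r by (intro nn_integral_polar_radial) auto
      also have "\<dots> = (\<integral>\<^sup>+t. sphere_power p v t * ennreal (t powr (a - 1)) * indicator {r..R} t \<partial>lborel)"
      proof (rule nn_integral_cong_AE)
        show "AE t in lborel. (\<integral>\<^sup>+w. f (t *\<^sub>R w) \<partial>direction_measure) * ennreal (t powr (DIM('a) - 1)) * indicator {r<..R} t =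
          sphere_power p v t * ennreal (t powr (a - 1)) * indicator {r..R} t"
          using AE_lborel_singleton[of r]
        proof eventually_elim
          fix t assume tr: "t \<noteq> r"
          show "(\<integral>\<^sup>+w. f (t *\<^sub>R w) \<partial>direction_measure) * ennreal (t powr (DIM('a) - 1)) * indicator {r<..R} t =
            sphere_power p v t * ennreal (t powr (a - 1)) * indicator {r..R} t"
          proof (cases "r < t \<and> t \<le> R")
            case True
            with r have t: "t > 0" by simp
            have "(\<integral>\<^sup>+w. f (t *\<^sub>R w) \<partial>direction_measure) = (\<integral>\<^sup>+w. ennreal (\<bar>v (t *\<^sub>R w)\<bar> powr p) * ennreal (t powr (- p)) \<partial>direction_measure)"
            proof (rule nn_integral_cong_AE)
              show "AE w in direction_measure. f (t *\<^sub>R w) = ennreal (\<bar>v (t *\<^sub>R w)\<bar> powr p) * ennreal (t powr (- p))"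
                using AE_direction_measure_norm
                by eventually_elim (use t in \<open>simp add: f_def ennreal_mult[symmetric] powr_minus divide_inverse\<close>)
            qed
            also have "\<dots> = sphere_power p v t * ennreal (t powr (- p))"
              unfolding sphere_power_def by (rule nn_integral_multc) measurable
            also have "\<dots> * ennreal (t powr (DIM('a) - 1)) = sphere_power p v t * ennreal (t powr (a - 1))"
            proof -
              have "t powr (- p) * t powr (DIM('a) - 1) = t powr (a - 1)"
                unfolding powr_add[symmetric] by (simp add: a_def n_def of_nat_diff Suc_le_eq algebra_simps)
              then show ?thesis by (simp add: mult.assoc ennreal_mult[symmetric])
            qed
            finally show ?thesis using True by simp
          qed (use tr in \<open>auto simp: indicator_def\<close>)
        qed
      qed
      finally show ?thesis .
    qed
    have "(\<integral>\<^sup>+t. sphere_flux p v g t * ennreal (t powr a) * indicator {r..R} t \<partial>lborel) =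
      (\<integral>\<^sup>+t. sphere_flux p v g t * ennreal (t powr a) * indicator {r<..R} t \<partial>lborel)"
    proof (rule nn_integral_cong_AE)
      show "AE t in lborel. sphere_flux p v g t * ennreal (t powr a) * indicator {r..R} t =
        sphere_flux p v g t * ennreal (t powr a) * indicator {r<..R} t"
        using AE_lborel_singleton[of r] by eventually_elim (auto simp: indicator_def)
    qed
    also have "\<dots> \<le> ennreal (p * (AR R powr (1 / conj_exponent p) * E powr (1 / p)))"
    proof (rule sphere_flux_integral_le[OF _ _ _ _ p _ _ _ E(2)])
      show "(\<integral>\<^sup>+x. ennreal (\<bar>v x\<bar> powr p / norm x powr ((real DIM('a) - 1 - a) * conj_exponent p)) * indicator {r<..R} (norm x) \<partial>lborel) = ennreal (AR R)"
        using AR(1)[of R] pq by (simp add: T_def f_def n_def q_def)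
      have "(\<integral>\<^sup>+x. ennreal (\<bar>g x\<bar> powr p) * indicator {r<..R} (norm x) \<partial>lborel) \<le>
          (\<integral>\<^sup>+x. ennreal (\<bar>g x\<bar> powr p) * indicator {r<..} (norm x) \<partial>lborel)"
        by (intro nn_integral_mono) (auto simp: indicator_def)
      then show "(\<integral>\<^sup>+x. ennreal (\<bar>g x\<bar> powr p) * indicator {r<..R} (norm x) \<partial>lborel) \<le> ennreal E"
        using E(1) by (rule order_trans)
    qed (use r AR in auto)
    finally have "(\<integral>\<^sup>+t. sphere_flux p v g t * ennreal (t powr a) * indicator {r..R} t \<partial>lborel) \<le> ennreal (p * (AR R powr (1 / q) * e))"
      by (simp add: q_def e_def)
    with weighted_sphere_power_le[OF v p r R a]
    have "ennreal (r powr a) * sphere_power p v r + ennreal a * T R \<le>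
      ennreal (R powr a) * sphere_power p v R + ennreal (p * (AR R powr (1 / q) * e))"
      unfolding T_eq by (meson add_left_mono order_trans)
    then show ?thesis using a AR[of R] by (simp add: ennreal_mult)
  qed
  (* The bound of the integrals over all bounded shells whose boundary term is at most 1. *)
  define M where "M = max 1 (((1 + p * e) / a) powr p)"
  have "\<forall>\<^sub>F R in at_top. ennreal (R powr (n - p)) * sphere_power p v R < 1"
    by (rule order_tendstoD(2)[OF lim]) simp
  then have "\<forall>\<^sub>F R in at_top. AR R \<le> M"
    using eventually_ge_at_top[of r]
  proof eventually_elim
    fix R assume R: "ennreal (R powr (n - p)) * sphere_power p v R < 1" "r \<le> R"
    have "ennreal (a * AR R) \<le> ennreal (r powr a) * sphere_power p v r + ennreal (a * AR R)"
      by simp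
    also note step[OF R(2)]
    also have "ennreal (R powr a) * sphere_power p v R + ennreal (p * (AR R powr (1 / q) * e)) \<le>
        ennreal 1 + ennreal (p * (AR R powr (1 / q) * e))"
      using R(1) by (intro add_right_mono) (simp add: a_def)
    also have "\<dots> = ennreal (1 + p * (AR R powr (1 / q) * e))"
      using p e by (subst ennreal_plus) auto
    finally have "a * AR R \<le> 1 + (p * e) * AR R powr (1 - 1 / p)"
      using p e q by (subst (asm) ennreal_le_iff) (auto simp: mult_ac)
    then show "AR R \<le> M"
      unfolding M_def using p e a AR by (intro powr_self_bound) auto
  qed
  then obtain R0 where R0: "\<And>R. R \<ge> R0 \<Longrightarrow> AR R \<le> M"
    by (auto simp: eventually_at_top_linorder)
  have T_lim: "(\<lambda>k. T (real k)) \<longlonglongrightarrow> (\<integral>\<^sup>+x. f x * indicator {r<..} (norm x) \<partial>lborel)"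
    unfolding T_def
  proof (rule nn_integral_LIMSEQ)
    show "incseq (\<lambda>k x. f x * indicator {r<..real k} (norm x))"
      by (intro incseq_SucI le_funI) (auto simp: indicator_def)
    fix x :: 'a
    obtain k0 :: nat where k0: "norm x \<le> k0" using real_arch_simple by blast
    show "(\<lambda>k. f x * indicator {r<..real k} (norm x)) \<longlonglongrightarrow> f x * indicator {r<..} (norm x)"
      by (intro tendsto_eventually eventually_sequentiallyI[of k0]) (use k0 in \<open>auto simp: indicator_def\<close>)
  qed measurable
  have T_le: "T (real k) \<le> (\<integral>\<^sup>+x. f x * indicator {r<..} (norm x) \<partial>lborel)" for k
    unfolding T_def by (intro nn_integral_mono) (auto simp: indicator_def)
  have "(\<integral>\<^sup>+x. f x * indicator {r<..} (norm x) \<partial>lborel) \<le> ennreal M"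
  proof (rule LIMSEQ_le_const2[OF T_lim])
    obtain k0 :: nat where k0: "R0 \<le> k0" using real_arch_simple by blast
    show "\<exists>N. \<forall>k\<ge>N. T (real k) \<le> ennreal M"
      by (rule exI[of _ k0]) (use k0 R0 in \<open>auto simp: AR(1) intro!: ennreal_leI\<close>)
  qed
  moreover have "M \<ge> 0" by (simp add: M_def)
  ultimately obtain A where A: "(\<integral>\<^sup>+x. f x * indicator {r<..} (norm x) \<partial>lborel) = ennreal A" "A \<ge> 0"
    by (auto simp: le_ennreal_iff)
  have AR_le: "AR (real k) \<le> A" for k
    using T_le[of k] A AR by (simp add: ennreal_le_iff)
  have "ennreal (r powr a) * sphere_power p v r + ennreal a * ennreal A \<le> 0 + ennreal (p * (A powr (1 / q) * e))"
  proof (rule LIMSEQ_le)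
    show "(\<lambda>k. ennreal (r powr a) * sphere_power p v r + ennreal a * T (real k)) \<longlonglongrightarrow>
        ennreal (r powr a) * sphere_power p v r + ennreal a * ennreal A"
      using T_lim A(1) by (intro tendsto_add tendsto_const ennreal_tendsto_cmult) auto
    show "(\<lambda>k. ennreal (real k powr a) * sphere_power p v (real k) + ennreal (p * (A powr (1 / q) * e))) \<longlonglongrightarrow>
        0 + ennreal (p * (A powr (1 / q) * e))"
      using filterlim_compose[OF lim filterlim_real_sequentially]
      by (intro tendsto_add tendsto_const) (simp add: a_def)
    obtain k0 :: nat where k0: "r \<le> k0" using real_arch_simple by blast
    show "\<exists>N. \<forall>k\<ge>N. ennreal (r powr a) * sphere_power p v r + ennreal a * T (real k) \<le>
       ennreal (real k powr a) * sphere_power p v (real k) + ennreal (p * (A powr (1 / q) * e))"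
    proof (intro exI[of _ k0] allI impI)
      fix k assume "k \<ge> k0"
      then have "ennreal (r powr a) * sphere_power p v r + ennreal a * T (real k) \<le>
         ennreal (real k powr a) * sphere_power p v (real k) + ennreal (p * (AR (real k) powr (1 / q) * e))"
        using step[of "real k"] k0 a AR[of "real k"] by (simp add: ennreal_mult)
      also have "\<dots> \<le> ennreal (real k powr a) * sphere_power p v (real k) + ennreal (p * (A powr (1 / q) * e))"
        using p e q AR_le[of k] AR(2)[of k]
        by (intro add_left_mono ennreal_leI mult_left_mono mult_right_mono powr_mono2) (auto simp: q)
      finally show "ennreal (r powr a) * sphere_power p v r + ennreal a * T (real k) \<le>
         ennreal (real k powr a) * sphere_power p v (real k) + ennreal (p * (A powr (1 / q) * e))" .
    qed
  qed
  then show ?thesis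
    using A a by (intro exI[of _ A]) (auto simp: f_def a_def q_def e_def ennreal_mult)
qed

section \<open>Classical gradients and uniqueness of the weak gradient\<close>

text \<open>Integrate the derivative along the segment from x to x + b first over the segment and then over x. By
  translation invariance the result is the integral of \<psi>(x + b) - \<psi>(x), which vanishes.\<close>

lemma integral_gradient_compact_support:
  fixes \<psi> :: "'a::euclidean_space \<Rightarrow> real"
  assumes \<psi>: "C1_gradient \<psi> E" and K: "compact K" and zero: "\<And>x. x \<notin> K \<Longrightarrow> \<psi> x = 0"
  shows "(\<integral>x. E x \<bullet> b \<partial>lborel) = 0"
proof -
  note [measurable] = C1_gradient_borel[OF \<psi>]
  have E0: "E x = 0" if "x \<notin> K" for x
    using C1_gradient_zero_outside[OF \<psi> compact_imp_closed[OF K] zero that] .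
  have cont_E: "continuous_on A E" for A
    using \<psi> by (auto simp: C1_gradient_def intro: continuous_on_subset)
  have cont_\<psi>: "continuous_on A \<psi>" for A
    using C1_gradient_continuous[OF \<psi>] by (rule continuous_on_subset) simp
  have [measurable]: "K \<in> sets borel" using K by (rule borel_compact)
  define f where "f s x = indicator {0..1::real} s * (E (x + s *\<^sub>R b) \<bullet> b)" for s x
  have [measurable]: "case_prod f \<in> borel_measurable (borel \<Otimes>\<^sub>M borel)"
    unfolding f_def by measurable
  define S where "S = (\<lambda>z. snd z - fst z *\<^sub>R b) ` ({0..1} \<times> K)"
  have S: "compact S"
    unfolding S_def by (intro compact_continuous_image compact_Times K compact_Icc continuous_intros)
  (* f is continuous with compact support on the product of [0, 1] with the space. *)
  have f_int: "integrable (lborel \<Otimes>\<^sub>M lborel) (case_prod f)"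
  proof -
    have "integrable lborel (\<lambda>z. indicator ({0..1} \<times> S) z *\<^sub>R (E (snd z + fst z *\<^sub>R b) \<bullet> b))"
      by (intro borel_integrable_compact compact_Times S compact_Icc continuous_intros
          continuous_on_compose2[OF cont_E[of UNIV]]) auto
    also have "(\<lambda>z. indicator ({0..1} \<times> S) z *\<^sub>R (E (snd z + fst z *\<^sub>R b) \<bullet> b)) = case_prod f"
    proof
      fix z :: "real \<times> 'a"
      obtain s x where z: "z = (s, x)" by (cases z)
      have "x \<in> S" if "s \<in> {0..1}" "E (x + s *\<^sub>R b) \<bullet> b \<noteq> 0"
      proof -
        have "x + s *\<^sub>R b \<in> K" using that E0 by fastforce
        then show ?thesis unfolding S_def using that by (intro image_eqI[of _ _ "(s, x + s *\<^sub>R b)"]) auto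
      qed
      then show "indicator ({0..1} \<times> S) z *\<^sub>R (E (snd z + fst z *\<^sub>R b) \<bullet> b) = case_prod f z"
        by (auto simp: f_def z indicator_def)
    qed
    finally show ?thesis by (simp add: lborel_prod)
  qed
  have shift: "(\<integral>x. h (x + c) \<partial>lborel) = (\<integral>x. h x \<partial>lborel)" if "h \<in> borel_measurable borel" for h :: "'a \<Rightarrow> real" and c
    by (subst lborel_distr_plus[symmetric, of c], subst integral_distr) (use that in \<open>auto simp: add.commute\<close>)
  have "(\<integral>s. (\<integral>x. f s x \<partial>lborel) \<partial>lborel) = (\<integral>x. (\<integral>s. f s x \<partial>lborel) \<partial>lborel)"
    by (rule lborel_pair.Fubini_integral[OF f_int, symmetric])
  also have "\<dots> = (\<integral>x. \<psi> (x + b) - \<psi> x \<partial>lborel)"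
  proof (intro Bochner_Integration.integral_cong refl)
    fix x
    have "(\<integral>s. indicator {0..1} s *\<^sub>R (E (x + s *\<^sub>R b) \<bullet> b) \<partial>lborel) = \<psi> (x + 1 *\<^sub>R b) - \<psi> (x + 0 *\<^sub>R b)"
    proof (rule integral_FTC_atLeastAtMost)
      fix s :: real
      have "((\<lambda>s. x + s *\<^sub>R b) has_derivative (\<lambda>t. t *\<^sub>R b)) (at s)"
        by (auto intro!: derivative_eq_intros)
      moreover have "(\<psi> has_derivative (\<lambda>h. E (x + s *\<^sub>R b) \<bullet> h)) (at (x + s *\<^sub>R b))"
        using \<psi> by (simp add: C1_gradient_def)
      ultimately have "((\<lambda>s. \<psi> (x + s *\<^sub>R b)) has_derivative (\<lambda>t. E (x + s *\<^sub>R b) \<bullet> (t *\<^sub>R b))) (at s)"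
        by (rule has_derivative_compose)
      then show "((\<lambda>s. \<psi> (x + s *\<^sub>R b)) has_vector_derivative E (x + s *\<^sub>R b) \<bullet> b) (at s within {0..1})"
        by (simp add: has_vector_derivative_def has_derivative_at_withinI)
    qed (auto intro!: continuous_intros continuous_on_compose2[OF cont_E[of UNIV]])
    then show "(\<integral>s. f s x \<partial>lborel) = \<psi> (x + b) - \<psi> x" by (simp add: f_def)
  qed
  also have "\<dots> = 0"
  proof -
    have int: "integrable lborel \<psi>"
    proof -
      have "integrable lborel (\<lambda>x. indicator K x *\<^sub>R \<psi> x)"
        by (intro borel_integrable_compact K cont_\<psi>)
      also have "(\<lambda>x. indicator K x *\<^sub>R \<psi> x) = \<psi>" using zero by (auto simp: fun_eq_iff indicator_def)
      finally show ?thesis .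
    qed
    have "integrable (distr lborel borel ((+) b)) \<psi>" using int by (simp add: lborel_distr_plus)
    then have "integrable lborel (\<lambda>x. \<psi> (x + b))"
      by (subst (asm) integrable_distr_eq) (auto simp: add.commute)
    then show ?thesis using int shift[of \<psi> b] by simp
  qed
  finally have "(\<integral>s. (\<integral>x. f s x \<partial>lborel) \<partial>lborel) = 0" .
  moreover have "(\<integral>x. f s x \<partial>lborel) = indicator {0..1} s * (\<integral>x. E x \<bullet> b \<partial>lborel)" for s
    unfolding f_def using shift[of "\<lambda>x. E x \<bullet> b" "s *\<^sub>R b"] by simp
  ultimately show ?thesis by simp
qed

text \<open>Integration by parts: the product of u and a test function, extended by zero, is continuously
  differentiable with compact support.\<close>

lemma is_weak_gradient_classical:
  fixes u :: "real ^ 'n::finite \<Rightarrow> real"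
  assumes \<Omega>: "open \<Omega>" and u: "\<And>x. x \<in> \<Omega> \<Longrightarrow> (u has_derivative (\<lambda>h. G x \<bullet> h)) (at x)"
    and G: "continuous_on \<Omega> G"
  shows "is_weak_gradient \<Omega> u G"
proof -
  have cont_u: "continuous_on \<Omega> u"
    using u by (auto intro!: continuous_at_imp_continuous_on dest: has_derivative_continuous)
  have int: "set_integrable lebesgue K h" "set_integrable lborel K h" if "compact K" "K \<subseteq> \<Omega>" "continuous_on \<Omega> h"
    for K and h :: "real ^ 'n \<Rightarrow> 'b::{banach, second_countable_topology}"
  proof -
    have "continuous_on K h" using that by (auto intro: continuous_on_subset)
    then have i: "integrable lborel (\<lambda>x. indicator K x *\<^sub>R h x)"
      by (intro borel_integrable_compact that)
    then show "set_integrable lborel K h" by (simp add: set_integrable_def)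
    have "(\<lambda>x. indicator K x *\<^sub>R h x) \<in> borel_measurable lborel"
      using i by (rule borel_measurable_integrable)
    then show "set_integrable lebesgue K h"
      using i unfolding set_integrable_def by (subst integrable_completion)
  qed
  show ?thesis
    unfolding is_weak_gradient_def locally_integrable_on_def
  proof (intro conjI allI impI; (elim conjE)?)
    fix K assume "compact K" "K \<subseteq> \<Omega>"
    then show "set_integrable lebesgue K u" "set_integrable lebesgue K G"
      using int cont_u G by blast+
  next
    fix \<phi> i assume test: "test_function \<Omega> \<phi>"
    define D where "D x = (\<chi> i. partial_deriv i \<phi> x)" for x
    define K where "K = closure {x. \<phi> x \<noteq> 0}"
    have K: "compact K" "K \<subseteq> \<Omega>" using test by (auto simp: test_function_def K_def)
    have zero: "\<phi> x = 0" if "x \<notin> K" for x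
      using that closure_subset[of "{x. \<phi> x \<noteq> 0}"] by (auto simp: K_def)
    have \<phi>: "C1_gradient \<phi> D"
      using C1_gradient_of_test_function[OF test] by (simp add: D_def[abs_def])
    note [measurable] = C1_gradient_borel[OF \<phi>]
    have D0: "D x = 0" if "x \<notin> K" for x
      using C1_gradient_zero_outside[OF \<phi> compact_imp_closed[OF K(1)] zero that] .
    have cont: "continuous_on A \<phi>" "continuous_on A D" for A
      using \<phi> C1_gradient_continuous[OF \<phi>] by (auto simp: C1_gradient_def intro: continuous_on_subset)
    define \<psi> where "\<psi> x = (if x \<in> \<Omega> then u x * \<phi> x else 0)" for x
    define E where "E x = (if x \<in> \<Omega> then u x *\<^sub>R D x + \<phi> x *\<^sub>R G x else 0)" for x
    have "C1_gradient \<psi> E"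
      unfolding C1_gradient_def
    proof (intro conjI allI)
      fix x
      show "(\<psi> has_derivative (\<lambda>h. E x \<bullet> h)) (at x)"
      proof (cases "x \<in> \<Omega>")
        case True
        have "(\<phi> has_derivative (\<lambda>h. D x \<bullet> h)) (at x)" using \<phi> by (simp add: C1_gradient_def)
        with u[OF True] have "((\<lambda>x. u x * \<phi> x) has_derivative (\<lambda>h. u x * (D x \<bullet> h) + (G x \<bullet> h) * \<phi> x)) (at x)"
          by (rule has_derivative_mult)
        then have "((\<lambda>x. u x * \<phi> x) has_derivative (\<lambda>h. E x \<bullet> h)) (at x)"
          by (rule has_derivative_eq_rhs) (use True in \<open>simp add: E_def fun_eq_iff inner_add_left mult.commute\<close>)
        then show ?thesis
          by (rule has_derivative_transform_within_open[OF _ \<Omega> True]) (simp add: \<psi>_def)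
      next
        case False
        then have "x \<in> - K" using K by auto
        have "((\<lambda>x. 0) has_derivative (\<lambda>h. E x \<bullet> h)) (at x)" using False by (simp add: E_def)
        then show ?thesis
          by (rule has_derivative_transform_within_open[OF _ _ \<open>x \<in> - K\<close>])
             (use K zero in \<open>auto simp: \<psi>_def compact_imp_closed open_Compl\<close>)
      qed
    next
      have "continuous_on \<Omega> (\<lambda>x. u x *\<^sub>R D x + \<phi> x *\<^sub>R G x)"
        by (intro continuous_intros cont cont_u G)
      then have 1: "continuous_on \<Omega> E" by (rule continuous_on_eq) (simp add: E_def)
      have 2: "continuous_on (- K) E"
        by (rule continuous_on_eq[OF continuous_on_const[of _ 0]]) (auto simp: E_def zero D0)
      have "continuous_on (\<Omega> \<union> - K) E"
        using K by (intro continuous_on_open_Un \<Omega> open_Compl compact_imp_closed 1 2)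
      moreover have "\<Omega> \<union> - K = UNIV" using K by auto
      ultimately show "continuous_on UNIV E" by simp
    qed
    moreover have "\<psi> x = 0" if "x \<notin> K" for x using zero[OF that] by (simp add: \<psi>_def)
    ultimately have zero_int: "(\<integral>x. E x \<bullet> axis i 1 \<partial>lborel) = 0"
      by (intro integral_gradient_compact_support[OF _ K(1)])
    have i1: "integrable lborel (\<lambda>x. u x * (D x \<bullet> axis i 1))"
      using D0 by (intro integrable_mult_continuous_support[OF int(2)[OF K cont_u] K(1)]) (auto intro!: continuous_intros cont)
    have i2: "integrable lborel (\<lambda>x. (G x \<bullet> axis i 1) * \<phi> x)"
      using zero by (intro integrable_mult_continuous_support[OF int(2)[OF K] K(1)]) (auto intro!: continuous_intros cont G)
    have pd: "partial_deriv i \<phi> x = D x \<bullet> axis i 1" for x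
      by (simp add: D_def inner_axis)
    have "(LINT x:\<Omega>|lebesgue. u x * partial_deriv i \<phi> x) = (\<integral>x. u x * (D x \<bullet> axis i 1) \<partial>lebesgue)"
      unfolding set_lebesgue_integral_def pd using D0[OF contra_subsetD[OF K(2)]]
      by (intro Bochner_Integration.integral_cong refl) (auto simp: indicator_def)
    also have "\<dots> = (\<integral>x. u x * (D x \<bullet> axis i 1) \<partial>lborel)"
      using i1 by (intro integral_completion) auto
    also have "\<dots> = - (\<integral>x. (G x \<bullet> axis i 1) * \<phi> x \<partial>lborel)"
    proof -
      have "(\<integral>x. E x \<bullet> axis i 1 \<partial>lborel) = (\<integral>x. u x * (D x \<bullet> axis i 1) + (G x \<bullet> axis i 1) * \<phi> x \<partial>lborel)"
        using D0[OF contra_subsetD[OF K(2)]] zero[OF contra_subsetD[OF K(2)]]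
        by (intro Bochner_Integration.integral_cong refl) (auto simp: E_def inner_add_left mult.commute)
      then show ?thesis using zero_int i1 i2 by simp
    qed
    also have "(\<integral>x. (G x \<bullet> axis i 1) * \<phi> x \<partial>lborel) = (\<integral>x. (G x \<bullet> axis i 1) * \<phi> x \<partial>lebesgue)"
      using i2 by (intro integral_completion[symmetric]) auto
    also have "\<dots> = (LINT x:\<Omega>|lebesgue. G x $ i * \<phi> x)"
      unfolding set_lebesgue_integral_def using zero[OF contra_subsetD[OF K(2)]]
      by (intro Bochner_Integration.integral_cong refl) (auto simp: indicator_def inner_axis)
    finally show "(LINT x:\<Omega>|lebesgue. u x * partial_deriv i \<phi> x) = - (LINT x:\<Omega>|lebesgue. G x $ i * \<phi> x)" .
  qed
qed

lemma weak_gradient_unique: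
  fixes u :: "real ^ 'n::finite \<Rightarrow> real"
  assumes \<Omega>: "open \<Omega>" and G: "is_weak_gradient \<Omega> u G" and H: "is_weak_gradient \<Omega> u H"
  shows "AE x in lborel. x \<in> \<Omega> \<longrightarrow> G x = H x"
proof -
  obtain u1 G1 where wg1: "borel_weak_gradient \<Omega> u1 G1" and ae1: "AE x in lborel. x \<in> \<Omega> \<longrightarrow> u x = u1 x \<and> G x = G1 x"
    using is_weak_gradient_borel[OF \<Omega> G] by blast
  obtain u2 G2 where wg2: "borel_weak_gradient \<Omega> u2 G2" and ae2: "AE x in lborel. x \<in> \<Omega> \<longrightarrow> u x = u2 x \<and> H x = G2 x"
    using is_weak_gradient_borel[OF \<Omega> H] by blast
  note [measurable] = borel_weak_gradient_measurable_function[OF wg1] borel_weak_gradient_measurable_gradient[OF wg1] borel_weak_gradient_measurable_function[OF wg2] borel_weak_gradient_measurable_gradient[OF wg2]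
  have "AE x in lborel. \<forall>b\<in>Basis. x \<in> \<Omega> \<longrightarrow> (G1 x - G2 x) \<bullet> b = 0"
  proof (subst AE_ball_countable, simp add: countable_finite, rule ballI)
    fix b :: "real ^ 'n" assume b: "b \<in> Basis"
    have int: "set_integrable lborel K (\<lambda>x. G1 x \<bullet> b)" "set_integrable lborel K (\<lambda>x. G2 x \<bullet> b)" if "compact K" "K \<subseteq> \<Omega>" for K
      using borel_weak_gradient_integrable_gradient[OF wg1 that] borel_weak_gradient_integrable_gradient[OF wg2 that] by (auto simp: set_integrable_def simp flip: inner_scaleR_left)
    show "AE x in lborel. x \<in> \<Omega> \<longrightarrow> (G1 x - G2 x) \<bullet> b = 0"
    proof (rule fundamental_lemma_calculus_of_variations[OF _ \<Omega>])
      show "set_integrable lborel K (\<lambda>x. (G1 x - G2 x) \<bullet> b)" if "compact K" "K \<subseteq> \<Omega>" for K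
        using int[OF that] by (simp add: inner_diff_left)
    next
      fix \<phi> D K assume \<phi>: "C1_gradient \<phi> D" and K: "compact K" "K \<subseteq> \<Omega>" and zero: "\<And>x. x \<notin> K \<Longrightarrow> \<phi> x = 0"
      note [measurable] = C1_gradient_borel[OF \<phi>]
      have D0: "D x = 0" if "x \<notin> K" for x
        using C1_gradient_zero_outside[OF \<phi> compact_imp_closed[OF K(1)] zero that] .
      have cont: "continuous_on A \<phi>" for A
        using C1_gradient_continuous[OF \<phi>] by (rule continuous_on_subset) simp
      have i: "integrable lborel (\<lambda>x. (G1 x \<bullet> b) * \<phi> x)" "integrable lborel (\<lambda>x. (G2 x \<bullet> b) * \<phi> x)"
        using zero by (intro integrable_mult_continuous_support[OF int(1)[OF K] K(1)]
            integrable_mult_continuous_support[OF int(2)[OF K] K(1)] cont; simp)+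
      have "(\<integral>x. u1 x * (D x \<bullet> b) \<partial>lborel) = (\<integral>x. u2 x * (D x \<bullet> b) \<partial>lborel)"
      proof (rule integral_cong_AE)
        show "AE x in lborel. u1 x * (D x \<bullet> b) = u2 x * (D x \<bullet> b)"
          using ae1 ae2 by eventually_elim (use D0[OF contra_subsetD[OF K(2)]] in auto)
      qed measurable
      then show "(\<integral>x. ((G1 x - G2 x) \<bullet> b) * \<phi> x \<partial>lborel) = 0"
        using borel_weak_gradient_identity[OF wg1 \<phi> K zero b] borel_weak_gradient_identity[OF wg2 \<phi> K zero b] i by (simp add: inner_diff_left left_diff_distrib)
    qed measurable
  qed
  with ae1 ae2 show ?thesis
  proof eventually_elim
    fix x assume "x \<in> \<Omega> \<longrightarrow> u x = u1 x \<and> G x = G1 x" "x \<in> \<Omega> \<longrightarrow> u x = u2 x \<and> H x = G2 x"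
      "\<forall>b\<in>Basis. x \<in> \<Omega> \<longrightarrow> (G1 x - G2 x) \<bullet> b = 0"
    then show "x \<in> \<Omega> \<longrightarrow> G x = H x"
      using euclidean_all_zero_iff[of "G1 x - G2 x"] by auto
  qed
qed

section \<open>The inequalities for the class M1\<close>

text \<open>The integrals over the exterior domain in the definition of the class are expressed as nonnegative
  integrals of Borel functions, where the polar coordinate formula applies.\<close>

lemma exterior_integral:
  fixes f h :: "real ^ 'n::finite \<Rightarrow> real"
  assumes [measurable]: "f \<in> borel_measurable borel" and f0: "\<And>x. f x \<ge> 0"
    and AE: "AE x in lborel. x \<in> - cball 0 r \<longrightarrow> h x = f x"
  shows "set_integrable lebesgue (- cball 0 r) h \<longleftrightarrow>
      (\<integral>\<^sup>+x. ennreal (f x) * indicator {r<..} (norm x) \<partial>lborel) < \<infinity>" (is "_ \<longleftrightarrow> ?X < \<infinity>")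
    and "(LINT x:- cball 0 r|lebesgue. h x) =
      enn2real (\<integral>\<^sup>+x. ennreal (f x) * indicator {r<..} (norm x) \<partial>lborel)"
proof -
  have [measurable]: "- cball (0 :: real ^ 'n) r \<in> sets borel" by simp
  have X: "?X = (\<integral>\<^sup>+x. ennreal (indicator (- cball 0 r) x *\<^sub>R f x) \<partial>lborel)"
    by (intro nn_integral_cong) (auto simp: indicator_def)
  have "set_integrable lebesgue (- cball 0 r) h \<longleftrightarrow> set_integrable lborel (- cball 0 r) f"
    by (rule set_integrable_lebesgue_AE_eq(1)[OF _ _ AE]) measurable
  also have "\<dots> \<longleftrightarrow> ?X < \<infinity>"
    unfolding set_integrable_def integrable_iff_bounded X using f0 by simp
  finally show "set_integrable lebesgue (- cball 0 r) h \<longleftrightarrow> ?X < \<infinity>" .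
  have "(LINT x:- cball 0 r|lebesgue. h x) = (LINT x:- cball 0 r|lborel. f x)"
    by (rule set_integrable_lebesgue_AE_eq(2)[OF _ _ AE]) measurable
  also have "\<dots> = enn2real ?X"
    unfolding set_lebesgue_integral_def X using f0 by (intro integral_eq_nn_integral) auto
  finally show "(LINT x:- cball 0 r|lebesgue. h x) = enn2real ?X" .
qed

text \<open>For R \<ge> r the trace on the sphere of radius R is almost everywhere equal to the Borel
  function v. The factor R^(n-1) is the one that the definition of the class compensates.\<close>

lemma sphere_trace:
  fixes u :: "real ^ 'n::finite \<Rightarrow> real"
  assumes r: "r > 0" and R: "R \<ge> r" and [measurable]: "v \<in> borel_measurable borel"
    and tr: "AE w in direction_measure. \<forall>t\<ge>r. ray_trace r u (t *\<^sub>R w) = v (t *\<^sub>R w)"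
  shows "(\<integral>\<^sup>+x. ennreal (\<bar>ray_trace r u x\<bar> powr p) \<partial>sphere_measure R) = ennreal (R powr (real CARD('n) - 1)) * sphere_power p v R"
    and "(\<lambda>x. \<bar>ray_trace r u x\<bar> powr p) \<in> borel_measurable (sphere_measure R)"
proof -
  have R0: "R > 0" using r R by simp
  note S = sphere_measure_eq_completion[where 'n = 'n, OF R0]
  have ae: "AE x in sphere_measure R. ray_trace r u x = v x"
    unfolding AE_sphere_measure_iff[OF R0] using tr by eventually_elim (use R in auto)
  have "(\<integral>\<^sup>+x. ennreal (\<bar>ray_trace r u x\<bar> powr p) \<partial>sphere_measure R) = (\<integral>\<^sup>+x. ennreal (\<bar>v x\<bar> powr p) \<partial>sphere_measure R)"
    using ae by (intro nn_integral_cong_AE) (auto elim: eventually_mono)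
  also have "\<dots> = ennreal (R ^ (CARD('n) - 1)) * sphere_power p v R"
    unfolding sphere_power_def by (rule nn_integral_sphere_measure[OF R0]) measurable
  also have "R ^ (CARD('n) - 1) = R powr (real CARD('n) - 1)"
    using powr_realpow[OF R0, of "CARD('n) - 1"] by (simp add: of_nat_diff Suc_le_eq)
  finally show "(\<integral>\<^sup>+x. ennreal (\<bar>ray_trace r u x\<bar> powr p) \<partial>sphere_measure R) = ennreal (R powr (real CARD('n) - 1)) * sphere_power p v R" .
  show "(\<lambda>x. \<bar>ray_trace r u x\<bar> powr p) \<in> borel_measurable (sphere_measure R)"
    unfolding S(1)
  proof (rule borel_measurable_completion_AE_eq)
    show "AE x in scale_measure (ennreal (real CARD('n) / R))
       (distr (restrict_space lborel (ball 0 R - {0})) (restrict_space borel (sphere 0 R)) (\<lambda>x. (R / norm x) *\<^sub>R x)).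
        \<bar>ray_trace r u x\<bar> powr p = \<bar>v x\<bar> powr p"
      using ae unfolding S(1) AE_completion_iff by eventually_elim simp
    have "(\<lambda>x. \<bar>v x\<bar> powr p) \<in> borel_measurable (restrict_space borel (sphere 0 R))"
      by (rule measurable_restrict_space1) measurable
    then show "(\<lambda>x. \<bar>v x\<bar> powr p) \<in> borel_measurable (scale_measure (ennreal (real CARD('n) / R))
       (distr (restrict_space lborel (ball 0 R - {0})) (restrict_space borel (sphere 0 R)) (\<lambda>x. (R / norm x) *\<^sub>R x)))"
      by (subst measurable_cong_sets[OF S(2) refl])
  qed
qed

lemma boundary_integral_eq:
  fixes u :: "real ^ 'n::finite \<Rightarrow> real"
  assumes r: "r > 0" and v: "v \<in> borel_measurable borel"
    and tr: "AE w in direction_measure. \<forall>t\<ge>r. ray_trace r u (t *\<^sub>R w) = v (t *\<^sub>R w)"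
  shows "boundary_integrable p r u \<longleftrightarrow> sphere_power p v r < \<infinity>"
    and "boundary_integral p r u = r powr (real CARD('n) - 1) * enn2real (sphere_power p v r)"
proof -
  note tr = sphere_trace[OF r order_refl v tr, of p]
  show "boundary_integrable p r u \<longleftrightarrow> sphere_power p v r < \<infinity>"
    unfolding boundary_integrable_def integrable_iff_bounded using tr r
    by (auto simp: ennreal_mult_less_top ennreal_eq_0_iff)
  show "boundary_integral p r u = r powr (real CARD('n) - 1) * enn2real (sphere_power p v r)"
    unfolding boundary_integral_def using tr by (subst integral_eq_nn_integral) (auto simp: enn2real_mult)
qed

text \<open>What membership in the class says about a Borel representative; the weight in the limit is the one
  with which the average over the directions tends to zero.\<close>

lemma M1_structure:
  fixes u :: "real ^ 'n::finite \<Rightarrow> real"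
  defines "n \<equiv> real CARD('n)"
  assumes u: "u \<in> M1 p r" and p: "p > 1" and r: "r > 0"
  shows "\<exists>v g. radial_primitive r v g \<and>
    (AE x in lborel. x \<in> - cball 0 r \<longrightarrow> u x = v x) \<and>
    (AE w in direction_measure. \<forall>t\<ge>r. ray_trace r u (t *\<^sub>R w) = v (t *\<^sub>R w)) \<and>
    (\<integral>\<^sup>+x. ennreal (\<bar>g x\<bar> powr p) * indicator {r<..} (norm x) \<partial>lborel) = ennreal (radial_energy p r u) \<and>
    (\<integral>\<^sup>+x. ennreal (\<bar>v x\<bar> powr p / norm x powr ((n - 1) * conj_exponent p)) * indicator {r<..} (norm x) \<partial>lborel) =
      ennreal (weighted_integral p ((n - 1) * conj_exponent p) r u) \<and>
    ((\<lambda>R. ennreal (R powr (if (p - n) / (p - 1) \<ge> 0 then 0 else n - p)) * sphere_power p v R) \<longlongrightarrow> 0) at_top"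
proof -
  define m where "m = (p - n) / (p - 1)"
  have wd: "u weakly_differentiable_on (- cball 0 r)"
    and int_g: "set_integrable lebesgue (- cball 0 r) (\<lambda>x. \<bar>radial_derivative r u x\<bar> powr p)"
    and int_u: "set_integrable lebesgue (- cball 0 r) (\<lambda>x. \<bar>u x\<bar> powr p / norm x powr ((n - 1) * conj_exponent p))"
    and lim: "((\<lambda>R. ennreal (R powr (if m \<ge> 0 then 1 - n else 1 - p)) *
           (\<integral>\<^sup>+ x. ennreal (\<bar>ray_trace r u x\<bar> powr p) \<partial>sphere_measure R)) \<longlongrightarrow> 0) at_top"
    using u unfolding M1_def Let_def mem_Collect_eq n_def m_def by - (elim conjE, assumption)+
  obtain v g where prim: "radial_primitive r v g"
    and ae: "AE x in lborel. x \<in> - cball 0 r \<longrightarrow> u x = v x \<and> radial_derivative r u x = g x"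
    and tr: "AE w in direction_measure. \<forall>t\<ge>r. ray_trace r u (t *\<^sub>R w) = v (t *\<^sub>R w)"
    using ray_trace_is_radial_primitive[OF r less_imp_le[OF p] wd int_g] by blast
  have vg [measurable]: "v \<in> borel_measurable borel" "g \<in> borel_measurable borel"
    using prim by (simp_all add: radial_primitive_def)
  have "AE x in lborel. x \<in> - cball 0 r \<longrightarrow> u x = v x"
    using ae by eventually_elim auto
  moreover have "(\<integral>\<^sup>+x. ennreal (\<bar>g x\<bar> powr p) * indicator {r<..} (norm x) \<partial>lborel) = ennreal (radial_energy p r u)"
  proof -
    have "AE x in lborel. x \<in> - cball 0 r \<longrightarrow> \<bar>radial_derivative r u x\<bar> powr p = \<bar>g x\<bar> powr p"
      using ae by eventually_elim auto
    from exterior_integral[OF _ _ this] int_g show ?thesis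
      by (simp add: radial_energy_def less_top)
  qed
  moreover have "(\<integral>\<^sup>+x. ennreal (\<bar>v x\<bar> powr p / norm x powr ((n - 1) * conj_exponent p)) * indicator {r<..} (norm x) \<partial>lborel) =
      ennreal (weighted_integral p ((n - 1) * conj_exponent p) r u)"
  proof -
    have "AE x in lborel. x \<in> - cball 0 r \<longrightarrow> \<bar>u x\<bar> powr p / norm x powr ((n - 1) * conj_exponent p) =
        \<bar>v x\<bar> powr p / norm x powr ((n - 1) * conj_exponent p)"
      using ae by eventually_elim auto
    from exterior_integral[OF _ _ this] int_u show ?thesis
      by (simp add: weighted_integral_def less_top)
  qed
  moreover have "((\<lambda>R. ennreal (R powr (if m \<ge> 0 then 0 else n - p)) * sphere_power p v R) \<longlongrightarrow> 0) at_top"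
  proof (rule Lim_transform_eventually[OF lim])
    show "\<forall>\<^sub>F R in at_top. ennreal (R powr (if m \<ge> 0 then 1 - n else 1 - p)) *
           (\<integral>\<^sup>+ x. ennreal (\<bar>ray_trace r u x\<bar> powr p) \<partial>sphere_measure R) =
         ennreal (R powr (if m \<ge> 0 then 0 else n - p)) * sphere_power p v R"
      using eventually_ge_at_top[of r]
    proof eventually_elim
      fix R assume R: "r \<le> R"
      have "ennreal (R powr (if m \<ge> 0 then 1 - n else 1 - p)) * ennreal (R powr (n - 1)) =
        ennreal (R powr (if m \<ge> 0 then 0 else n - p))"
        by (simp add: ennreal_mult[symmetric] powr_add[symmetric])
      then show "ennreal (R powr (if m \<ge> 0 then 1 - n else 1 - p)) *
           (\<integral>\<^sup>+ x. ennreal (\<bar>ray_trace r u x\<bar> powr p) \<partial>sphere_measure R) =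
         ennreal (R powr (if m \<ge> 0 then 0 else n - p)) * sphere_power p v R"
        unfolding sphere_trace(1)[OF r R vg(1) tr] n_def[symmetric] mult.assoc[symmetric] by simp
    qed
  qed
  ultimately show ?thesis using prim tr unfolding m_def by blast
qed

text \<open>Both (i) and (iii): for m = 0, that is p = n, the exponent (n - 1) p' equals n.\<close>

lemma M1_inequality_nonneg:
  fixes u :: "real ^ 'n::finite \<Rightarrow> real"
  defines "n \<equiv> real CARD('n)"
  assumes u: "u \<in> M1 p r" and p: "p > 1" and r: "r > 0" and m: "(p - n) / (p - 1) \<ge> 0"
  shows "boundary_integrable p r u"
    and "1 / p * r powr (1 - n) * boundary_integral p r u \<le>
      weighted_integral p ((n - 1) * conj_exponent p) r u powr (1 / conj_exponent p) * radial_energy p r u powr (1 / p)"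
      (is "_ \<le> ?W powr _ * ?E powr _")
proof -
  obtain v g where v: "radial_primitive r v g"
    and tr: "AE w in direction_measure. \<forall>t\<ge>r. ray_trace r u (t *\<^sub>R w) = v (t *\<^sub>R w)"
    and E: "(\<integral>\<^sup>+x. ennreal (\<bar>g x\<bar> powr p) * indicator {r<..} (norm x) \<partial>lborel) = ennreal ?E"
    and W: "(\<integral>\<^sup>+x. ennreal (\<bar>v x\<bar> powr p / norm x powr ((n - 1) * conj_exponent p)) * indicator {r<..} (norm x) \<partial>lborel) = ennreal ?W"
    and lim: "((\<lambda>R. ennreal (R powr (if (p - n) / (p - 1) \<ge> 0 then 0 else n - p)) * sphere_power p v R) \<longlongrightarrow> 0) at_top"
    using M1_structure[OF u p r, folded n_def] by blast
  have vm: "v \<in> borel_measurable borel" using v by (simp add: radial_primitive_def)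
  have lim': "(sphere_power p v \<longlongrightarrow> 0) at_top"
  proof (rule Lim_transform_eventually[OF lim])
    show "\<forall>\<^sub>F R in at_top. ennreal (R powr (if (p - n) / (p - 1) \<ge> 0 then 0 else n - p)) * sphere_power p v R = sphere_power p v R"
      using eventually_gt_at_top[of 0] by eventually_elim (use m in simp)
  qed
  have WE: "?W \<ge> 0" "?E \<ge> 0"
    by (auto simp: weighted_integral_def radial_energy_def set_lebesgue_integral_def intro!: integral_nonneg_AE always_eventually)
  have le: "sphere_power p v r \<le> ennreal (p * (?W powr (1 / conj_exponent p) * ?E powr (1 / p)))"
    using W E WE by (intro sphere_power_bound[OF v p r _ _ _ _ lim']) (simp_all add: n_def)
  then have fin: "sphere_power p v r < \<infinity>"
    by (rule le_less_trans) simp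
  then show "boundary_integrable p r u"
    using boundary_integral_eq(1)[OF r vm tr] by simp
  have "enn2real (sphere_power p v r) \<le> p * (?W powr (1 / conj_exponent p) * ?E powr (1 / p))"
    using enn2real_mono[OF le] p by simp
  moreover have "1 / p * r powr (1 - n) * boundary_integral p r u = 1 / p * enn2real (sphere_power p v r)"
  proof -
    have "r powr (1 - n) * r powr (n - 1) = 1"
      using r by (simp add: powr_add[symmetric])
    then show ?thesis
      unfolding boundary_integral_eq(2)[OF r vm tr] n_def[symmetric] by (metis mult.assoc mult.right_neutral)
  qed
  ultimately show "1 / p * r powr (1 - n) * boundary_integral p r u \<le> ?W powr (1 / conj_exponent p) * ?E powr (1 / p)"
    using p by (simp add: field_simps)
qed

text \<open>If u vanishes almost everywhere, the weighted integral is zero and so is its power with negative exponent, by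
  the convention 0 powr a = 0. Hence the formula covers the exceptional case in the definition.\<close>

lemma boundary_quotient_eq:
  fixes u :: "real ^ 'n::finite \<Rightarrow> real"
  shows "boundary_quotient p r u = 1 / p * r powr (1 - p) * boundary_integral p r u *
    weighted_integral p p r u powr (- (1 / conj_exponent p))"
proof (cases "AE x in lebesgue. x \<in> - cball 0 r \<longrightarrow> u x = 0")
  case True
  then have "AE x in lborel. x \<in> - cball 0 r \<longrightarrow> \<bar>u x\<bar> powr p / norm x powr p = 0"
    unfolding AE_completion_iff by eventually_elim auto
  from exterior_integral(2)[OF _ _ this] have "weighted_integral p p r u = 0"
    by (simp add: weighted_integral_def)
  then show ?thesis using True by (simp add: boundary_quotient_def)
qed (simp add: boundary_quotient_def)

text \<open>Division of the weighted estimate by p A^(1/p'), where A is the integral of |u|^p / |x|^p.\<close>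

lemma M1_inequality_neg:
  fixes u :: "real ^ 'n::finite \<Rightarrow> real"
  defines "n \<equiv> real CARD('n)"
  assumes u: "u \<in> M1 p r" and p: "p > 1" and r: "r > 0" and m: "(p - n) / (p - 1) < 0"
  shows "weighted_integrable p p r u" and "boundary_integrable p r u"
    and "\<bar>(p - n) / (p - 1)\<bar> / conj_exponent p * weighted_integral p p r u powr (1 / p) + boundary_quotient p r u
      \<le> radial_energy p r u powr (1 / p)" (is "_ \<le> ?E powr _")
proof -
  define q where "q = conj_exponent p"
  have q: "1 / q = 1 - 1 / p" using p by (auto simp: q_def conj_exponent_def field_simps)
  have pn: "p < n" using m p by (simp add: divide_less_0_iff)
  have n1: "n \<ge> 1" by (simp add: n_def Suc_le_eq)
  obtain v g where v: "radial_primitive r v g"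
    and ae: "AE x in lborel. x \<in> - cball 0 r \<longrightarrow> u x = v x"
    and tr: "AE w in direction_measure. \<forall>t\<ge>r. ray_trace r u (t *\<^sub>R w) = v (t *\<^sub>R w)"
    and E: "(\<integral>\<^sup>+x. ennreal (\<bar>g x\<bar> powr p) * indicator {r<..} (norm x) \<partial>lborel) = ennreal ?E"
    and W: "(\<integral>\<^sup>+x. ennreal (\<bar>v x\<bar> powr p / norm x powr ((n - 1) * conj_exponent p)) * indicator {r<..} (norm x) \<partial>lborel)
       = ennreal (weighted_integral p ((n - 1) * conj_exponent p) r u)"
    and lim: "((\<lambda>R. ennreal (R powr (if (p - n) / (p - 1) \<ge> 0 then 0 else n - p)) * sphere_power p v R) \<longlongrightarrow> 0) at_top"
    using M1_structure[OF u p r, folded n_def] by blast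
  have vm [measurable]: "v \<in> borel_measurable borel" using v by (simp add: radial_primitive_def)
  have E0: "?E \<ge> 0"
    by (auto simp: radial_energy_def set_lebesgue_integral_def intro!: integral_nonneg_AE always_eventually)
  obtain A where A: "A \<ge> 0" "(\<integral>\<^sup>+x. ennreal (\<bar>v x\<bar> powr p / norm x powr p) * indicator {r<..} (norm x) \<partial>lborel) = ennreal A"
    and le: "ennreal (r powr (n - p)) * sphere_power p v r + ennreal ((n - p) * A) \<le>
      ennreal (p * (A powr (1 / q) * ?E powr (1 / p)))"
    using weighted_sphere_power_bound[OF v p r, of "(n - 1) * conj_exponent p" ?E] pn W E E0 lim m n1 p
    by (auto simp: n_def q_def conj_exponent_def not_le)
  have ae': "AE x in lborel. x \<in> - cball 0 r \<longrightarrow> \<bar>u x\<bar> powr p / norm x powr p = \<bar>v x\<bar> powr p / norm x powr p"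
    using ae by eventually_elim auto
  note ext = exterior_integral[OF _ _ ae']
  show "weighted_integrable p p r u"
    unfolding weighted_integrable_def using ext(1) A by simp
  have A_eq: "weighted_integral p p r u = A"
    unfolding weighted_integral_def using ext(2) A by simp
  have fin: "sphere_power p v r < \<infinity>"
  proof -
    have "ennreal (r powr (n - p)) * sphere_power p v r \<le> ennreal (p * (A powr (1 / q) * ?E powr (1 / p)))"
      using le by (rule order_trans[rotated]) simp
    then have "ennreal (r powr (n - p)) * sphere_power p v r < \<infinity>" by (rule le_less_trans) simp
    then show ?thesis using r by (auto simp: ennreal_mult_less_top ennreal_eq_0_iff)
  qed
  then show "boundary_integrable p r u"
    using boundary_integral_eq(1)[OF r vm tr] by simp
  define F where "F = enn2real (sphere_power p v r)"
  have F: "sphere_power p v r = ennreal F" "F \<ge> 0" using fin by (simp_all add: F_def less_top)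
  have "ennreal (r powr (n - p) * F + (n - p) * A) \<le> ennreal (p * (A powr (1 / q) * ?E powr (1 / p)))"
    using le F A(1) pn by (simp add: ennreal_mult[symmetric] ennreal_plus[symmetric] del: ennreal_plus)
  then have real_le: "r powr (n - p) * F + (n - p) * A \<le> p * (A powr (1 / q) * ?E powr (1 / p))"
    using p by (subst (asm) ennreal_le_iff) auto
  have quot: "boundary_quotient p r u = 1 / p * (r powr (n - p) * F) * A powr (- (1 / q))"
  proof -
    have "r powr (1 - p) * r powr (n - 1) = r powr (n - p)"
      by (simp add: powr_add[symmetric])
    then show ?thesis
      unfolding boundary_quotient_eq A_eq boundary_integral_eq(2)[OF r vm tr] n_def[symmetric] F_def q_def
      by (simp add: mult.assoc[symmetric])
  qed
  have mq: "\<bar>(p - n) / (p - 1)\<bar> / conj_exponent p = (n - p) / p"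
    using pn p by (simp add: conj_exponent_def field_simps)
  show "\<bar>(p - n) / (p - 1)\<bar> / conj_exponent p * weighted_integral p p r u powr (1 / p) + boundary_quotient p r u
      \<le> ?E powr (1 / p)"
  proof (cases "A = 0")
    case True
    then show ?thesis by (simp add: quot A_eq)
  next
    case False
    with A have Apos: "A > 0" by simp
    have "A powr (- (1 / q)) * (r powr (n - p) * F + (n - p) * A) \<le> A powr (- (1 / q)) * (p * (A powr (1 / q) * ?E powr (1 / p)))"
      using real_le by (intro mult_left_mono) auto
    also have "\<dots> = p * ?E powr (1 / p)"
      using Apos by (simp add: powr_minus field_simps)
    also have "A powr (- (1 / q)) * (r powr (n - p) * F + (n - p) * A) =
        r powr (n - p) * F * A powr (- (1 / q)) + (n - p) * A powr (1 / p)"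
    proof -
      have "A powr (- (1 / q)) * A powr 1 = A powr (1 / p)"
        unfolding powr_add[symmetric] q by simp
      then show ?thesis using Apos by (simp add: distrib_left mult_ac)
    qed
    finally show ?thesis
      unfolding quot A_eq mq using p by (simp add: field_simps)
  qed
qed

section \<open>Radial functions\<close>

lemma radial_function_weak_gradient:
  fixes U U' :: "real \<Rightarrow> real"
  assumes U: "\<And>t. t > 0 \<Longrightarrow> (U has_real_derivative U' t) (at t)" and U': "continuous_on {0<..} U'" and r: "r > 0"
  defines "u \<equiv> \<lambda>x :: real ^ 'n::finite. U (norm x)"
  shows "u weakly_differentiable_on (- cball 0 r)"
    and "AE x in lborel. x \<in> - cball 0 r \<longrightarrow> radial_derivative r u x = U' (norm x)"
proof -
  let ?\<Omega> = "- cball (0 :: real ^ 'n) r"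
  define G where "G x = U' (norm x) *\<^sub>R sgn x" for x :: "real ^ 'n"
  have \<Omega>: "open ?\<Omega>" by (simp add: open_Compl)
  have x0: "x \<noteq> 0" if "x \<in> ?\<Omega>" for x using that r by auto
  have G: "is_weak_gradient ?\<Omega> u G"
  proof (rule is_weak_gradient_classical[OF \<Omega>])
    fix x assume x: "x \<in> ?\<Omega>"
    have "(norm has_derivative (\<lambda>h. h \<bullet> sgn x)) (at x)"
      by (rule has_derivative_norm[OF x0[OF x]])
    moreover have "(U has_derivative (*) (U' (norm x))) (at (norm x))"
      using U[of "norm x"] x0[OF x] by (simp add: has_field_derivative_def)
    ultimately have "(u has_derivative (\<lambda>h. U' (norm x) * (h \<bullet> sgn x))) (at x)"
      unfolding u_def by (rule has_derivative_compose)
    then show "(u has_derivative (\<lambda>h. G x \<bullet> h)) (at x)"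
      by (rule has_derivative_eq_rhs) (simp add: fun_eq_iff G_def inner_commute)
  next
    show "continuous_on ?\<Omega> G"
      unfolding G_def sgn_div_norm using x0
      by (intro continuous_intros continuous_on_compose2[OF U']) auto
  qed
  then show "u weakly_differentiable_on ?\<Omega>"
    unfolding weakly_differentiable_on_def by blast
  have "is_weak_gradient ?\<Omega> u (weak_gradient ?\<Omega> u)"
    unfolding weak_gradient_def using G by (rule someI[of "is_weak_gradient ?\<Omega> u"])
  from weak_gradient_unique[OF \<Omega> this G]
  show "AE x in lborel. x \<in> ?\<Omega> \<longrightarrow> radial_derivative r u x = U' (norm x)"
  proof eventually_elim
    fix x assume x: "x \<in> ?\<Omega> \<longrightarrow> weak_gradient ?\<Omega> u x = G x"
    show "x \<in> ?\<Omega> \<longrightarrow> radial_derivative r u x = U' (norm x)"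
    proof
      assume "x \<in> ?\<Omega>"
      moreover have "x \<bullet> sgn x = norm x"
        using x0[OF \<open>x \<in> ?\<Omega>\<close>] by (simp add: sgn_div_norm dot_square_norm power2_eq_square)
      ultimately show "radial_derivative r u x = U' (norm x)"
        using x x0 by (simp add: radial_derivative_def G_def)
    qed
  qed
qed

text \<open>A radial function with continuously differentiable profile is its own ray representative.\<close>

lemma radial_function_trace:
  fixes U U' :: "real \<Rightarrow> real"
  assumes U: "\<And>t. t > 0 \<Longrightarrow> (U has_real_derivative U' t) (at t)" and U': "continuous_on {0<..} U'" and r: "r > 0"
  defines "u \<equiv> \<lambda>x :: real ^ 'n::finite. U (norm x)"
  shows "AE w in direction_measure. \<forall>t\<ge>r. ray_trace r u (t *\<^sub>R w) = u (t *\<^sub>R w)"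
proof -
  have AC: "absolutely_continuous_on_interval r R U" for R
  proof (rule absolutely_continuous_on_interval_primitive)
    have c: "continuous_on {a..b} U'" if "r \<le> a" for a b
      using that r by (intro continuous_on_subset[OF U']) auto
    show "integrable lborel (\<lambda>t. indicator {r..R} t * U' t)"
      using borel_integrable_atLeastAtMost'[OF c] by (simp add: set_integrable_def)
    fix s t assume st: "r \<le> s" "s \<le> t" "t \<le> R"
    have "(\<integral>x. indicator {s..t} x *\<^sub>R U' x \<partial>lborel) = U t - U s"
      using st r U by (intro integral_FTC_atLeastAtMost c)
        (auto simp: has_real_derivative_iff_has_vector_derivative[symmetric] intro: has_field_derivative_at_within)
    moreover have "(\<integral>x. indicator {s..t} x * (indicator {r..R} x * U' x) \<partial>lborel) = (\<integral>x. indicator {s..t} x *\<^sub>R U' x \<partial>lborel)"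
      using st by (intro Bochner_Integration.integral_cong) (auto simp: indicator_def)
    ultimately show "U t - U s = (\<integral>x. indicator {s..t} x * (indicator {r..R} x * U' x) \<partial>lborel)"
      by simp
  qed
  have AC': "absolutely_continuous_on_interval r R (\<lambda>t. u (t *\<^sub>R w))" if "norm w = 1" for R w
  proof -
    have "u (t *\<^sub>R w) = U t" if "t \<ge> r" for t using that \<open>norm w = 1\<close> r by (simp add: u_def)
    then have eq: "(\<Sum>(s, t)\<in>D. \<bar>u (t *\<^sub>R w) - u (s *\<^sub>R w)\<bar>) = (\<Sum>(s, t)\<in>D. \<bar>U t - U s\<bar>)"
      if "D \<subseteq> {(s, t). r \<le> s \<and> s \<le> t \<and> t \<le> R}" for D
      using that by (intro sum.cong) auto
    show ?thesis
      using AC[of R] unfolding absolutely_continuous_on_interval_def by (simp add: eq cong: conj_cong imp_cong)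
  qed
  have "is_ray_representative r u u"
    unfolding is_ray_representative_def AE_sphere_measure_iff[OF zero_less_one] scaleR_one
    using AE_direction_measure_norm by (auto elim: eventually_mono intro: AC')
  moreover from this have "is_ray_representative r u (ray_trace r u)"
    unfolding ray_trace_def by (rule someI[of "is_ray_representative r u"])
  ultimately show ?thesis
    using ray_representative_unique[OF r] by blast
qed

lemma nn_integral_radial:
  fixes h :: "real \<Rightarrow> real"
  assumes [measurable]: "h \<in> borel_measurable borel" and h: "\<And>t. t > 0 \<Longrightarrow> h t \<ge> 0" and r: "r > 0"
    and I: "(\<integral>\<^sup>+t. ennreal (h t * t powr (real CARD('n) - 1)) * indicator {r<..} t \<partial>lborel) = ennreal c" "c \<ge> 0"
  shows "(\<integral>\<^sup>+x. ennreal (h (norm (x :: real ^ 'n::finite))) * indicator {r<..} (norm x) \<partial>lborel) =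
    ennreal (measure (direction_measure :: (real ^ 'n) measure) UNIV * c)"
proof -
  let ?S = "measure (direction_measure :: (real ^ 'n) measure) UNIV"
  have "(\<integral>\<^sup>+x. ennreal (h (norm (x :: real ^ 'n))) * indicator {r<..} (norm x) \<partial>lborel) =
    (\<integral>\<^sup>+t. (\<integral>\<^sup>+w. ennreal (h (norm (t *\<^sub>R (w :: real ^ 'n)))) \<partial>direction_measure) * ennreal (t powr (DIM(real ^ 'n) - 1)) * indicator {r<..} t \<partial>lborel)"
    using r by (intro nn_integral_polar_radial) auto
  also have "\<dots> = (\<integral>\<^sup>+t. ennreal ?S * (ennreal (h t * t powr (real CARD('n) - 1)) * indicator {r<..} t) \<partial>lborel)"
  proof (rule nn_integral_cong)
    fix t
    show "(\<integral>\<^sup>+w. ennreal (h (norm (t *\<^sub>R (w :: real ^ 'n)))) \<partial>direction_measure) * ennreal (t powr (DIM(real ^ 'n) - 1)) * indicator {r<..} t =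
      ennreal ?S * (ennreal (h t * t powr (real CARD('n) - 1)) * indicator {r<..} t)"
    proof (cases "t > r")
      case True
      with r have t: "t > 0" by simp
      have "(\<integral>\<^sup>+w. ennreal (h (norm (t *\<^sub>R (w :: real ^ 'n)))) \<partial>direction_measure) = (\<integral>\<^sup>+w. ennreal (h t) \<partial>(direction_measure :: (real ^ 'n) measure))"
      proof (rule nn_integral_cong_AE)
        show "AE w in direction_measure. ennreal (h (norm (t *\<^sub>R (w :: real ^ 'n)))) = ennreal (h t)"
          using AE_direction_measure_norm by eventually_elim (use t in simp)
      qed
      also have "\<dots> = ennreal (h t) * ennreal ?S"
        by (simp add: direction_measure.emeasure_eq_measure)
      finally show ?thesis
        using True h[OF t] by (simp add: ennreal_mult of_nat_diff Suc_le_eq mult_ac)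
    qed simp
  qed
  also have "\<dots> = ennreal ?S * ennreal c"
    by (subst nn_integral_cmult) (auto simp: I)
  also have "\<dots> = ennreal (?S * c)" using I(2) by (simp add: ennreal_mult)
  finally show ?thesis .
qed

lemma radial_weighted_integral:
  fixes U :: "real \<Rightarrow> real"
  assumes [measurable]: "U \<in> borel_measurable borel" and r: "r > 0"
    and I: "(\<integral>\<^sup>+t. ennreal (\<bar>U t\<bar> powr p * t powr (real CARD('n) - 1 - s)) * indicator {r<..} t \<partial>lborel) = ennreal c" "c \<ge> 0"
  defines "u \<equiv> \<lambda>x :: real ^ 'n::finite. U (norm x)"
  shows "set_integrable lebesgue (- cball 0 r) (\<lambda>x. \<bar>u x\<bar> powr p / norm x powr s)"
    and "weighted_integral p s r u = measure (direction_measure :: (real ^ 'n) measure) UNIV * c"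
proof -
  have "(\<integral>\<^sup>+t. ennreal (\<bar>U t\<bar> powr p / t powr s * t powr (real CARD('n) - 1)) * indicator {r<..} t \<partial>lborel) =
     (\<integral>\<^sup>+t. ennreal (\<bar>U t\<bar> powr p * t powr (real CARD('n) - 1 - s)) * indicator {r<..} t \<partial>lborel)"
    by (intro nn_integral_cong) (simp add: powr_diff mult_ac)
  then have X: "(\<integral>\<^sup>+x. ennreal (\<bar>u x\<bar> powr p / norm x powr s) * indicator {r<..} (norm x) \<partial>lborel) =
      ennreal (measure (direction_measure :: (real ^ 'n) measure) UNIV * c)"
    unfolding u_def using I r by (intro nn_integral_radial[where h = "\<lambda>t. \<bar>U t\<bar> powr p / t powr s"]) auto
  have [measurable]: "u \<in> borel_measurable borel" unfolding u_def by measurable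
  have "AE x in lborel. x \<in> - cball 0 r \<longrightarrow> \<bar>u x\<bar> powr p / norm x powr s = \<bar>u x\<bar> powr p / norm x powr s" by simp
  note ext = exterior_integral[OF _ _ this]
  show "set_integrable lebesgue (- cball 0 r) (\<lambda>x. \<bar>u x\<bar> powr p / norm x powr s)"
    using ext(1) X by simp
  show "weighted_integral p s r u = measure (direction_measure :: (real ^ 'n) measure) UNIV * c"
    unfolding weighted_integral_def using ext(2) X I(2) by simp
qed

text \<open>For a radial function all quantities are one-dimensional integrals of the profile, times the total
  surface measure of the unit sphere. This common factor cancels in the equalities.\<close>

lemma radial_function_M1:
  fixes U U' :: "real \<Rightarrow> real"
  defines "n \<equiv> real CARD('n::finite)"
  assumes U: "\<And>t. t > 0 \<Longrightarrow> (U has_real_derivative U' t) (at t)" and U': "continuous_on {0<..} U'" and r: "r > 0"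
    and [measurable]: "U \<in> borel_measurable borel" "U' \<in> borel_measurable borel"
    and E: "(\<integral>\<^sup>+t. ennreal (\<bar>U' t\<bar> powr p * t powr (n - 1)) * indicator {r<..} t \<partial>lborel) = ennreal e" "e \<ge> 0"
    and W: "(\<integral>\<^sup>+t. ennreal (\<bar>U t\<bar> powr p * t powr (n - 1 - (n - 1) * conj_exponent p)) * indicator {r<..} t \<partial>lborel) = ennreal c" "c \<ge> 0"
    and lim: "((\<lambda>R. R powr (if (p - n) / (p - 1) \<ge> 0 then 0 else n - p) * \<bar>U R\<bar> powr p) \<longlongrightarrow> 0) at_top"
  defines "u \<equiv> \<lambda>x :: real ^ 'n. U (norm x)"
  shows "u \<in> M1 p r"
    and "radial_energy p r u = measure (direction_measure :: (real ^ 'n) measure) UNIV * e"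
    and "boundary_integral p r u = r powr (n - 1) * (measure (direction_measure :: (real ^ 'n) measure) UNIV * \<bar>U r\<bar> powr p)"
proof -
  let ?S = "measure (direction_measure :: (real ^ 'n) measure) UNIV"
  define m where "m = (p - n) / (p - 1)"
  let ?w = "\<lambda>R. R powr (if m \<ge> 0 then 0 else n - p) * \<bar>U R\<bar> powr p"
  have um [measurable]: "u \<in> borel_measurable borel" unfolding u_def by measurable
  have wd: "u weakly_differentiable_on (- cball 0 r)"
    unfolding u_def by (rule radial_function_weak_gradient(1)[OF _ U' r]) (rule U)
  have rd: "AE x in lborel. x \<in> - cball 0 r \<longrightarrow> radial_derivative r u x = U' (norm x)"
    unfolding u_def by (rule radial_function_weak_gradient(2)[OF _ U' r]) (rule U)
  have tr: "AE w in direction_measure. \<forall>t\<ge>r. ray_trace r u (t *\<^sub>R w) = u (t *\<^sub>R w)"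
    unfolding u_def by (rule radial_function_trace[OF _ U' r]) (rule U)
  have ae: "AE x in lborel. x \<in> - cball 0 r \<longrightarrow> \<bar>radial_derivative r u x\<bar> powr p = \<bar>U' (norm x)\<bar> powr p"
    using rd by eventually_elim simp
  have X: "(\<integral>\<^sup>+x. ennreal (\<bar>U' (norm (x :: real ^ 'n))\<bar> powr p) * indicator {r<..} (norm x) \<partial>lborel) = ennreal (?S * e)"
    using E r unfolding n_def by (intro nn_integral_radial[where h = "\<lambda>t. \<bar>U' t\<bar> powr p"]) auto
  note ext = exterior_integral[OF _ _ ae]
  have int: "set_integrable lebesgue (- cball 0 r) (\<lambda>x. \<bar>radial_derivative r u x\<bar> powr p)"
    using ext(1) X by simp
  show "radial_energy p r u = ?S * e"
    unfolding radial_energy_def using ext(2) X E(2) by simp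
  have F: "sphere_power p u t = ennreal (?S * \<bar>U t\<bar> powr p)" if "t > 0" for t
  proof -
    have "sphere_power p u t = (\<integral>\<^sup>+w. ennreal (\<bar>U t\<bar> powr p) \<partial>(direction_measure :: (real ^ 'n) measure))"
      unfolding sphere_power_def
    proof (rule nn_integral_cong_AE)
      show "AE w in direction_measure. ennreal (\<bar>u (t *\<^sub>R w)\<bar> powr p) = ennreal (\<bar>U t\<bar> powr p)"
        using AE_direction_measure_norm by eventually_elim (use that in \<open>simp add: u_def\<close>)
    qed
    then show ?thesis
      by (simp add: direction_measure.emeasure_eq_measure ennreal_mult mult.commute)
  qed
  show "boundary_integral p r u = r powr (n - 1) * (?S * \<bar>U r\<bar> powr p)"
    unfolding boundary_integral_eq(2)[OF r um tr] F[OF r] n_def by simp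
  have lim_S: "((\<lambda>R. ennreal (?S * (?w R))) \<longlongrightarrow> ennreal (?S * 0)) at_top"
    using lim unfolding m_def by (intro tendsto_ennrealI tendsto_mult_left)
  have "((\<lambda>R. ennreal (R powr (if m \<ge> 0 then 1 - n else 1 - p)) *
           (\<integral>\<^sup>+ x. ennreal (\<bar>ray_trace r u x\<bar> powr p) \<partial>sphere_measure R)) \<longlongrightarrow> 0) at_top"
  proof (rule Lim_transform_eventually[OF lim_S[unfolded mult_zero_right ennreal_0]])
    show "\<forall>\<^sub>F R in at_top. ennreal (?S * (?w R)) =
       ennreal (R powr (if m \<ge> 0 then 1 - n else 1 - p)) * (\<integral>\<^sup>+ x. ennreal (\<bar>ray_trace r u x\<bar> powr p) \<partial>sphere_measure R)"
      using eventually_ge_at_top[of r]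
    proof eventually_elim
      fix R assume R: "r \<le> R"
      have e: "R powr (if m \<ge> 0 then 1 - n else 1 - p) * R powr (n - 1) = R powr (if m \<ge> 0 then 0 else n - p)"
        by (simp add: powr_add[symmetric])
      show "ennreal (?S * (?w R)) =
       ennreal (R powr (if m \<ge> 0 then 1 - n else 1 - p)) * (\<integral>\<^sup>+ x. ennreal (\<bar>ray_trace r u x\<bar> powr p) \<partial>sphere_measure R)"
        using R r unfolding sphere_trace(1)[OF r R um tr] n_def[symmetric] e[symmetric]
        by (subst F) (simp_all add: ennreal_mult mult_ac)
    qed
  qed
  then show "u \<in> M1 p r"
    unfolding M1_def Let_def mem_Collect_eq n_def[symmetric] m_def[symmetric]
    using wd int radial_weighted_integral(1)[where 'n = 'n and s = "(n - 1) * conj_exponent p", OF \<open>U \<in> borel_measurable borel\<close> r _ W(2)] W(1)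
    unfolding u_def n_def by (intro conjI) auto
qed

section \<open>The extremal functions and the sharp inequalities\<close>

lemma exp_neg_powr_tendsto_0:
  fixes c m :: real
  assumes c: "c > 0" and m: "m > 0"
  shows "((\<lambda>t. exp (- (c * t powr m))) \<longlongrightarrow> 0) at_top"
proof -
  have exp_ln: "LIM t at_top. exp (m * ln t) :> at_top"
    using m by (intro filterlim_compose[OF exp_at_top] filterlim_tendsto_pos_mult_at_top[OF tendsto_const] ln_at_top) auto
  have "\<forall>\<^sub>F t in at_top. exp (m * ln t) = t powr m"
    using eventually_gt_at_top[of 0] by eventually_elim (simp add: powr_def)
  from filterlim_cong[OF refl refl this, THEN iffD1, OF exp_ln]
  have "LIM t at_top. t powr m :> at_top" .
  then have "LIM t at_top. c * t powr m :> at_top"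
    using c by (intro filterlim_tendsto_pos_mult_at_top[OF tendsto_const]) auto
  then show ?thesis
    by (intro filterlim_compose[OF exp_at_bot filterlim_compose[OF filterlim_uminus_at_bot_at_top]])
qed

text \<open>Since (m - 1) p = - (n - 1) p', the integrands of the energy and of the weighted integral are
  proportional with factor (\<alpha> m)^p, and since n - 1 - (n - 1) p' = m - 1 they have an elementary primitive.\<close>

lemma exp_powr_extremal:
  fixes p r \<alpha> :: real
  defines "n \<equiv> real CARD('n::finite)" and "q \<equiv> conj_exponent p"
  assumes p: "p > 1" and r: "r > 0" and m: "m = (p - n) / (p - 1)" "m > 0" and \<alpha>: "\<alpha> > 0"
  defines "u \<equiv> \<lambda>x :: real ^ 'n. exp (- \<alpha> * norm x powr m)"
  shows "u \<in> M1 p r"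
    and "weighted_integral p ((n - 1) * q) r u powr (1 / q) * radial_energy p r u powr (1 / p) =
      1 / p * r powr (1 - n) * boundary_integral p r u"
proof -
  let ?S = "measure (direction_measure :: (real ^ 'n) measure) UNIV"
  define U where "U t = exp (- \<alpha> * t powr m)" for t :: real
  define U' where "U' t = - (\<alpha> * m * t powr (m - 1)) * exp (- \<alpha> * t powr m)" for t :: real
  have U: "(U has_real_derivative U' t) (at t)" if "t > 0" for t
    unfolding U_def U'_def using that by (auto intro!: derivative_eq_intros)
  have U': "continuous_on {0<..} U'"
    unfolding U'_def by (intro continuous_intros) auto
  have [measurable]: "U \<in> borel_measurable borel" "U' \<in> borel_measurable borel"
    unfolding U_def U'_def by measurable
  have q: "1 / q = 1 - 1 / p" using p by (auto simp: q_def conj_exponent_def field_simps)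
  have exps: "n - 1 - (n - 1) * q = m - 1" "(m - 1) * p + (n - 1) = m - 1"
    using p by (auto simp: q_def conj_exponent_def m(1) field_simps)
  define c where "c = exp (- \<alpha> * p * r powr m) / (\<alpha> * p * m)"
  have c: "c \<ge> 0" unfolding c_def using \<alpha> p m(2) by (intro divide_nonneg_pos mult_pos_pos) auto
  have pow: "\<bar>U t\<bar> powr p = exp (- \<alpha> * p * t powr m)" for t
    by (simp add: U_def powr_def mult_ac)
  have I: "(\<integral>\<^sup>+t. ennreal (exp (- \<alpha> * p * t powr m) * t powr (m - 1)) * indicator {r<..} t \<partial>lborel) = ennreal c"
  proof -
    define F where "F t = - (exp (- \<alpha> * p * t powr m) / (\<alpha> * p * m))" for t
    have "(\<integral>\<^sup>+t. ennreal (exp (- \<alpha> * p * t powr m) * t powr (m - 1)) * indicator {r<..} t \<partial>lborel) =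
      (\<integral>\<^sup>+t. ennreal (exp (- \<alpha> * p * t powr m) * t powr (m - 1)) * indicator {r..} t \<partial>lborel)"
      using AE_lborel_singleton[of r] by (intro nn_integral_cong_AE) (auto simp: indicator_def elim: eventually_mono)
    also have "\<dots> = ennreal (0 - F r)"
    proof (rule nn_integral_FTC_atLeast)
      show "DERIV F t :> exp (- \<alpha> * p * t powr m) * t powr (m - 1)" if "r \<le> t" for t
        unfolding F_def using that r \<alpha> p m(2) by (auto intro!: derivative_eq_intros)
      have "((\<lambda>t. exp (- (\<alpha> * p * t powr m))) \<longlongrightarrow> 0) at_top"
        using \<alpha> p m(2) by (intro exp_neg_powr_tendsto_0) auto
      then have "((\<lambda>t. - (exp (- (\<alpha> * p * t powr m)) / (\<alpha> * p * m))) \<longlongrightarrow> - (0 / (\<alpha> * p * m))) at_top"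
        using \<alpha> p m(2) by (intro tendsto_minus tendsto_divide tendsto_const) auto
      then show "(F \<longlongrightarrow> 0) at_top" by (simp add: F_def[abs_def])
    qed (use r in auto)
    finally show ?thesis by (simp add: F_def c_def)
  qed
  have W: "(\<integral>\<^sup>+t. ennreal (\<bar>U t\<bar> powr p * t powr (n - 1 - (n - 1) * q)) * indicator {r<..} t \<partial>lborel) = ennreal c"
    unfolding exps pow by (rule I)
  have E: "(\<integral>\<^sup>+t. ennreal (\<bar>U' t\<bar> powr p * t powr (n - 1)) * indicator {r<..} t \<partial>lborel) = ennreal ((\<alpha> * m) powr p * c)"
  proof -
    have "(\<integral>\<^sup>+t. ennreal (\<bar>U' t\<bar> powr p * t powr (n - 1)) * indicator {r<..} t \<partial>lborel) =
      (\<integral>\<^sup>+t. ennreal ((\<alpha> * m) powr p) * (ennreal (exp (- \<alpha> * p * t powr m) * t powr (m - 1)) * indicator {r<..} t) \<partial>lborel)"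
    proof (rule nn_integral_cong)
      fix t
      have "\<bar>U' t\<bar> powr p * t powr (n - 1) = (\<alpha> * m) powr p * (exp (- \<alpha> * p * t powr m) * t powr (m - 1))" if "t > r"
      proof -
        have "\<bar>U' t\<bar> = \<alpha> * m * t powr (m - 1) * U t"
          using \<alpha> m(2) by (simp add: U'_def U_def abs_mult)
        then have 1: "\<bar>U' t\<bar> powr p = (\<alpha> * m) powr p * t powr ((m - 1) * p) * exp (- \<alpha> * p * t powr m)"
          using \<alpha> m(2) pow[of t] by (simp add: powr_mult powr_powr U_def)
        have 2: "t powr (m - 1) = t powr ((m - 1) * p) * t powr (n - 1)"
          unfolding powr_add[symmetric] exps(2) ..
        show ?thesis unfolding 1 2 by (simp only: mult_ac)
      qed
      then show "ennreal (\<bar>U' t\<bar> powr p * t powr (n - 1)) * indicator {r<..} t =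
        ennreal ((\<alpha> * m) powr p) * (ennreal (exp (- \<alpha> * p * t powr m) * t powr (m - 1)) * indicator {r<..} t)"
        by (cases "t > r") (simp_all add: ennreal_mult)
    qed
    also have "\<dots> = ennreal ((\<alpha> * m) powr p) * ennreal c"
      unfolding I[symmetric] by (rule nn_integral_cmult) measurable
    finally show ?thesis using c by (simp add: ennreal_mult)
  qed
  have lim: "((\<lambda>R. R powr (if (p - n) / (p - 1) \<ge> 0 then 0 else n - p) * \<bar>U R\<bar> powr p) \<longlongrightarrow> 0) at_top"
  proof (rule Lim_transform_eventually)
    show "((\<lambda>t. exp (- (\<alpha> * p * t powr m))) \<longlongrightarrow> 0) at_top"
      using \<alpha> p m(2) by (intro exp_neg_powr_tendsto_0) auto
    show "\<forall>\<^sub>F R in at_top. exp (- (\<alpha> * p * R powr m)) = R powr (if (p - n) / (p - 1) \<ge> 0 then 0 else n - p) * \<bar>U R\<bar> powr p"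
      using eventually_gt_at_top[of 0] by eventually_elim (use m in \<open>simp add: pow\<close>)
  qed
  have u_eq: "u = (\<lambda>x. U (norm x))" by (simp add: u_def U_def fun_eq_iff)
  have c': "(\<alpha> * m) powr p * c \<ge> 0" using c by simp
  note M = radial_function_M1[where 'n = 'n, of U U' r p, folded n_def q_def u_eq, OF U U' r _ _ E c' W c lim]
  show "u \<in> M1 p r" by (rule M(1)) auto
  have re: "radial_energy p r u = ?S * ((\<alpha> * m) powr p * c)" by (rule M(2)) auto
  have bi: "boundary_integral p r u = r powr (n - 1) * (?S * \<bar>U r\<bar> powr p)" by (rule M(3)) auto
  have wi: "weighted_integral p ((n - 1) * q) r u = ?S * c"
    unfolding u_eq using W c r unfolding n_def by (intro radial_weighted_integral(2)) auto
  have "weighted_integral p ((n - 1) * q) r u powr (1 / q) * radial_energy p r u powr (1 / p) =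
     ((?S * c) powr (1 / q) * (?S * c) powr (1 / p)) * (\<alpha> * m)"
    unfolding wi re using c p \<alpha> m(2) by (simp add: powr_mult powr_powr mult_ac)
  also have "(?S * c) powr (1 / q) * (?S * c) powr (1 / p) = ?S * c"
    unfolding powr_add[symmetric] q using c by simp
  also have "?S * c * (\<alpha> * m) = 1 / p * (?S * \<bar>U r\<bar> powr p)"
    using \<alpha> m(2) p by (simp add: c_def pow field_simps)
  also have "\<dots> = 1 / p * r powr (1 - n) * boundary_integral p r u"
  proof -
    have "r powr (1 - n) * r powr (n - 1) = 1" using r by (simp add: powr_add[symmetric])
    then show ?thesis unfolding bi by (simp add: mult.assoc[symmetric])
  qed
  finally show "weighted_integral p ((n - 1) * q) r u powr (1 / q) * radial_energy p r u powr (1 / p) =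
      1 / p * r powr (1 - n) * boundary_integral p r u" .
qed

lemma nn_integral_powr_tail:
  assumes "r > 0" "b < 0"
  shows "(\<integral>\<^sup>+t. ennreal (t powr (b - 1)) * indicator {r<..} t \<partial>lborel) = ennreal (r powr b / (- b))"
proof -
  have scale: "ennreal (1 / (- b)) * ennreal ((- b) * y) = ennreal y" if "y \<ge> 0" for y
    using assms that by (subst ennreal_mult[symmetric]) (auto simp: mult_nonpos_nonneg)
  have "(\<integral>\<^sup>+t. ennreal (t powr (b - 1)) * indicator {r<..} t \<partial>lborel) =
    (\<integral>\<^sup>+t. ennreal (1 / (- b)) * (ennreal ((- b) * t powr (- (- b) - 1)) * indicator {r..} t) \<partial>lborel)"
  proof (rule nn_integral_cong_AE)
    show "AE t in lborel. ennreal (t powr (b - 1)) * indicator {r<..} t =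
      ennreal (1 / (- b)) * (ennreal ((- b) * t powr (- (- b) - 1)) * indicator {r..} t)"
      using AE_lborel_singleton[of r]
    proof eventually_elim
      fix t :: real assume "t \<noteq> r"
      then show "ennreal (t powr (b - 1)) * indicator {r<..} t =
        ennreal (1 / (- b)) * (ennreal ((- b) * t powr (- (- b) - 1)) * indicator {r..} t)"
        unfolding mult.assoc[symmetric] scale[OF powr_ge_zero] by (simp add: indicator_def)
    qed
  qed
  also have "\<dots> = ennreal (1 / (- b)) * ennreal (r powr (- (- b)))"
    using assms by (subst nn_integral_cmult) (auto simp: nn_integral_tail_power[of r "- b", simplified])
  finally show ?thesis using assms by (simp add: ennreal_mult[symmetric])
qed

text \<open>Powers of |x|, for (ii) and (iii) together: the integrands of the energy and of the integral of
  |u|^p / |x|^p are proportional with factor |k|^p.\<close>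

lemma powr_extremal:
  fixes p r k :: real
  defines "n \<equiv> real CARD('n::finite)"
  assumes p: "p > 1" and r: "r > 0" and k: "k < 0" "k * p - p + n < 0"
    and lim_exp: "(if (p - n) / (p - 1) \<ge> 0 then 0 else n - p) + k * p < 0"
    and W_exp: "k * p - (n - 1) * conj_exponent p + n < 0"
  defines "u \<equiv> \<lambda>x :: real ^ 'n. norm x powr k" and "S \<equiv> measure (direction_measure :: (real ^ 'n) measure) UNIV"
    and "A \<equiv> r powr (k * p - p + n) / (- (k * p - p + n))"
  shows "u \<in> M1 p r"
    and "radial_energy p r u = \<bar>k\<bar> powr p * (S * A)"
    and "boundary_integral p r u = r powr (n - 1 + k * p) * S"
    and "weighted_integral p p r u = S * A"
proof -
  define U where "U t = t powr k" for t :: real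
  define U' where "U' t = k * t powr (k - 1)" for t :: real
  have U: "(U has_real_derivative U' t) (at t)" if "t > 0" for t
    unfolding U_def U'_def using that by (auto intro!: derivative_eq_intros)
  have U': "continuous_on {0<..} U'"
    unfolding U'_def by (intro continuous_intros) auto
  have [measurable]: "U \<in> borel_measurable borel" "U' \<in> borel_measurable borel"
    unfolding U_def U'_def by measurable
  have pow: "\<bar>U t\<bar> powr p = t powr (k * p)" for t by (simp add: U_def powr_powr)
  have tail: "(\<integral>\<^sup>+t. ennreal (\<bar>U t\<bar> powr p * t powr (n - 1 - s)) * indicator {r<..} t \<partial>lborel) =
      ennreal (r powr (k * p - s + n) / (- (k * p - s + n)))" if "k * p - s + n < 0" for s
    using nn_integral_powr_tail[OF r that] by (simp add: pow powr_add[symmetric] algebra_simps)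
  have A: "A \<ge> 0" using k by (simp add: A_def divide_nonneg_neg divide_nonpos_neg)
  have E: "(\<integral>\<^sup>+t. ennreal (\<bar>U' t\<bar> powr p * t powr (n - 1)) * indicator {r<..} t \<partial>lborel) = ennreal (\<bar>k\<bar> powr p * A)"
  proof -
    have "\<bar>U' t\<bar> powr p * t powr (n - 1) = \<bar>k\<bar> powr p * t powr (k * p - p + n - 1)" for t
    proof -
      have "\<bar>U' t\<bar> powr p = \<bar>k\<bar> powr p * t powr (k * p - p)"
        by (simp add: U'_def abs_mult powr_mult powr_powr left_diff_distrib)
      then show ?thesis by (simp add: mult.assoc powr_add[symmetric] algebra_simps)
    qed
    then have "(\<integral>\<^sup>+t. ennreal (\<bar>U' t\<bar> powr p * t powr (n - 1)) * indicator {r<..} t \<partial>lborel) =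
        (\<integral>\<^sup>+t. ennreal (\<bar>k\<bar> powr p) * (ennreal (t powr (k * p - p + n - 1)) * indicator {r<..} t) \<partial>lborel)"
      by (simp add: ennreal_mult mult.assoc)
    also have "\<dots> = ennreal (\<bar>k\<bar> powr p) * ennreal A"
      using nn_integral_powr_tail[OF r k(2)] by (subst nn_integral_cmult) (auto simp: A_def)
    finally show ?thesis using A by (simp add: ennreal_mult)
  qed
  define c where "c = r powr (k * p - (n - 1) * conj_exponent p + n) / (- (k * p - (n - 1) * conj_exponent p + n))"
  have c: "c \<ge> 0" using W_exp by (simp add: c_def divide_nonneg_neg divide_nonpos_neg)
  have W: "(\<integral>\<^sup>+t. ennreal (\<bar>U t\<bar> powr p * t powr (n - 1 - (n - 1) * conj_exponent p)) * indicator {r<..} t \<partial>lborel) = ennreal c"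
    unfolding c_def by (rule tail[OF W_exp])
  have lim: "((\<lambda>R. R powr (if (p - n) / (p - 1) \<ge> 0 then 0 else n - p) * \<bar>U R\<bar> powr p) \<longlongrightarrow> 0) at_top"
    unfolding pow powr_add[symmetric] using lim_exp by (intro tendsto_neg_powr filterlim_ident)
  have u_eq: "u = (\<lambda>x. U (norm x))" by (simp add: u_def U_def)
  have A': "\<bar>k\<bar> powr p * A \<ge> 0" using A by simp
  note M = radial_function_M1[where 'n = 'n, of U U' r p, folded n_def u_eq, OF U U' r _ _ E A' W c lim]
  show "u \<in> M1 p r" by (rule M(1)) auto
  have "radial_energy p r u = S * (\<bar>k\<bar> powr p * A)" unfolding S_def by (rule M(2)) auto
  then show "radial_energy p r u = \<bar>k\<bar> powr p * (S * A)" by simp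
  have "boundary_integral p r u = r powr (n - 1) * (S * \<bar>U r\<bar> powr p)" unfolding S_def by (rule M(3)) auto
  then show "boundary_integral p r u = r powr (n - 1 + k * p) * S" by (simp add: pow powr_add)
  show "weighted_integral p p r u = S * A"
    unfolding u_eq S_def using tail[OF k(2)] A r unfolding n_def A_def[unfolded n_def]
    by (intro radial_weighted_integral(2)) auto
qed

theorem proposition3p1:
  fixes p r n m p' :: real
  assumes n_def: "n = real CARD('n::finite)" and n_ge: "CARD('n) \<ge> 2"
    and p: "p > 1" and r: "r > 0"
    and p'_def: "p' = conj_exponent p"
    and m_def: "m = (p - n) / (p - 1)"
  shows
    "(m > 0 \<longrightarrow>
       (\<forall>u :: real ^ 'n \<Rightarrow> real. u \<in> M1 p r \<longrightarrow>
          boundary_integrable p r u \<and>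
          weighted_integral p ((n - 1) * p') r u powr (1 / p') * radial_energy p r u powr (1 / p)
            \<ge> 1 / p * r powr (1 - n) * boundary_integral p r u) \<and>
       (\<forall>\<alpha>>0. let u = (\<lambda>x :: real ^ 'n. exp (- \<alpha> * norm x powr m)) in
          u \<in> M1 p r \<and>
          weighted_integral p ((n - 1) * p') r u powr (1 / p') * radial_energy p r u powr (1 / p)
            = 1 / p * r powr (1 - n) * boundary_integral p r u)) \<and>
     (m < 0 \<longrightarrow>
       (\<forall>u :: real ^ 'n \<Rightarrow> real. u \<in> M1 p r \<longrightarrow>
          weighted_integrable p p r u \<and> boundary_integrable p r u \<and>
          radial_energy p r u powr (1 / p)
            \<ge> \<bar>m\<bar> / p' * weighted_integral p p r u powr (1 / p) + boundary_quotient p r u) \<and>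
       (\<forall>k>p'. let u = (\<lambda>x :: real ^ 'n. norm x powr (k * m)) in
          u \<in> M1 p r \<and>
          radial_energy p r u powr (1 / p)
            = \<bar>m\<bar> / p' * weighted_integral p p r u powr (1 / p) + boundary_quotient p r u)) \<and>
     (m = 0 \<longrightarrow>
       (\<forall>u :: real ^ 'n \<Rightarrow> real. u \<in> M1 p r \<longrightarrow>
          boundary_integrable n r u \<and>
          weighted_integral n n r u powr ((n - 1) / n) * radial_energy n r u powr (1 / n)
            \<ge> 1 / n * r powr (1 - n) * boundary_integral n r u) \<and>
       (\<forall>q<0. let u = (\<lambda>x :: real ^ 'n. norm x powr q) in
          u \<in> M1 p r \<and>
          weighted_integral n n r u powr ((n - 1) / n) * radial_energy n r u powr (1 / n)
            = 1 / n * r powr (1 - n) * boundary_integral n r u))"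
proof (intro conjI impI allI)
  fix u :: "real ^ 'n \<Rightarrow> real" assume "m > 0" "u \<in> M1 p r"
  then show "boundary_integrable p r u"
    "1 / p * r powr (1 - n) * boundary_integral p r u \<le>
       weighted_integral p ((n - 1) * p') r u powr (1 / p') * radial_energy p r u powr (1 / p)"
    unfolding p'_def using M1_inequality_nonneg[of u p r] p r by (simp_all add: m_def n_def)
next
  fix \<alpha> :: real assume "m > 0" "\<alpha> > 0"
  then show "let u = (\<lambda>x :: real ^ 'n. exp (- \<alpha> * norm x powr m)) in
          u \<in> M1 p r \<and>
          weighted_integral p ((n - 1) * p') r u powr (1 / p') * radial_energy p r u powr (1 / p)
            = 1 / p * r powr (1 - n) * boundary_integral p r u"
    unfolding Let_def p'_def n_def
    using exp_powr_extremal[where 'n = 'n, OF p r m_def[unfolded n_def]] by blast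
next
  fix u :: "real ^ 'n \<Rightarrow> real" assume "m < 0" "u \<in> M1 p r"
  then show "weighted_integrable p p r u" "boundary_integrable p r u"
    "\<bar>m\<bar> / p' * weighted_integral p p r u powr (1 / p) + boundary_quotient p r u \<le> radial_energy p r u powr (1 / p)"
    unfolding p'_def using M1_inequality_neg[of u p r] p r by (simp_all add: m_def n_def)
next
  fix k :: real assume m: "m < 0" and k: "k > p'"
  define \<kappa> where "\<kappa> = k * m"
  define u :: "real ^ 'n \<Rightarrow> real" where "u = (\<lambda>x. norm x powr \<kappa>)"
  define S where "S = measure (direction_measure :: (real ^ 'n) measure) UNIV"
  define b where "b = \<kappa> * p - p + n"
  define A where "A = r powr b / (- b)"
  have p'1: "p' > 1" using p by (simp add: p'_def conj_exponent_def)
  have q: "1 / p' = 1 - 1 / p" using p by (auto simp: p'_def conj_exponent_def field_simps)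
  have mp: "p - n = m * (p - 1)" using p by (simp add: m_def)
  have b_eq: "b = m * (k * p - (p - 1))"
    using mp by (simp add: b_def \<kappa>_def algebra_simps)
  have kp: "k * p > p" using k p'1 p by simp
  then have b: "b < 0" unfolding b_eq using m by (intro mult_neg_pos) auto
  have \<kappa>: "\<kappa> < 0" unfolding \<kappa>_def using m k p'1 by (intro mult_pos_neg) auto
  have e1: "\<kappa> * p - (n - 1) * p' + n < 0"
  proof -
    have "n - (n - 1) * p' = m"
      using p by (simp add: p'_def conj_exponent_def m_def field_simps)
    moreover have "\<kappa> * p < 0" using \<kappa> p by (intro mult_neg_pos) auto
    ultimately show ?thesis using m by (simp add: algebra_simps)
  qed
  have e2: "(if (p - n) / (p - 1) \<ge> 0 then 0 else n - p) + \<kappa> * p < 0"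
    using m b unfolding m_def[symmetric] b_def by simp
  note ext = powr_extremal[where 'n = 'n, folded n_def, OF p r \<kappa> b[unfolded b_def] e2 e1[unfolded p'_def],
      folded u_def S_def b_def, folded A_def]
  have A: "A > 0" using r b by (simp add: A_def divide_pos_neg)
  have S: "S \<ge> 0" by (simp add: S_def)
  have "radial_energy p r u powr (1 / p) = \<bar>m\<bar> / p' * weighted_integral p p r u powr (1 / p) + boundary_quotient p r u"
  proof (cases "S = 0")
    case True
    then show ?thesis unfolding boundary_quotient_eq ext(2-4) by simp
  next
    case False
    with S A have SA: "S * A > 0" by simp
    have quot: "boundary_quotient p r u = 1 / p * (- b) * (S * A) powr (1 / p)"
    proof -
      have "r powr (1 - p) * r powr (n - 1 + \<kappa> * p) = r powr b"
        by (simp add: b_def powr_add[symmetric] algebra_simps)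
      then have "r powr (1 - p) * boundary_integral p r u = (- b) * (S * A)"
        unfolding ext(3) using b by (simp add: A_def mult.assoc[symmetric])
      moreover have "(S * A) * (S * A) powr (- (1 / p')) = (S * A) powr (1 / p)"
        using SA powr_add[of "S * A" 1 "- (1 / p')"] q by simp
      ultimately show ?thesis
        unfolding boundary_quotient_eq ext(4) p'_def[symmetric] by (simp add: mult.assoc)
    qed
    have "radial_energy p r u powr (1 / p) = \<bar>\<kappa>\<bar> * (S * A) powr (1 / p)"
      unfolding ext(2) using SA p by (simp add: powr_mult powr_powr)
    also have "\<bar>\<kappa>\<bar> = \<bar>m\<bar> / p' + 1 / p * (- b)"
    proof -
      have "\<bar>\<kappa>\<bar> = - m * k" "\<bar>m\<bar> = - m" using m k p'1 by (simp_all add: \<kappa>_def abs_mult)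
      moreover have "\<bar>m\<bar> / p' = \<bar>m\<bar> * (1 - 1 / p)" using q by (metis times_divide_eq_right mult.right_neutral)
      ultimately show ?thesis unfolding b_eq using p by (simp add: field_simps)
    qed
    finally show ?thesis unfolding quot ext(4) by (simp add: distrib_right left_diff_distrib)
  qed
  with ext(1) show "let u = (\<lambda>x :: real ^ 'n. norm x powr (k * m)) in
          u \<in> M1 p r \<and>
          radial_energy p r u powr (1 / p)
            = \<bar>m\<bar> / p' * weighted_integral p p r u powr (1 / p) + boundary_quotient p r u"
    unfolding Let_def \<kappa>_def[symmetric] u_def[symmetric] by blast
next
  assume m0: "m = 0"
  then have pn: "p = n" using p by (simp add: m_def)
  have n: "n > 1" using p pn by simp
  have c: "(n - 1) * conj_exponent n = n" "1 / conj_exponent n = (n - 1) / n"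
    using n by (simp_all add: conj_exponent_def)
  {
    fix u :: "real ^ 'n \<Rightarrow> real" assume "u \<in> M1 p r"
    then show "boundary_integrable n r u"
      "1 / n * r powr (1 - n) * boundary_integral n r u \<le>
         weighted_integral n n r u powr ((n - 1) / n) * radial_energy n r u powr (1 / n)"
      using M1_inequality_nonneg[of u n r, folded n_def, unfolded c] n r by (simp_all add: pn)
  next
    fix q :: real assume q: "q < 0"
    define u :: "real ^ 'n \<Rightarrow> real" where "u = (\<lambda>x. norm x powr q)"
    define S where "S = measure (direction_measure :: (real ^ 'n) measure) UNIV"
    define A where "A = r powr (q * n) / (- (q * n))"
    have qn: "q * n < 0" using q n by (intro mult_neg_pos) auto
    have h: "q * n - n + n < 0" "(if (n - n) / (n - 1) \<ge> 0 then 0 else n - n) + q * n < 0" "q * n - (n - 1) * conj_exponent n + n < 0"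
      using qn c(1) by simp_all
    note ext = powr_extremal[where 'n = 'n, folded n_def, OF n r q h, folded u_def S_def]
    have A_eq: "r powr (q * n - n + n) / (- (q * n - n + n)) = A" by (simp add: A_def)
    note ext = ext[unfolded A_eq]
    have A: "A \<ge> 0" using qn by (simp add: A_def divide_nonneg_neg divide_nonpos_neg)
    have S: "S \<ge> 0" by (simp add: S_def)
    have "weighted_integral n n r u powr ((n - 1) / n) * radial_energy n r u powr (1 / n) =
        \<bar>q\<bar> * ((S * A) powr ((n - 1) / n) * (S * A) powr (1 / n))"
      unfolding ext(2,4) using A S n by (simp add: powr_mult powr_powr)
    also have "(S * A) powr ((n - 1) / n) * (S * A) powr (1 / n) = S * A"
    proof -
      have "(n - 1) / n + 1 / n = 1" using n by (simp add: field_simps)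
      then show ?thesis using A S by (simp add: powr_add[symmetric])
    qed
    also have "\<bar>q\<bar> * (S * A) = 1 / n * (S * r powr (q * n))"
      using q n by (simp add: A_def field_simps)
    also have "\<dots> = 1 / n * r powr (1 - n) * boundary_integral n r u"
    proof -
      have "r powr (1 - n) * r powr (n - 1 + q * n) = r powr (q * n)"
        by (simp add: powr_add[symmetric])
      then show ?thesis unfolding ext(3) by (simp add: mult_ac)
    qed
    finally show "let u = (\<lambda>x :: real ^ 'n. norm x powr q) in
          u \<in> M1 p r \<and>
          weighted_integral n n r u powr ((n - 1) / n) * radial_energy n r u powr (1 / n)
            = 1 / n * r powr (1 - n) * boundary_integral n r u"
      using ext(1) unfolding Let_def u_def[symmetric] pn by blast
  }
qed

end
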